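(* Up to isomorphism there is a unique $2$-$(496,4,1)$ design (linear space) admitting $\mathrm{P\Gamma L}(2,2^5)$ as a flag-transitive automorphism group. Moreover, $\mathrm{P\Gamma L}(2,2^5)$ is its full automorphism group.
   Context: A $2$-$(v,k,1)$ design (linear space with constant line size) consists of $v$ points and a family of $k$-subsets (lines) such that any two distinct points lie in exactly one line. An automorphism is a permutation of the points preserving the set of lines; a group of automorphisms is flag-transitive if it is transitive on incident point-line pairs. *)

theory Defs
  imports "HOL-Algebra.Algebra"
begin

section \<open>Designs and their automorphisms\<close>

text \<open>
  Two distinct points determine their line, so for \<open>k \<ge> 2\<close> a design with \<open>\<lambda> = 1\<close> has no
  repeated lines, and the family of lines can be taken to be a set of point sets.
\<close>

definition design2 :: "nat \<Rightarrow> nat \<Rightarrow> 'p set \<Rightarrow> 'p set set \<Rightarrow> bool" where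
  "design2 v k P L \<longleftrightarrow>
     finite P \<and> card P = v \<and>
     (\<forall>l\<in>L. l \<subseteq> P \<and> card l = k) \<and>
     (\<forall>x\<in>P. \<forall>y\<in>P. x \<noteq> y \<longrightarrow> (\<exists>!l. l \<in> L \<and> x \<in> l \<and> y \<in> l))"

definition design_iso :: "'p set \<Rightarrow> 'p set set \<Rightarrow> 'q set \<Rightarrow> 'q set set \<Rightarrow> bool" where
  "design_iso P L P' L' \<longleftrightarrow> (\<exists>f. bij_betw f P P' \<and> (\<lambda>l. f ` l) ` L = L')"

definition aut_group :: "'p set \<Rightarrow> 'p set set \<Rightarrow> ('p \<Rightarrow> 'p) monoid" where
  "aut_group P L = BijGroup P \<lparr>carrier := {f \<in> Bij P. (\<lambda>l. f ` l) ` L = L}\<rparr>"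

definition flag_transitive :: "'p set set \<Rightarrow> ('p \<Rightarrow> 'p) set \<Rightarrow> bool" where
  "flag_transitive L G \<longleftrightarrow>
     (\<forall>l\<in>L. \<forall>x\<in>l. \<forall>m\<in>L. \<forall>y\<in>m. \<exists>g\<in>G. g x = y \<and> g ` l = m)"

definition admits_flag_transitive ::
    "'p set \<Rightarrow> 'p set set \<Rightarrow> ('h, 'm) monoid_scheme \<Rightarrow> bool" where
  "admits_flag_transitive P L H \<longleftrightarrow>
     (\<exists>G. subgroup G (aut_group P L) \<and> flag_transitive L G \<and>
          aut_group P L \<lparr>carrier := G\<rparr> \<cong> H)"


section \<open>The group \<open>P\<Gamma>L(2, F)\<close>\<close>

definition vec2 :: "('f, 'm) ring_scheme \<Rightarrow> ('f \<times> 'f) set" where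
  "vec2 F = carrier F \<times> carrier F"

definition vadd :: "('f, 'm) ring_scheme \<Rightarrow> 'f \<times> 'f \<Rightarrow> 'f \<times> 'f \<Rightarrow> 'f \<times> 'f" where
  "vadd F u w = (fst u \<oplus>\<^bsub>F\<^esub> fst w, snd u \<oplus>\<^bsub>F\<^esub> snd w)"

definition vsmult :: "('f, 'm) ring_scheme \<Rightarrow> 'f \<Rightarrow> 'f \<times> 'f \<Rightarrow> 'f \<times> 'f" where
  "vsmult F a u = (a \<otimes>\<^bsub>F\<^esub> fst u, a \<otimes>\<^bsub>F\<^esub> snd u)"

definition semilinear2 :: "('f, 'm) ring_scheme \<Rightarrow> ('f \<times> 'f \<Rightarrow> 'f \<times> 'f) \<Rightarrow> bool" where
  "semilinear2 F f \<longleftrightarrow>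
     (\<exists>\<sigma> \<in> ring_iso F F.
        (\<forall>u\<in>vec2 F. \<forall>w\<in>vec2 F. f (vadd F u w) = vadd F (f u) (f w)) \<and>
        (\<forall>a\<in>carrier F. \<forall>u\<in>vec2 F. f (vsmult F a u) = vsmult F (\<sigma> a) (f u)))"

definition GammaL2 :: "('f, 'm) ring_scheme \<Rightarrow> ('f \<times> 'f \<Rightarrow> 'f \<times> 'f) monoid" where
  "GammaL2 F = BijGroup (vec2 F) \<lparr>carrier := {f \<in> Bij (vec2 F). semilinear2 F f}\<rparr>"

definition scalars2 :: "('f, 'm) ring_scheme \<Rightarrow> ('f \<times> 'f \<Rightarrow> 'f \<times> 'f) set" where
  "scalars2 F = (\<lambda>a. \<lambda>u\<in>vec2 F. vsmult F a u) ` (carrier F - {\<zero>\<^bsub>F\<^esub>})"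

definition PGammaL2 :: "('f, 'm) ring_scheme \<Rightarrow> ('f \<times> 'f \<Rightarrow> 'f \<times> 'f) set monoid" where
  "PGammaL2 F = GammaL2 F Mod scalars2 F"


section \<open>These are groups\<close>

lemma subgroup_BijGroupI:
  assumes "H \<subseteq> Bij S" "(\<lambda>x\<in>S. x) \<in> H"
    and "\<And>f g. f \<in> H \<Longrightarrow> g \<in> H \<Longrightarrow> compose S f g \<in> H"
    and "\<And>f. f \<in> H \<Longrightarrow> (\<lambda>x\<in>S. inv_into S f x) \<in> H"
  shows "subgroup H (BijGroup S)"
proof (rule subgroup.intro)
  show "H \<subseteq> carrier (BijGroup S)" using assms(1) by (simp add: BijGroup_def)
  show "\<one>\<^bsub>BijGroup S\<^esub> \<in> H" using assms(2) by (simp add: BijGroup_def)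
  show "x \<otimes>\<^bsub>BijGroup S\<^esub> y \<in> H" if "x \<in> H" "y \<in> H" for x y
    using that assms(1,3) by (auto simp: BijGroup_def subset_iff)
  show "inv\<^bsub>BijGroup S\<^esub> x \<in> H" if "x \<in> H" for x
    using that assms(1,4) by (auto simp: inv_BijGroup subset_iff)
qed

lemma group_aut_group:
  assumes "\<And>l. l \<in> L \<Longrightarrow> l \<subseteq> P"
  shows "group (aut_group P L)"
proof -
  have L: "(\<lambda>l. h ` l) ` L = (\<lambda>l. h' ` l) ` L" if "\<And>x. x \<in> P \<Longrightarrow> h x = h' x" for h h' :: "'a \<Rightarrow> 'a"
    by (rule image_cong) (use that assms in \<open>auto intro!: image_cong simp: subset_iff\<close>)
  have "subgroup {f \<in> Bij P. (\<lambda>l. f ` l) ` L = L} (BijGroup P)"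
  proof (rule subgroup_BijGroupI; (elim CollectE conjE)?;
      (intro CollectI conjI subsetI compose_Bij id_Bij restrict_inv_into_Bij; (elim CollectE conjE)?; assumption?)?)
    show "(\<lambda>l. (\<lambda>x\<in>P. x) ` l) ` L = L"
      using L[of "\<lambda>x\<in>P. x" "\<lambda>x. x"] by simp
  next
    fix f g assume "(\<lambda>l. f ` l) ` L = L" "(\<lambda>l. g ` l) ` L = L"
    then have "(\<lambda>l. f ` l) ` (\<lambda>l. g ` l) ` L = L" by simp
    moreover have "(\<lambda>l. f ` l) ` (\<lambda>l. g ` l) ` L = (\<lambda>l. (\<lambda>x. f (g x)) ` l) ` L"
      by (simp add: image_image)
    moreover have "\<dots> = (\<lambda>l. compose P f g ` l) ` L"
      by (rule L) (simp add: compose_eq)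
    ultimately show "(\<lambda>l. compose P f g ` l) ` L = L" by simp
  next
    fix f assume f: "f \<in> Bij P" "(\<lambda>l. f ` l) ` L = L"
    let ?i = "\<lambda>x\<in>P. inv_into P f x"
    have b: "bij_betw f P P" using f(1) by (simp add: Bij_def)
    have "?i (f x) = x" if "x \<in> P" for x
      using that b by (auto simp: bij_betw_def inv_into_f_f)
    then have "(\<lambda>l. (\<lambda>x. ?i (f x)) ` l) ` L = (\<lambda>l. (\<lambda>x. x) ` l) ` L"
      by (rule L)
    moreover have "(\<lambda>l. ?i ` l) ` (\<lambda>l. f ` l) ` L = (\<lambda>l. (\<lambda>x. ?i (f x)) ` l) ` L"
      by (simp only: image_image)
    ultimately show "(\<lambda>l. ?i ` l) ` L = L" using f(2) by simp
  qed
  then show ?thesis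
    unfolding aut_group_def by (rule group.subgroup_imp_group[OF group_BijGroup])
qed

context field
begin

lemma vadd_closed: "u \<in> vec2 R \<Longrightarrow> w \<in> vec2 R \<Longrightarrow> vadd R u w \<in> vec2 R"
  by (auto simp: vec2_def vadd_def)

lemma vsmult_closed: "a \<in> carrier R \<Longrightarrow> u \<in> vec2 R \<Longrightarrow> vsmult R a u \<in> vec2 R"
  by (auto simp: vec2_def vsmult_def)

lemma vsmult_vsmult:
  "\<lbrakk>a \<in> carrier R; b \<in> carrier R; u \<in> vec2 R\<rbrakk> \<Longrightarrow> vsmult R a (vsmult R b u) = vsmult R (a \<otimes> b) u"
  by (auto simp: vec2_def vsmult_def m_assoc)

lemma vsmult_vadd:
  "\<lbrakk>a \<in> carrier R; u \<in> vec2 R; w \<in> vec2 R\<rbrakk> \<Longrightarrow>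
   vsmult R a (vadd R u w) = vadd R (vsmult R a u) (vsmult R a w)"
  by (auto simp: vec2_def vsmult_def vadd_def r_distr)

lemma vsmult_one: "u \<in> vec2 R \<Longrightarrow> vsmult R \<one> u = u"
  by (auto simp: vec2_def vsmult_def)

lemma id_ring_iso: "(\<lambda>x. x) \<in> ring_iso R R"
  using ring_iso_set_refl[of R] by (simp add: id_def)

lemma subgroup_GammaL2: "subgroup {f \<in> Bij (vec2 R). semilinear2 R f} (BijGroup (vec2 R))"
proof (rule subgroup_BijGroupI; clarsimp simp: compose_Bij id_Bij restrict_inv_into_Bij)
  show "semilinear2 R (\<lambda>u\<in>vec2 R. u)"
    unfolding semilinear2_def
    by (rule bexI[OF _ id_ring_iso]) (auto simp: vadd_closed vsmult_closed)
next
  fix f g assume f: "f \<in> Bij (vec2 R)" "semilinear2 R f" and g: "g \<in> Bij (vec2 R)" "semilinear2 R g"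
  obtain s where s: "s \<in> ring_iso R R"
    "\<And>u w. u \<in> vec2 R \<Longrightarrow> w \<in> vec2 R \<Longrightarrow> f (vadd R u w) = vadd R (f u) (f w)"
    "\<And>a u. a \<in> carrier R \<Longrightarrow> u \<in> vec2 R \<Longrightarrow> f (vsmult R a u) = vsmult R (s a) (f u)"
    using f(2) unfolding semilinear2_def by blast
  obtain t where t: "t \<in> ring_iso R R"
    "\<And>u w. u \<in> vec2 R \<Longrightarrow> w \<in> vec2 R \<Longrightarrow> g (vadd R u w) = vadd R (g u) (g w)"
    "\<And>a u. a \<in> carrier R \<Longrightarrow> u \<in> vec2 R \<Longrightarrow> g (vsmult R a u) = vsmult R (t a) (g u)"
    using g(2) unfolding semilinear2_def by blast
  have gc: "g u \<in> vec2 R" if "u \<in> vec2 R" for u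
    using Bij_imp_funcset[OF g(1)] that by auto
  have tc: "t a \<in> carrier R" if "a \<in> carrier R" for a
    using t(1) that by (auto simp: ring_iso_def bij_betw_def)
  show "semilinear2 R (compose (vec2 R) f g)"
    unfolding semilinear2_def
    by (rule bexI[OF _ ring_iso_set_trans[OF t(1) s(1)]])
       (auto simp: compose_eq vadd_closed vsmult_closed s t gc tc)
next
  fix f assume f: "f \<in> Bij (vec2 R)" "semilinear2 R f"
  obtain s where s: "s \<in> ring_iso R R"
    "\<And>u w. u \<in> vec2 R \<Longrightarrow> w \<in> vec2 R \<Longrightarrow> f (vadd R u w) = vadd R (f u) (f w)"
    "\<And>a u. a \<in> carrier R \<Longrightarrow> u \<in> vec2 R \<Longrightarrow> f (vsmult R a u) = vsmult R (s a) (f u)"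
    using f(2) unfolding semilinear2_def by blast
  let ?i = "inv_into (vec2 R) f" and ?t = "inv_into (carrier R) s"
  have b: "bij_betw f (vec2 R) (vec2 R)" using f(1) by (simp add: Bij_def)
  have bs: "bij_betw s (carrier R) (carrier R)" using s(1) by (simp add: ring_iso_def)
  have ic: "?i u \<in> vec2 R" if "u \<in> vec2 R" for u
    using that f(1) by (rule Bij_inv_into_mem[rotated])
  have fi: "f (?i u) = u" if "u \<in> vec2 R" for u
    using that b by (simp add: bij_betw_inv_into_right)
  have fI: "?i (f u) = u" if "u \<in> vec2 R" for u
    using that b by (simp add: bij_betw_inv_into_left)
  have tc: "?t a \<in> carrier R" "s (?t a) = a" if "a \<in> carrier R" for a
    using that bs bij_betw_inv_into[OF bs] by (auto simp: bij_betw_inv_into_right bij_betw_apply)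
  have "?i (vadd R u w) = vadd R (?i u) (?i w)" if "u \<in> vec2 R" "w \<in> vec2 R" for u w
    using that s(2)[OF ic ic, of u w] fI[OF vadd_closed[OF ic ic], of u w] by (simp add: fi)
  moreover have "?i (vsmult R a u) = vsmult R (?t a) (?i u)" if "a \<in> carrier R" "u \<in> vec2 R" for a u
    using that s(3)[OF tc(1) ic, of a u] fI[OF vsmult_closed[OF tc(1) ic], of a u]
    by (simp add: fi tc)
  ultimately show "semilinear2 R (\<lambda>u\<in>vec2 R. ?i u)"
    unfolding semilinear2_def
    by (intro bexI[OF _ ring_iso_set_sym[OF ring_axioms s(1)]]) (auto simp: vadd_closed vsmult_closed)
qed

lemma group_GammaL2: "group (GammaL2 R)"
  unfolding GammaL2_def by (rule group.subgroup_imp_group[OF group_BijGroup subgroup_GammaL2])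

lemma scalars2_compose:
  assumes "a \<in> carrier R" "b \<in> carrier R"
  shows "compose (vec2 R) (\<lambda>u\<in>vec2 R. vsmult R a u) (\<lambda>u\<in>vec2 R. vsmult R b u)
           = (\<lambda>u\<in>vec2 R. vsmult R (a \<otimes> b) u)"
  using assms by (auto simp: fun_eq_iff compose_def vsmult_closed vsmult_vsmult)

lemma scalar_inverse:
  assumes "a \<in> carrier R - {\<zero>}"
  obtains b where "b \<in> carrier R - {\<zero>}" "a \<otimes> b = \<one>" "b \<otimes> a = \<one>"
  using assms by (metis Diff_iff field_Units Units_inv_Units Units_l_inv Units_r_inv)

lemma scalars2_subset: "scalars2 R \<subseteq> carrier (GammaL2 R)"
proof -
  have "(\<lambda>u\<in>vec2 R. vsmult R a u) \<in> Bij (vec2 R)" if a: "a \<in> carrier R - {\<zero>}" for a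
  proof -
    obtain b where "b \<in> carrier R - {\<zero>}" "a \<otimes> b = \<one>" "b \<otimes> a = \<one>"
      using scalar_inverse[OF a] .
    with a have "bij_betw (\<lambda>u\<in>vec2 R. vsmult R a u) (vec2 R) (vec2 R)"
      by (intro bij_betw_byWitness[where f' = "vsmult R b"])
         (auto simp: vsmult_closed vsmult_vsmult vsmult_one)
    then show ?thesis by (simp add: Bij_def)
  qed
  moreover have "semilinear2 R (\<lambda>u\<in>vec2 R. vsmult R a u)" if a: "a \<in> carrier R - {\<zero>}" for a
    unfolding semilinear2_def
    by (rule bexI[OF _ id_ring_iso])
       (use a in \<open>auto simp: vadd_closed vsmult_closed vsmult_vadd vsmult_vsmult m_comm\<close>)
  ultimately show ?thesis by (auto simp: scalars2_def GammaL2_def)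
qed

lemma GammaL2_mult:
  "f \<in> carrier (GammaL2 R) \<Longrightarrow> g \<in> carrier (GammaL2 R) \<Longrightarrow> f \<otimes>\<^bsub>GammaL2 R\<^esub> g = compose (vec2 R) f g"
  by (simp add: GammaL2_def BijGroup_def)

lemma GammaL2_one: "\<one>\<^bsub>GammaL2 R\<^esub> = (\<lambda>u\<in>vec2 R. u)"
  by (simp add: GammaL2_def BijGroup_def)

lemma scalars2_mult:
  assumes "a \<in> carrier R - {\<zero>}" "b \<in> carrier R - {\<zero>}"
  shows "(\<lambda>u\<in>vec2 R. vsmult R a u) \<otimes>\<^bsub>GammaL2 R\<^esub> (\<lambda>u\<in>vec2 R. vsmult R b u)
           = (\<lambda>u\<in>vec2 R. vsmult R (a \<otimes> b) u)"
proof -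
  have "(\<lambda>u\<in>vec2 R. vsmult R c u) \<in> carrier (GammaL2 R)" if "c \<in> carrier R - {\<zero>}" for c
    using that scalars2_subset by (auto simp: scalars2_def)
  then show ?thesis using assms by (simp add: GammaL2_mult scalars2_compose)
qed

lemma scalars2_one: "(\<lambda>u\<in>vec2 R. vsmult R \<one> u) = \<one>\<^bsub>GammaL2 R\<^esub>"
  by (auto simp: GammaL2_one fun_eq_iff vsmult_one)

lemma normal_scalars2: "scalars2 R \<lhd> GammaL2 R"
proof -
  interpret G: group "GammaL2 R" by (rule group_GammaL2)
  have sub: "subgroup (scalars2 R) (GammaL2 R)"
  proof (rule G.subgroupI)
    show "scalars2 R \<subseteq> carrier (GammaL2 R)" by (rule scalars2_subset)
    show "scalars2 R \<noteq> {}" using one_not_zero by (auto simp: scalars2_def)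
  next
    fix x assume "x \<in> scalars2 R"
    then obtain a where a: "a \<in> carrier R - {\<zero>}" "x = (\<lambda>u\<in>vec2 R. vsmult R a u)"
      by (auto simp: scalars2_def)
    obtain b where b: "b \<in> carrier R - {\<zero>}" "a \<otimes> b = \<one>" "b \<otimes> a = \<one>"
      using scalar_inverse[OF a(1)] .
    let ?y = "\<lambda>u\<in>vec2 R. vsmult R b u"
    have y: "?y \<in> scalars2 R" using b(1) by (auto simp: scalars2_def)
    have "?y \<otimes>\<^bsub>GammaL2 R\<^esub> x = \<one>\<^bsub>GammaL2 R\<^esub>"
      using a b by (simp add: scalars2_mult scalars2_one)
    then have "inv\<^bsub>GammaL2 R\<^esub> x = ?y"
      using \<open>x \<in> scalars2 R\<close> y scalars2_subset by (intro G.inv_equality) auto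
    then show "inv\<^bsub>GammaL2 R\<^esub> x \<in> scalars2 R" using y by simp
  next
    fix x y assume "x \<in> scalars2 R" "y \<in> scalars2 R"
    then obtain a b where "a \<in> carrier R - {\<zero>}" "x = (\<lambda>u\<in>vec2 R. vsmult R a u)"
        "b \<in> carrier R - {\<zero>}" "y = (\<lambda>u\<in>vec2 R. vsmult R b u)"
      by (auto simp: scalars2_def)
    then show "x \<otimes>\<^bsub>GammaL2 R\<^esub> y \<in> scalars2 R"
      by (auto simp: scalars2_mult scalars2_def integral_iff intro!: imageI)
  qed
  show ?thesis
  proof (rule G.normal_invI[OF sub])
    fix f x assume f: "f \<in> carrier (GammaL2 R)" and x: "x \<in> scalars2 R"
    obtain a where a: "a \<in> carrier R - {\<zero>}" "x = (\<lambda>u\<in>vec2 R. vsmult R a u)"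
      using x by (auto simp: scalars2_def)
    have fB: "f \<in> Bij (vec2 R)" "semilinear2 R f" using f by (auto simp: GammaL2_def)
    obtain s where s: "s \<in> ring_iso R R"
      "\<And>a u. a \<in> carrier R \<Longrightarrow> u \<in> vec2 R \<Longrightarrow> f (vsmult R a u) = vsmult R (s a) (f u)"
      using fB(2) unfolding semilinear2_def by blast
    have fc: "f u \<in> vec2 R" if "u \<in> vec2 R" for u
      using Bij_imp_funcset[OF fB(1)] that by auto
    have "s \<zero> = \<zero>"
      using s(1) by (auto simp: ring_iso_def intro: ring_hom_zero[OF _ ring_axioms ring_axioms])
    moreover have "inj_on s (carrier R)" "s ` carrier R = carrier R"
      using s(1) by (auto simp: ring_iso_def bij_betw_def)
    ultimately have sa: "s a \<in> carrier R - {\<zero>}"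
      using a(1) by (auto simp: inj_on_def)
    let ?y = "\<lambda>u\<in>vec2 R. vsmult R (s a) u"
    have y: "?y \<in> scalars2 R" using sa by (auto simp: scalars2_def)
    have xc: "x \<in> carrier (GammaL2 R)" and yc: "?y \<in> carrier (GammaL2 R)"
      using x y scalars2_subset by auto
    have "f \<otimes>\<^bsub>GammaL2 R\<^esub> x = ?y \<otimes>\<^bsub>GammaL2 R\<^esub> f"
      unfolding GammaL2_mult[OF f xc] GammaL2_mult[OF yc f]
      using a by (auto simp: fun_eq_iff compose_def s(2) fc)
    then have "f \<otimes>\<^bsub>GammaL2 R\<^esub> x \<otimes>\<^bsub>GammaL2 R\<^esub> inv\<^bsub>GammaL2 R\<^esub> f = ?y"
      using f yc by (simp add: G.m_assoc)
    then show "f \<otimes>\<^bsub>GammaL2 R\<^esub> x \<otimes>\<^bsub>GammaL2 R\<^esub> inv\<^bsub>GammaL2 R\<^esub> f \<in> scalars2 R"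
      using y by simp
  qed
qed

lemma group_PGammaL2: "group (PGammaL2 R)"
  unfolding PGammaL2_def by (rule normal.factorgroup_is_group[OF normal_scalars2])

end

end

(*
  Identify the points with the elliptic quadratic forms Q = (\<alpha>, \<beta>) = \<alpha> x^2 + x y + \<beta> y^2
  over GF(32), i.e. those with Tr(\<alpha> \<beta>) = 1; there are 496 of them.  Each nonzero vector w gives
  a block {Q. Q(w) = 1} of 16 points, and two points lie in exactly one block.  A block is an affine
  space over the trace-zero hyperplane of GF(32), and the lines in it are the cosets of the members
  of the unique spread of this hyperplane that is invariant under the Frobenius map.

  Full automorphism group: quadrilaterals (two lines through a point met by two further lines
  which meet each other) exist only within blocks, hence automorphisms permute the blocks.  Two
  blocks belong to proportional vectors iff they are disjoint and together with some third block
  are not met by a common block, so the 33 classes of blocks, i.e. the points of the projective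
  line, are permuted as well.  An automorphism fixing the classes of (1, 0) and (0, 1) has
  the form (\<alpha>, \<beta>) |-> (M \<alpha>, N \<beta>); nondegeneracy of the trace form makes M and N
  additive, and the other classes make M a multiple of a field automorphism.

  Uniqueness: a point stabilizer has order 330, and an element of order 11 in it fixes exactly one
  elliptic form, which yields an equivariant bijection with the forms.  A line stabilizer has order
  8 and exponent 2, so it is abelian and each line lies in the fixed block of an involution, where it
  is a coset of a subgroup of order four; the Frobenius map of order 5 then determines the subgroup.
*)
theory Submission
  imports Defs
begin

text \<open>Two forms with polar form \<open>sp\<close> differ by the square of a linear form, and
  every element of the field is a square. So vectors act simply transitively on all forms by
  \<open>shift\<close>, and trace conditions single out the translates that stay elliptic. For the
  same reason every invertible matrix has a scalar multiple of determinant one, so the whole group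
  acts through SL(2,32) extended by the Frobenius map. The extension is essential: SL(2,32) has
  fewer elements than there are flags, and it is the Frobenius map that permutes the five members of
  the spread cyclically. The lines inside a block form an affine plane of order 4, which is why
  quadrilaterals abound there. That none exists elsewhere is a property of this particular spread;
  it is reduced to one equation in two ratios and then checked for all pairs of ratios. Checks of
  this kind need a computable field. Hence everything is proved in an explicit model, and an
  arbitrary field of order 32 is identified with the model by finding in it a root of the defining
  polynomial.\<close>

section \<open>The field of order 32 as bit vectors, with finite facts decided by evaluation\<close>

text \<open>\<open>GF a b c d e\<close> is \<open>a + b r + c r\<^sup>2 + d r\<^sup>3 + e r\<^sup>4\<close>, where \<open>r\<close> is a root of \<open>X\<^sup>5 + X\<^sup>2 + 1\<close>
  and \<open>xtimes\<close> multiplies by \<open>r\<close>.\<close>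

datatype gf32 = GF bool bool bool bool bool

text \<open>Turns quantifiers over the field into \<open>list_all\<close> and
  \<open>list_ex\<close>, which can be evaluated. The order is binary counting with the constant
  coefficient as lowest bit.\<close>

definition gf_list :: "gf32 list" where
  "gf_list = [GF False False False False False, GF True False False False False,
   GF False True False False False, GF True True False False False,
   GF False False True False False, GF True False True False False,
   GF False True True False False, GF True True True False False,
   GF False False False True False, GF True False False True False,
   GF False True False True False, GF True True False True False,
   GF False False True True False, GF True False True True False,
   GF False True True True False, GF True True True True False,
   GF False False False False True, GF True False False False True,
   GF False True False False True, GF True True False False True,
   GF False False True False True, GF True False True False True,
   GF False True True False True, GF True True True False True,
   GF False False False True True, GF True False False True True,
   GF False True False True True, GF True True False True True,
   GF False False True True True, GF True False True True True,
   GF False True True True True, GF True True True True True]"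

lemma set_gf_list: "set gf_list = UNIV"
proof -
  have "x \<in> set gf_list" for x
  proof (cases x)
    case (GF a b c d e)
    then show ?thesis by (cases a; cases b; cases c; cases d; cases e; simp add: gf_list_def)
  qed
  then show ?thesis by auto
qed

instance gf32 :: finite
  by standard (simp flip: set_gf_list)

lemma distinct_gf_list: "distinct gf_list"
  by (simp add: gf_list_def)

lemma card_gf: "card (UNIV :: gf32 set) = 32"
  using distinct_card[OF distinct_gf_list] by (simp add: set_gf_list) (simp add: gf_list_def)

instantiation gf32 :: ab_group_add
begin
definition zero_gf32 where "0 = GF False False False False False"
fun plus_gf32 where
  "GF a b c d e + GF a' b' c' d' e' = GF (a \<noteq> a') (b \<noteq> b') (c \<noteq> c') (d \<noteq> d') (e \<noteq> e')"
definition uminus_gf32 where "- x = (x :: gf32)"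
definition minus_gf32 where "x - y = x + (y :: gf32)"
instance
proof
  fix x y z :: gf32
  show "x + y + z = x + (y + z)" by (cases x; cases y; cases z; auto)
  show "x + y = y + x" by (cases x; cases y; auto)
  show "0 + x = x" by (cases x; auto simp: zero_gf32_def)
  show "- x + x = 0" by (cases x; auto simp: zero_gf32_def uminus_gf32_def)
  show "x - y = x + - y" by (simp add: uminus_gf32_def minus_gf32_def)
qed
end

fun xtimes :: "gf32 \<Rightarrow> gf32" where
  "xtimes (GF a b c d e) = GF e a (b \<noteq> e) c d"

definition bscale :: "bool \<Rightarrow> gf32 \<Rightarrow> gf32" where
  "bscale b x = (if b then x else 0)"

lemma gf_double [simp]: "(x :: gf32) + x = 0"
  by (cases x) (simp add: zero_gf32_def)

lemma xtimes_add: "xtimes (x + y) = xtimes x + xtimes y"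
  by (cases x; cases y) auto

lemma bscale_add: "bscale b (x + y) = bscale b x + bscale b y"
  by (simp add: bscale_def)

lemma bscale_xor: "bscale (b = (\<not> c)) x = bscale b x + bscale c x"
  by (simp add: bscale_def)

lemma xtimes_zero: "xtimes 0 = 0"
  by (simp add: zero_gf32_def)

instantiation gf32 :: comm_ring_1
begin
definition one_gf32 where "1 = GF True False False False False"
text \<open>Horner's scheme in the bits of the second factor. Associativity then follows from
  distributivity and from commuting with \<open>xtimes\<close> and \<open>bscale\<close>.\<close>

fun times_gf32 where
  "x * GF a b c d e = bscale a x + xtimes (bscale b x + xtimes (bscale c x +
     xtimes (bscale d x + xtimes (bscale e x))))"
lemma gf_distrib: "x * (y + z) = x * y + x * (z :: gf32)" "(x + y) * z = x * z + y * (z :: gf32)"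
  subgoal by (cases y; cases z) (simp add: bscale_xor xtimes_add ac_simps)
  subgoal by (cases z) (simp add: bscale_add xtimes_add ac_simps)
  done
lemma gf_mult_commute: "x * y = y * (x :: gf32)"
proof -
  have "list_all (\<lambda>x. list_all (\<lambda>y. x * y = y * x) gf_list) gf_list"
    unfolding gf_list_def by code_simp
  then show ?thesis using set_gf_list by (auto simp: list_all_iff)
qed
lemma gf_mult_xtimes: "x * xtimes y = xtimes (x * y)"
proof -
  have "list_all (\<lambda>x. list_all (\<lambda>y. x * xtimes y = xtimes (x * y)) gf_list) gf_list"
    unfolding gf_list_def by code_simp
  then show ?thesis using set_gf_list by (auto simp: list_all_iff)
qed
lemma gf_mult_bscale: "x * bscale b y = bscale b (x * y)"
proof -
  have "x * 0 = 0"
    using times_gf32.simps[of x False False False False False]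
    by (simp add: bscale_def xtimes_zero flip: zero_gf32_def)
  then show ?thesis by (simp add: bscale_def)
qed
instance
proof
  fix x y z :: gf32
  show "x * y * z = x * (y * z)"
    by (cases z) (simp add: gf_distrib gf_mult_xtimes gf_mult_bscale)
  show "x * y = y * x" by (rule gf_mult_commute)
  show "1 * x = x"
    by (subst gf_mult_commute, subst one_gf32_def) (simp add: bscale_def xtimes_zero)
  show "(x + y) * z = x * z + y * z" by (rule gf_distrib)
  show "(0 :: gf32) \<noteq> 1" by (simp add: zero_gf32_def one_gf32_def)
qed
end


declare times_gf32.simps [simp del]

instantiation gf32 :: field
begin
text \<open>This is x^30, since 2 + 4 + 8 + 16 = 30; it sends 0 to 0 as a field instance
  demands.\<close>

definition inverse_gf32 where
  "inverse x = (let a = x * x; b = a * a; c = b * b; d = c * c in a * b * (c * (d :: gf32)))"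
definition divide_gf32 where "x div y = x * inverse (y :: gf32)"
instance
proof
  have "list_all (\<lambda>x. x = 0 \<or> inverse x * x = 1) gf_list"
    unfolding gf_list_def by code_simp
  then show "x \<noteq> 0 \<Longrightarrow> inverse x * x = 1" for x :: gf32
    using set_gf_list by (auto simp: list_all_iff)
  show "inverse 0 = (0 :: gf32)" by (simp add: inverse_gf32_def Let_def)
  show "x div y = x * inverse y" for x y :: gf32 by (simp add: divide_gf32_def)
qed
end

lemma gf_uminus [simp]: "- x = (x :: gf32)"
  by (simp add: uminus_gf32_def)

lemma gf_minus [simp]: "x - y = x + (y :: gf32)"
  by (simp add: minus_gf32_def)

lemma gf_double_left [simp]: "x + (x + y) = (y :: gf32)"
  by (simp flip: add.assoc)

lemma gf_numeral_even [simp]: "numeral (Num.Bit0 n) = (0 :: gf32)"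
  by (simp add: numeral.simps)

lemma gf_numeral_odd [simp]: "numeral (Num.Bit1 n) = (1 :: gf32)"
  by (simp add: numeral.simps)

lemma gf_add_eq_0_iff: "x + y = 0 \<longleftrightarrow> x = (y :: gf32)"
  using eq_neg_iff_add_eq_0[of x y] by simp

lemma gf_add_move: "x + y = z \<longleftrightarrow> x = y + (z :: gf32)"
  by (metis add.commute gf_double_left)

lemma gf_square_add: "(x + y)\<^sup>2 = x\<^sup>2 + (y :: gf32)\<^sup>2"
  by (simp add: power2_sum)

lemma gf_square_inject [simp]: "x\<^sup>2 = y\<^sup>2 \<longleftrightarrow> x = (y :: gf32)"
  by (metis gf_add_eq_0_iff gf_square_add zero_eq_power2)

lemma gf_square_eq_1 [simp]: "x\<^sup>2 = 1 \<longleftrightarrow> x = (1 :: gf32)"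
  using gf_square_inject[of x 1] by (simp del: gf_square_inject)

lemma gf_pow_31: "x \<noteq> 0 \<Longrightarrow> x ^ 31 = (1 :: gf32)"
proof -
  assume "x \<noteq> 0"
  moreover have "inverse x = x ^ 30"
    by (simp add: inverse_gf32_def Let_def power_numeral_reduce ac_simps)
  ultimately show ?thesis
    using left_inverse[of x] by (simp add: power_numeral_reduce mult.commute)
qed

lemma gf_pow_32: "x ^ 32 = (x :: gf32)"
  using gf_pow_31[of x] power_Suc[of x 31] by (cases "x = 0") auto

lemma gf_square_surj:
  fixes x :: gf32
  obtains y where "x = y\<^sup>2"
proof
  show "x = (x ^ 16)\<^sup>2" using gf_pow_32[of x] by (simp flip: power_mult)
qed

section \<open>The absolute trace\<close>

text \<open>The value of the trace, read as a truth value; the basis elements of trace one are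
  \<open>1\<close> and the cube of the root.\<close>

fun tr :: "gf32 \<Rightarrow> bool" where "tr (GF a b c d e) \<longleftrightarrow> a \<noteq> d"

lemma tr_add: "tr (x + y) \<longleftrightarrow> tr x \<noteq> tr y"
  by (cases x; cases y) auto

lemma tr_0 [simp]: "\<not> tr 0" and tr_1 [simp]: "tr 1"
  by (simp_all add: zero_gf32_def one_gf32_def)

lemma tr_square: "tr (x\<^sup>2) = tr x"
proof -
  have "list_all (\<lambda>x. tr (x * x) = tr x) gf_list"
    unfolding gf_list_def by code_simp
  then show ?thesis using set_gf_list by (auto simp: list_all_iff power2_eq_square)
qed

lemma tr_square_add: "\<not> tr (x\<^sup>2 + x)"
  by (simp add: tr_add tr_square)

text \<open>Additive Hilbert 90, verified by search.\<close>

lemma tr_0E: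
  assumes "\<not> tr x" obtains y where "x = y\<^sup>2 + y"
proof -
  have "list_all (\<lambda>x. tr x \<or> list_ex (\<lambda>y. x = y * y + y) gf_list) gf_list"
    unfolding gf_list_def by code_simp
  then show ?thesis using set_gf_list assms that by (auto simp: list_all_iff list_ex_iff power2_eq_square)
qed

text \<open>Two distinct elements are separated by the inverse of their sum, because 1 has trace one
  (the degree 5 is odd).\<close>

lemma tr_nondegenerate:
  assumes "\<And>y. tr (x * y) = tr (x' * y)" shows "x = x'"
proof (rule ccontr)
  assume "x \<noteq> x'"
  then have "(x + x') * inverse (x + x') = 1" by (simp add: gf_add_eq_0_iff)
  then have "tr (x * inverse (x + x')) \<noteq> tr (x' * inverse (x + x'))"
    by (metis distrib_right tr_1 tr_add)
  then show False using assms by blast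
qed

lemma card_tr_1: "card {x. tr x} = 16"
proof -
  have "{x. tr x} = set (filter tr gf_list)" by (simp add: set_gf_list)
  also have "card \<dots> = 16"
    by (subst distinct_card) (simp_all add: distinct_gf_list, simp add: gf_list_def)
  finally show ?thesis .
qed

lemma card_tr_0: "card {x. \<not> tr x} = 16"
proof -
  have "{x. \<not> tr x} = set (filter (\<lambda>x. \<not> tr x) gf_list)" by (simp add: set_gf_list)
  also have "card \<dots> = 16"
    by (subst distinct_card) (simp_all add: distinct_gf_list, simp add: gf_list_def)
  finally show ?thesis .
qed

section \<open>Field automorphisms\<close>

definition frob :: "nat \<Rightarrow> gf32 \<Rightarrow> gf32" where "frob n x = x ^ (2 ^ n)"

lemma frob_0 [simp]: "frob n 0 = 0" and frob_1 [simp]: "frob n 1 = 1"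
  by (simp_all add: frob_def)

lemma frob_zero_nat [simp]: "frob 0 x = x" by (simp add: frob_def)

lemma frob_Suc: "frob (Suc n) x = (frob n x)\<^sup>2"
  by (simp add: frob_def mult.commute flip: power_mult)

lemma frob_mult: "frob n (x * y) = frob n x * frob n y"
  by (simp add: frob_def power_mult_distrib)

lemma frob_add: "frob n (x + y) = frob n x + frob n y"
  by (induction n) (simp_all add: frob_Suc gf_square_add)

lemma frob_power: "frob n (x ^ k) = frob n x ^ k"
  by (simp add: frob_def mult.commute flip: power_mult)

lemma frob_frob: "frob m (frob n x) = frob (m + n) x"
  by (induction m) (simp_all add: frob_Suc)

lemma frob_5: "frob 5 x = x"
  using gf_pow_32[of x] by (simp add: frob_def)

lemma frob_mod: "frob (n mod 5) x = frob n x"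
proof -
  have "frob (5 * k) x = x" for k
  proof (induction k)
    case (Suc k)
    have "frob (5 * Suc k) x = frob 5 (frob (5 * k) x)" by (simp add: frob_frob)
    then show ?case using Suc frob_5 by simp
  qed simp
  then show ?thesis by (metis frob_frob mod_mult_div_eq)
qed

lemma frob_inj [simp]: "frob n x = frob n y \<longleftrightarrow> x = y"
  by (induction n) (simp_all add: frob_Suc)

lemma frob_eq_0 [simp]: "frob n x = 0 \<longleftrightarrow> x = 0"
  using frob_inj[of n x 0] by (simp del: frob_inj)

lemma tr_frob [simp]: "tr (frob n x) = tr x"
  by (induction n) (simp_all add: frob_Suc tr_square)

lemma frob_surj: obtains y where "x = frob n y"
proof
  have "frob n (frob (4 * n) x) = frob (5 * n) x" by (simp add: frob_frob)
  also have "\<dots> = frob (5 * n mod 5) x" by (simp only: frob_mod)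
  finally show "x = frob n (frob (4 * n) x)" by simp
qed

definition gf_root :: gf32 where "gf_root = GF False True False False False"

text \<open>A field automorphism is determined by the image of the root, which is again a root.\<close>

lemma gf32_aut_eq_frob:
  assumes add: "\<And>x y. s (x + y) = s x + s y" and mult: "\<And>x y. s (x * y) = s x * s y" and "s 1 = 1"
  obtains n where "n < 5" "s = frob n"
proof -
  have s0: "s 0 = 0" using add[of 0 0] by simp
  have "s gf_root * s gf_root * s gf_root * s gf_root * s gf_root = s (gf_root * gf_root * gf_root * gf_root * gf_root)" by (simp only: mult)
  also have "gf_root * gf_root * gf_root * gf_root * gf_root = gf_root * gf_root + 1"
    by code_simp
  also have "s \<dots> = s gf_root * s gf_root + 1" by (simp only: mult add \<open>s 1 = 1\<close>)
  finally have root: "s gf_root * s gf_root * s gf_root * s gf_root * s gf_root = s gf_root * s gf_root + 1" .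
  have "list_all (\<lambda>x. x * x * x * x * x = x * x + 1 \<longrightarrow> (let a = gf_root * gf_root; b = a * a; c = b * b; d = c * c in
           x = gf_root \<or> x = a \<or> x = b \<or> x = c \<or> x = d)) gf_list"
    unfolding gf_list_def by code_simp
  then have "\<forall>x. x * x * x * x * x = x * x + 1 \<longrightarrow> (\<exists>n\<in>{0, 1, 2, 3, 4}. x = frob n gf_root)"
    by (simp add: list_all_iff set_gf_list Let_def frob_Suc power2_eq_square numeral_eq_Suc)
  then have "\<exists>n\<in>{0, 1, 2, 3, 4}. s gf_root = frob n gf_root"
    using root by blast
  then have "\<exists>n\<in>{..<5}. s gf_root = frob n gf_root"
    by (rule bexE) (rule bexI, assumption, auto)
  then obtain n where n: "n < 5" "s gf_root = frob n gf_root" by auto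
  have b: "s (bscale b x) = bscale b (s x)" "frob n (bscale b x) = bscale b (frob n x)" for b x
    by (auto simp: bscale_def s0)
  have x: "xtimes x = x * gf_root" for x
    by (subst gf_root_def, subst times_gf32.simps) (simp add: bscale_def xtimes_zero)
  have sx: "s (xtimes x) = s x * s gf_root" and fx: "frob n (xtimes x) = frob n x * frob n gf_root" for x
    by (simp_all only: x mult frob_mult)
  have "s (1 * x) = frob n (1 * x)" for x
    apply (cases x)
    apply (simp only: times_gf32.simps)
    apply (simp only: add frob_add sx fx b n \<open>s 1 = 1\<close> frob_1)
    done
  with that n(1) show ?thesis by auto
qed

section \<open>Elliptic quadratic forms\<close>

type_synonym vec = "gf32 \<times> gf32"
type_synonym form = "gf32 \<times> gf32"

text \<open>The pair \<open>(\<alpha>, \<beta>)\<close> stands for the form \<open>\<alpha> x\<^sup>2 + x y + \<beta> y\<^sup>2\<close>, whose polar form is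
  the symplectic form \<open>sp\<close>; it is anisotropic iff \<open>\<alpha> \<beta>\<close> has trace one.\<close>

definition ev :: "form \<Rightarrow> vec \<Rightarrow> gf32" where
  "ev Q v = fst Q * (fst v)\<^sup>2 + fst v * snd v + snd Q * (snd v)\<^sup>2"

definition sp :: "vec \<Rightarrow> vec \<Rightarrow> gf32" where
  "sp u v = fst u * snd v + snd u * fst v"

definition scl :: "gf32 \<Rightarrow> vec \<Rightarrow> vec" where
  "scl c u = (c * fst u, c * snd u)"

definition vpl :: "vec \<Rightarrow> vec \<Rightarrow> vec" where
  "vpl u v = (fst u + fst v, snd u + snd v)"

text \<open>\<open>shift Q u\<close> is the form \<open>Q + (sp u)\<^sup>2\<close>.\<close>

definition shift :: "form \<Rightarrow> vec \<Rightarrow> form" where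
  "shift Q u = (fst Q + (snd u)\<^sup>2, snd Q + (fst u)\<^sup>2)"

definition pts :: "form set" where
  "pts = {Q. tr (fst Q * snd Q)}"

definition blk :: "vec \<Rightarrow> form set" where
  "blk w = {Q \<in> pts. ev Q w = 1}"

lemma ev_shift: "ev (shift Q u) v = ev Q v + (sp u v)\<^sup>2"
  by (simp add: ev_def shift_def sp_def power2_eq_square algebra_simps)

lemma ev_scl: "ev Q (scl c v) = c\<^sup>2 * ev Q v"
  by (simp add: ev_def scl_def power2_eq_square algebra_simps)

lemma ev_vpl: "ev Q (vpl u v) = ev Q u + ev Q v + sp u v"
  by (simp add: ev_def vpl_def sp_def power2_eq_square algebra_simps)

lemma ev_zero [simp]: "ev Q (0, 0) = 0"
  by (simp add: ev_def)

lemma sp_scl: "sp (scl c u) v = c * sp u v" "sp u (scl c v) = c * sp u v"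
  by (simp_all add: sp_def scl_def algebra_simps)

lemma sp_vpl: "sp (vpl u u') v = sp u v + sp u' v" "sp u (vpl v v') = sp u v + sp u v'"
  by (simp_all add: sp_def vpl_def algebra_simps)

lemma sp_self [simp]: "sp u u = 0"
  by (simp add: sp_def mult.commute)

lemma sp_commute: "sp u v = sp v u"
  by (simp add: sp_def algebra_simps)

lemma scl_1 [simp]: "scl 1 u = u" and scl_0 [simp]: "scl 0 u = (0, 0)"
  by (simp_all add: scl_def)

lemma scl_scl: "scl c (scl d u) = scl (c * d) u"
  by (simp add: scl_def ac_simps)

lemma scl_inject: "u \<noteq> (0, 0) \<Longrightarrow> scl c u = scl d u \<longleftrightarrow> c = d"
  by (cases u) (auto simp: scl_def)

lemma scl_cancel: "c \<noteq> 0 \<Longrightarrow> scl c u = scl c v \<longleftrightarrow> u = v"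
  by (cases u; cases v) (auto simp: scl_def)

lemma scl_eq_0: "scl c u = (0, 0) \<longleftrightarrow> c = 0 \<or> u = (0, 0)"
  by (cases u) (auto simp: scl_def)

lemma vpl_scl: "vpl (scl c u) (scl d u) = scl (c + d) u"
  by (simp add: scl_def vpl_def algebra_simps)

lemma sp_eq_0:
  assumes "sp u w = 0" "w \<noteq> (0, 0)" obtains c where "u = scl c w"
proof (cases "fst w = 0")
  case True
  then have "u = scl (snd u / snd w) w"
    using assms by (cases u; cases w) (auto simp: sp_def scl_def)
  then show ?thesis by (rule that)
next
  case False
  then have "u = scl (fst u / fst w) w"
    using assms by (cases u; cases w) (auto simp: sp_def scl_def field_simps gf_add_eq_0_iff)
  then show ?thesis by (rule that)
qed

lemma shift_inject [simp]: "shift Q u = shift Q v \<longleftrightarrow> u = v"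
  by (cases u; cases v) (auto simp: shift_def)

lemma shift_zero [simp]: "shift Q (0, 0) = Q"
  by (simp add: shift_def)

lemma shift_shift: "shift (shift Q u) v = shift Q (vpl u v)"
  by (simp add: shift_def vpl_def gf_square_add ac_simps)

lemma shift_surj: obtains u where "Q' = shift Q u"
proof -
  obtain a where a: "fst Q + fst Q' = a\<^sup>2" by (rule gf_square_surj)
  obtain b where b: "snd Q + snd Q' = b\<^sup>2" by (rule gf_square_surj)
  have "Q' = shift Q (b, a)"
    by (cases Q; cases Q') (use a b in \<open>auto simp: shift_def simp flip: a b\<close>)
  then show ?thesis by (rule that)
qed

text \<open>Basis independence of the Arf invariant: passing from the standard basis to
  \<open>u\<close>, \<open>v\<close> changes the normalised product by t^2 + t with t =
  \<open>x / sp u v\<close>, which has trace zero.\<close>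

lemma arf_invariant:
  assumes "sp u v \<noteq> 0"
  shows "tr (ev Q u * ev Q v / (sp u v)\<^sup>2) = tr (fst Q * snd Q)"
proof -
  define x where "x = fst Q * fst u * fst v + snd Q * snd u * snd v + fst u * snd v"
  have "ev Q u * ev Q v = fst Q * snd Q * (sp u v)\<^sup>2 + x\<^sup>2 + x * sp u v"
    by (simp add: ev_def sp_def x_def power2_eq_square algebra_simps)
  then have "ev Q u * ev Q v / (sp u v)\<^sup>2 = fst Q * snd Q + ((x / sp u v)\<^sup>2 + x / sp u v)"
    using assms by (simp add: field_simps power2_eq_square)
  then show ?thesis using tr_square_add[of "x / sp u v"] by (simp add: tr_add)
qed

text \<open>A nonzero singular vector is not proportional to one of the two standard basis vectors;
  with that one it would give Arf invariant zero.\<close>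

lemma ev_eq_0_iff:
  assumes "Q \<in> pts" shows "ev Q v = 0 \<longleftrightarrow> v = (0, 0)"
proof
  assume v: "ev Q v = 0"
  show "v = (0, 0)"
  proof (rule ccontr)
    assume "v \<noteq> (0, 0)"
    then have "sp v (1, 0) \<noteq> 0 \<or> sp v (0, 1) \<noteq> 0"
      by (cases v) (auto simp: sp_def)
    then show False
      using arf_invariant[of v _ Q] v assms by (auto simp: pts_def)
  qed
qed simp

text \<open>The shift adds \<open>ev Q u\<close> to the Arf invariant, except that the mixed term
  appears squared, which the trace does not see.\<close>

lemma shift_in_pts:
  assumes "Q \<in> pts" shows "shift Q u \<in> pts \<longleftrightarrow> \<not> tr (ev Q u)"
proof -
  have "tr (fst (shift Q u) * snd (shift Q u)) \<longleftrightarrow>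
      tr (fst Q * snd Q + (fst Q * (fst u)\<^sup>2 + snd Q * (snd u)\<^sup>2 + (fst u * snd u)\<^sup>2))"
    by (rule arg_cong[of _ _ tr]) (simp add: shift_def power2_eq_square algebra_simps)
  also have "\<dots> \<longleftrightarrow> tr (fst Q * snd Q) \<noteq> tr (ev Q u)"
    by (auto simp: tr_add tr_square ev_def)
  finally show ?thesis using assms by (auto simp: pts_def)
qed

lemma blk_sub: "blk w \<subseteq> pts"
  by (auto simp: blk_def)

lemma blk_zero: "blk (0, 0) = {}"
  by (auto simp: blk_def)

lemma blk_nonzero: "Q \<in> blk w \<Longrightarrow> w \<noteq> (0, 0)"
  using blk_zero by auto

lemma shift_in_blk:
  assumes "Q \<in> blk w" shows "shift Q u \<in> blk w \<longleftrightarrow> (\<exists>c. u = scl c w \<and> \<not> tr c)"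
proof -
  have Q: "Q \<in> pts" "ev Q w = 1" using assms by (auto simp: blk_def)
  show ?thesis
  proof
    assume u: "shift Q u \<in> blk w"
    then have "sp u w = 0" using Q by (simp add: blk_def ev_shift)
    then obtain c where c: "u = scl c w" using blk_nonzero[OF assms] by (rule sp_eq_0)
    then show "\<exists>c. u = scl c w \<and> \<not> tr c"
      using u Q by (auto simp: blk_def shift_in_pts ev_scl tr_square)
  qed (use Q in \<open>auto simp: blk_def shift_in_pts ev_shift ev_scl tr_square sp_scl\<close>)
qed

lemma blk_eq_image: "Q \<in> blk w \<Longrightarrow> blk w = (\<lambda>c. shift Q (scl c w)) ` {c. \<not> tr c}"
proof
  assume Q: "Q \<in> blk w"
  show "blk w \<subseteq> (\<lambda>c. shift Q (scl c w)) ` {c. \<not> tr c}"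
  proof
    fix Q' assume Q': "Q' \<in> blk w"
    obtain u where "Q' = shift Q u" by (rule shift_surj)
    with Q Q' show "Q' \<in> (\<lambda>c. shift Q (scl c w)) ` {c. \<not> tr c}"
      by (auto simp: shift_in_blk)
  qed
  show "(\<lambda>c. shift Q (scl c w)) ` {c. \<not> tr c} \<subseteq> blk w"
    using Q by (auto simp: shift_in_blk)
qed

lemma card_blk:
  assumes "Q \<in> blk w" shows "card (blk w) = 16"
proof -
  have "inj_on (\<lambda>c. shift Q (scl c w)) {c. \<not> tr c}"
    using blk_nonzero[OF assms] by (auto simp: inj_on_def scl_inject)
  then show ?thesis by (subst blk_eq_image[OF assms]) (simp add: card_image card_tr_0)
qed

lemma pts_joined:
  assumes "Q \<in> pts" "Q' \<in> pts" "Q \<noteq> Q'"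
  obtains w c where "Q \<in> blk w" "Q' = shift Q (scl c w)" "c \<noteq> 0" "\<not> tr c"
proof -
  obtain u where u: "Q' = shift Q u" by (rule shift_surj)
  then have "u \<noteq> (0, 0)" using assms by auto
  then have e: "ev Q u \<noteq> 0" using assms by (simp add: ev_eq_0_iff)
  obtain c where c: "ev Q u = c\<^sup>2" by (rule gf_square_surj)
  have c0: "c \<noteq> 0" using c e by auto
  show thesis
  proof
    show "Q \<in> blk (scl (1 / c) u)" using assms c c0 by (simp add: blk_def ev_scl power_divide)
    show "Q' = shift Q (scl c (scl (1 / c) u))" using u c0 by (simp add: scl_scl)
    show "c \<noteq> 0" by (fact c0)
    show "\<not> tr c" using u c assms shift_in_pts[of Q u] by (simp add: tr_square)
  qed
qed

lemma blk_unique: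
  assumes "Q \<in> blk w" "Q' \<in> blk w" "Q \<in> blk w'" "Q' \<in> blk w'" "Q \<noteq> Q'"
  shows "w = w'"
proof -
  obtain u where u: "Q' = shift Q u" by (rule shift_surj)
  obtain c c' where c: "u = scl c w" "u = scl c' w'"
    using assms shift_in_blk u by blast
  have "ev Q u = c\<^sup>2" unfolding c(1) ev_scl using assms(1) by (simp add: blk_def)
  moreover have "ev Q u = c'\<^sup>2" unfolding c(2) ev_scl using assms(3) by (simp add: blk_def)
  ultimately have "c = c'" by (metis gf_square_inject)
  moreover have "c \<noteq> 0" using c u assms by auto
  ultimately show ?thesis using c by (metis scl_cancel)
qed

lemma card_pts: "card pts = 496"
proof -
  have "bij_betw (\<lambda>(a, t). (a, t / a)) ((UNIV - {0}) \<times> {t. tr t}) pts"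
    by (rule bij_betw_byWitness[where f' = "\<lambda>(a, b). (a, a * b)"])
       (auto simp: pts_def split: if_splits)
  then have "card pts = card ((UNIV - {0 :: gf32}) \<times> {t. tr t})"
    by (simp add: bij_betw_same_card)
  also have "\<dots> = 496" by (simp add: card_cartesian_product card_tr_1 card_Diff_singleton card_gf)
  finally show ?thesis .
qed

section \<open>A regular spread of the trace-zero hyperplane\<close>

text \<open>\<open>rot\<close> permutes the nonzero elements of trace zero in cycles \<open>c, rot c, c + rot c\<close> and commutes
  with the Frobenius map.  Up to the order of the cycles, it is the only map with these properties.\<close>

fun rot :: "gf32 \<Rightarrow> gf32" where
  "rot (GF False True False False False) = GF True False True True True"
| "rot (GF False False True False False) = GF False True True False True"
| "rot (GF False True True False False) = GF True True False True False"
| "rot (GF True False False True False) = GF False False False False True"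
| "rot (GF True True False True False) = GF True False True True False"
| "rot (GF True False True True False) = GF False True True False False"
| "rot (GF True True True True False) = GF True True False True True"
| "rot (GF False False False False True) = GF True False False True True"
| "rot (GF False True False False True) = GF False False True False False"
| "rot (GF False False True False True) = GF True True True True False"
| "rot (GF False True True False True) = GF False True False False True"
| "rot (GF True False False True True) = GF True False False True False"
| "rot (GF True True False True True) = GF False False True False True"
| "rot (GF True False True True True) = GF True True True True True"
| "rot (GF True True True True True) = GF False True False False False"
| "rot _ = 0"

definition T0 :: "gf32 set" where "T0 = {c. c \<noteq> 0 \<and> \<not> tr c}"

lemma T0_list: "(\<forall>c\<in>T0. P c) \<longleftrightarrow> list_all (\<lambda>c. c = 0 \<or> tr c \<or> P c) gf_list"
  by (auto simp: list_all_iff set_gf_list T0_def)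

lemma rot_facts: "\<forall>c\<in>T0. rot c \<noteq> 0 \<and> \<not> tr (rot c) \<and> rot c \<noteq> c \<and> rot (rot c) = c + rot c \<and>
   rot (c + rot c) = c \<and> rot (c * c) = rot c * rot c"
  unfolding T0_list gf_list_def by code_simp

lemma rot_T0: "c \<in> T0 \<Longrightarrow> rot c \<in> T0"
  and rot_neq: "c \<in> T0 \<Longrightarrow> rot c \<noteq> c"
  and rot_rot: "c \<in> T0 \<Longrightarrow> rot (rot c) = c + rot c"
  and rot_add_rot: "c \<in> T0 \<Longrightarrow> rot (c + rot c) = c"
  and rot_square: "c \<in> T0 \<Longrightarrow> rot (c\<^sup>2) = (rot c)\<^sup>2"
  using rot_facts by (auto simp: T0_def power2_eq_square)

lemma frob_T0: "c \<in> T0 \<Longrightarrow> frob n c \<in> T0"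
  by (simp add: T0_def)

lemma rot_frob: "c \<in> T0 \<Longrightarrow> rot (frob n c) = frob n (rot c)"
  by (induction n) (simp_all add: frob_Suc rot_square frob_T0)

text \<open>For \<open>c\<close> in \<open>T0\<close> this is the member of the spread through
  \<open>c\<close>.\<close>

definition spr :: "gf32 \<Rightarrow> gf32 set" where
  "spr c = {0, c, rot c, c + rot c}"

lemma add_rot_T0: "c \<in> T0 \<Longrightarrow> c + rot c \<in> T0"
  by (metis rot_T0 rot_rot)

lemma zero_spr [simp]: "0 \<in> spr c" and self_spr [simp]: "c \<in> spr c"
  by (auto simp: spr_def)

lemma spr_T0: "c \<in> T0 \<Longrightarrow> d \<in> spr c \<Longrightarrow> d \<noteq> 0 \<Longrightarrow> d \<in> T0"
  by (auto simp: spr_def rot_T0 add_rot_T0)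

lemma spr_eq: "c \<in> T0 \<Longrightarrow> d \<in> spr c \<Longrightarrow> d \<noteq> 0 \<Longrightarrow> spr d = spr c"
  by (auto simp: spr_def rot_rot rot_add_rot ac_simps)

lemma spr_add: "d \<in> spr c \<Longrightarrow> d' \<in> spr c \<Longrightarrow> d + d' \<in> spr c"
  by (auto simp: spr_def ac_simps)

lemma card_spr: "c \<in> T0 \<Longrightarrow> card (spr c) = 4"
proof -
  assume c: "c \<in> T0"
  have "c \<noteq> 0" "rot c \<noteq> 0" "c + rot c \<noteq> 0"
    using c rot_T0[OF c] add_rot_T0[OF c] by (auto simp: T0_def)
  moreover have "c + rot c \<noteq> c" "c + rot c \<noteq> rot c" using calculation by auto
  ultimately show ?thesis using rot_neq[OF c] unfolding spr_def by (auto simp: card_insert_if)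
qed

lemma spr_not_tr: "c \<in> T0 \<Longrightarrow> d \<in> spr c \<Longrightarrow> \<not> tr d"
  using spr_T0[of c d] by (cases "d = 0") (auto simp: T0_def)

lemma frob_spr: "c \<in> T0 \<Longrightarrow> frob n ` spr c = spr (frob n c)"
  by (simp add: spr_def rot_frob frob_add)

section \<open>The design\<close>

definition dline :: "form \<Rightarrow> vec \<Rightarrow> gf32 \<Rightarrow> form set" where
  "dline Q w c = (\<lambda>d. shift Q (scl d w)) ` spr c"

definition dlines :: "form set set" where
  "dlines = {dline Q w c | Q w c. Q \<in> blk w \<and> c \<in> T0}"

lemma dlinesI: "Q \<in> blk w \<Longrightarrow> c \<in> T0 \<Longrightarrow> dline Q w c \<in> dlines"
  unfolding dlines_def by blast

lemma dline_self [simp]: "Q \<in> dline Q w c"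
  unfolding dline_def by (rule image_eqI[of _ _ 0]) simp_all

lemma dline_point [simp]: "shift Q (scl c w) \<in> dline Q w c"
  unfolding dline_def by (rule imageI) simp

lemma dline_sub_blk: "Q \<in> blk w \<Longrightarrow> c \<in> T0 \<Longrightarrow> dline Q w c \<subseteq> blk w"
  unfolding dline_def using spr_not_tr shift_in_blk by blast

lemma card_dline: "Q \<in> blk w \<Longrightarrow> c \<in> T0 \<Longrightarrow> card (dline Q w c) = 4"
  unfolding dline_def
  by (subst card_image) (auto simp: inj_on_def scl_inject blk_nonzero card_spr)

lemma dline_rebase:
  assumes "Q' \<in> dline Q w c" shows "dline Q' w c = dline Q w c"
proof -
  obtain d where d: "d \<in> spr c" "Q' = shift Q (scl d w)"
    using assms by (auto simp: dline_def)
  have "(+) d ` spr c = spr c"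
  proof
    show "(+) d ` spr c \<subseteq> spr c" using d spr_add by auto
    show "spr c \<subseteq> (+) d ` spr c"
    proof
      fix e assume "e \<in> spr c"
      then show "e \<in> (+) d ` spr c"
        using d spr_add by (intro image_eqI[of _ _ "d + e"]) auto
    qed
  qed
  then have "dline Q w c = (\<lambda>e. shift Q (scl e w)) ` (+) d ` spr c"
    by (simp add: dline_def)
  also have "\<dots> = dline Q' w c"
    by (simp add: dline_def image_image d shift_shift vpl_scl)
  finally show ?thesis by simp
qed

text \<open>Any point of a line can serve as its origin and any other point as its direction,
  because a member of the spread is determined by each of its nonzero elements.\<close>

lemma dlines_obtain:
  assumes "l \<in> dlines" "p \<in> l" "a \<in> l" "a \<noteq> p"
  obtains w c where "p \<in> blk w" "c \<in> T0" "l = dline p w c" "a = shift p (scl c w)"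
proof -
  obtain Q w c where Q: "l = dline Q w c" "Q \<in> blk w" "c \<in> T0"
    using assms by (auto simp: dlines_def)
  have l: "l = dline p w c" using Q dline_rebase assms by metis
  have p: "p \<in> blk w" using Q assms dline_sub_blk by blast
  obtain d where d: "d \<in> spr c" "a = shift p (scl d w)"
    using assms l by (auto simp: dline_def)
  then have "d \<noteq> 0" using assms by auto
  then have "d \<in> T0" "spr d = spr c" using d Q spr_T0 spr_eq by blast+
  with p l d show thesis by (intro that[of w d]) (auto simp: dline_def)
qed

lemma dlines_unique:
  assumes "l \<in> dlines" "m \<in> dlines" "p \<in> l" "q \<in> l" "p \<in> m" "q \<in> m" "p \<noteq> q"
  shows "l = m"
proof -
  obtain w c where l: "p \<in> blk w" "c \<in> T0" "l = dline p w c" "q = shift p (scl c w)"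
    using dlines_obtain[of l p q] assms by metis
  obtain w' c' where m: "p \<in> blk w'" "c' \<in> T0" "m = dline p w' c'" "q = shift p (scl c' w')"
    using dlines_obtain[of m p q] assms by metis
  have "q \<in> blk w" "q \<in> blk w'" using l m assms dline_sub_blk by blast+
  then have "w = w'" using blk_unique l m assms by metis
  then have "c = c'" using l m blk_nonzero by (metis scl_inject shift_inject)
  then show ?thesis using \<open>w = w'\<close> l m by simp
qed

lemma dlines_join:
  assumes "p \<in> pts" "q \<in> pts" "p \<noteq> q" obtains l where "l \<in> dlines" "p \<in> l" "q \<in> l"
proof -
  obtain w c where "p \<in> blk w" "q = shift p (scl c w)" "c \<noteq> 0" "\<not> tr c"
    using pts_joined assms by metis
  then show thesis by (intro that[of "dline p w c"]) (auto simp: dlinesI T0_def)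
qed

lemma dlines_sub: "l \<in> dlines \<Longrightarrow> l \<subseteq> pts"
  unfolding dlines_def using dline_sub_blk blk_sub by blast

lemma design2_dlines: "design2 496 4 pts dlines"
  unfolding design2_def
proof (intro conjI ballI impI)
  show "finite pts" by simp
  show "card pts = 496" by (rule card_pts)
  show "l \<subseteq> pts" if "l \<in> dlines" for l using that by (rule dlines_sub)
  show "card l = 4" if "l \<in> dlines" for l using that card_dline by (auto simp: dlines_def)
  show "\<exists>!l. l \<in> dlines \<and> x \<in> l \<and> y \<in> l" if "x \<in> pts" "y \<in> pts" "x \<noteq> y" for x y
    using dlines_join[OF that] dlines_unique that(3) by metis
qed

section \<open>Quadrilaterals lie in blocks\<close>

text \<open>Three points \<open>p\<close>, \<open>shift p u\<close>, \<open>shift p (scl k u)\<close> are collinear iff \<open>ev p u = (apex k)\<^sup>2\<close>.\<close>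

fun apex :: "gf32 \<Rightarrow> gf32" where
  "apex (GF _ True False False False) = GF True False True True True"
| "apex (GF _ False True False False) = GF False True True False True"
| "apex (GF _ True True False False) = GF True False True True False"
| "apex (GF _ False False True False) = GF False True False False True"
| "apex (GF _ True False True False) = GF True False False True False"
| "apex (GF _ False True True False) = GF False True True False False"
| "apex (GF _ True True True False) = GF True True False True False"
| "apex (GF _ False False False True) = GF True False False True True"
| "apex (GF _ True False False True) = GF True True True True True"
| "apex (GF _ False True False True) = GF True True False True True"
| "apex (GF _ True True False True) = GF False False True False False"
| "apex (GF _ False False True True) = GF False False False False True"
| "apex (GF _ True False True True) = GF False False True False True"
| "apex (GF _ False True True True) = GF False True False False False"
| "apex (GF _ True True True True) = GF True True True True False"
| "apex _ = 0"

text \<open>The two ratios that occur for \<open>c\<close> differ by 1, which is why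
  \<open>apex\<close> ignores the constant coefficient. The 15 elements of \<open>T0\<close>
  correspond to the 15 pairs {k, k + 1} other than {0, 1}, so a ratio determines the element it
  comes from.\<close>

lemma apex_facts: "\<forall>c\<in>T0. apex (rot c * inverse c) = c \<and> apex ((c + rot c) * inverse c) = c"
  unfolding T0_list gf_list_def by code_simp

lemma collinear_apex:
  assumes "l \<in> dlines" "p \<in> l" "a \<in> l" "b \<in> l" "a \<noteq> p" "b \<noteq> p" "a \<noteq> b"
  obtains u k where "a = shift p u" "b = shift p (scl k u)" "k \<noteq> 0" "k \<noteq> 1" "ev p u = (apex k)\<^sup>2"
proof -
  obtain w c where l: "p \<in> blk w" "c \<in> T0" "l = dline p w c" "a = shift p (scl c w)"
    using dlines_obtain[of l p a] assms by metis
  obtain d where d: "d \<in> spr c" "b = shift p (scl d w)"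
    using assms l by (auto simp: dline_def)
  have c: "c \<noteq> 0" using l by (simp add: T0_def)
  have "d \<noteq> 0" "d \<noteq> c" using d l assms by auto
  then have "d = rot c \<or> d = c + rot c" using d by (auto simp: spr_def)
  then have "apex (d * inverse c) = c" using apex_facts l by auto
  moreover have "ev p (scl c w) = c\<^sup>2" using l by (simp add: ev_scl blk_def)
  ultimately show thesis
    using l d c \<open>d \<noteq> 0\<close> \<open>d \<noteq> c\<close>
    by (intro that[of "scl c w" "d * inverse c"]) (auto simp: scl_scl field_simps)
qed

text \<open>In a quadrilateral not contained in a block, with \<open>r\<^sup>2 = sp u v\<close>, \<open>k\<^sub>i\<close> the ratio of the two points on the
  \<open>i\<close>-th line and \<open>m\<^sup>2 = k\<^sub>1 k\<^sub>2\<close>, the collinearity conditions on the third and fourth line read \<open>r\<^sup>2 + r = A\<close>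
  and \<open>(m r)\<^sup>2 + m r = B\<close>.  Eliminating \<open>r\<^sup>2\<close> gives \<open>e r = D\<close>.\<close>

definition quad_check :: "gf32 \<Rightarrow> gf32 \<Rightarrow> bool" where
  "quad_check x y = (let k1 = x * x; k2 = y * y; c1 = apex k1; c2 = apex k2;
     k4 = (k1 + 1) * inverse (k1 + k2); m = x * y; A = c1 + c2 + apex (k4 * k2); mm = m * m;
     B = apex k4 + k1 * c1 + k2 * c2; e = mm + m; D = B + mm * A
   in if e = 0 then A = 0 \<and> \<not> tr (c1 * c2) else D = 0 \<or> D * (D + e) \<noteq> A * (e * e))"

text \<open>The arguments are square roots of the two ratios, so that \<open>m\<close> is their
  product. If \<open>e\<close> is nonzero, \<open>D * (D + e) = A * (e * e)\<close> is the equation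
  r^2 + r = A multiplied by the square of \<open>e\<close>, and the check leaves only r = 0. If
  \<open>e\<close> is zero, \<open>A = 0\<close> leaves r = 0 or r = 1, and the trace condition
  contradicts ellipticity in the latter case.\<close>

lemma quad_check_list: "list_all (\<lambda>x. x = 0 \<or> x = 1 \<or>
    list_all (\<lambda>y. y = 0 \<or> y = 1 \<or> x = y \<or> quad_check x y) gf_list) gf_list"
  unfolding gf_list_def by code_simp

lemma quad_check: "x \<noteq> 0 \<Longrightarrow> x \<noteq> 1 \<Longrightarrow> y \<noteq> 0 \<Longrightarrow> y \<noteq> 1 \<Longrightarrow> x \<noteq> y \<Longrightarrow> quad_check x y"
  using quad_check_list by (auto simp: list_all_iff set_gf_list)


text \<open>In the affine plane on a block, the line joining the points \<open>c\<close> and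
  \<open>d\<close> is the coset \<open>c + spr (c + d)\<close>, and \<open>c + z\<close> runs over
  its two other points. The check finds a second transversal, through other points of
  \<open>spr c\<close> and \<open>spr d\<close>, that meets the first one in such a point.\<close>

definition plane_check :: "gf32 \<Rightarrow> gf32 \<Rightarrow> bool" where
  "plane_check c d \<longleftrightarrow> list_ex (\<lambda>c'. list_ex (\<lambda>d'. list_ex (\<lambda>z. list_ex (\<lambda>z'. c + z = c' + z')
      [rot (c' + d'), c' + d' + rot (c' + d')]) [rot (c + d), c + d + rot (c + d)])
      [rot d, d + rot d]) [rot c, c + rot c]"

lemma plane_check_list: "\<forall>c\<in>T0. list_all (\<lambda>d. d = 0 \<or> tr d \<or> d = c \<or> d = rot c \<or> d = c + rot c \<or>
    plane_check c d) gf_list"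
  unfolding T0_list gf_list_def by code_simp

text \<open>A Pasch configuration of four lines and six points in which \<open>l\<close> and
  \<open>m\<close> are two of the lines. It is expressed by incidence alone, so automorphisms
  preserve it.\<close>

definition quad :: "form set \<Rightarrow> form set \<Rightarrow> bool" where
  "quad l m \<longleftrightarrow> l \<in> dlines \<and> m \<in> dlines \<and> l \<noteq> m \<and>
     (\<exists>p a a' b b' c n n'. n \<in> dlines \<and> n' \<in> dlines \<and> p \<in> l \<and> p \<in> m \<and>
        a \<in> l \<and> a' \<in> l \<and> a \<noteq> p \<and> a' \<noteq> p \<and> a \<noteq> a' \<and> b \<in> m \<and> b' \<in> m \<and> b \<noteq> p \<and> b' \<noteq> p \<and> b \<noteq> b' \<and>
        a \<in> n \<and> b \<in> n \<and> c \<in> n \<and> a' \<in> n' \<and> b' \<in> n' \<and> c \<in> n')"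

lemma vpl_self_left [simp]: "vpl u (vpl u v) = v"
  by (simp add: vpl_def)

text \<open>If \<open>u\<close> and \<open>v\<close> were independent, pairing \<open>eq\<close>
  with each of them would compare coefficients and express \<open>k3\<close> and \<open>k4\<close>
  through \<open>k1\<close> and \<open>k2\<close>. Only the two ratios and the root of
  \<open>sp u v\<close> then remain, and \<open>quad_check\<close> rules them out.\<close>

lemma no_skew_quad:
  assumes p: "p \<in> pts" and k: "k1 \<noteq> 0" "k1 \<noteq> 1" "k2 \<noteq> 0" "k2 \<noteq> 1"
    and ev: "ev p u = (apex k1)\<^sup>2" "ev p v = (apex k2)\<^sup>2"
      "ev (shift p u) (vpl u v) = (apex k3)\<^sup>2"
      "ev (shift p (scl k1 u)) (vpl (scl k1 u) (scl k2 v)) = (apex k4)\<^sup>2"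
    and eq: "vpl u (scl k3 (vpl u v)) = vpl (scl k1 u) (scl k4 (vpl (scl k1 u) (scl k2 v)))"
  shows "sp u v = 0"
proof (rule ccontr)
  assume s: "sp u v \<noteq> 0"
  have "(1 + k3) * sp u v = (k1 + k4 * k1) * sp u v"
    using arg_cong[OF eq, of "\<lambda>x. sp x v"] by (simp add: sp_vpl sp_scl algebra_simps)
  then have k13: "1 + k3 = k1 + k4 * k1" using s by simp
  have "k3 * sp v u = (k4 * k2) * sp v u"
    using arg_cong[OF eq, of "\<lambda>x. sp x u"] by (simp add: sp_vpl sp_scl algebra_simps)
  then have k3: "k3 = k4 * k2" using s by (simp add: sp_commute)
  have k4': "k4 * (k1 + k2) = k1 + 1"
  proof -
    have "k4 * (k1 + k2) = (1 + k4 * k2) + 1 + k4 * k1" by (simp add: algebra_simps)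
    also have "1 + k4 * k2 = k1 + k4 * k1" using k13 by (simp only: k3)
    also have "k1 + k4 * k1 + 1 + k4 * k1 = k1 + 1" by (simp add: ac_simps)
    finally show ?thesis .
  qed
  then have k12: "k1 \<noteq> k2" using k by (auto simp: gf_add_eq_0_iff)
  then have k4: "k4 = (k1 + 1) * inverse (k1 + k2)"
    using k4' by (simp add: gf_add_eq_0_iff field_simps)
  obtain x where x: "k1 = x\<^sup>2" by (rule gf_square_surj)
  obtain y where y: "k2 = y\<^sup>2" by (rule gf_square_surj)
  obtain r where r: "sp u v = r\<^sup>2" by (rule gf_square_surj)
  define c1 c2 c3 c4 m where c: "c1 = apex k1" "c2 = apex k2" "c3 = apex k3" "c4 = apex k4" and m: "m = x * y"
  have "c3\<^sup>2 = (c1 + c2 + r + r\<^sup>2)\<^sup>2"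
    unfolding c ev(3)[symmetric]
    by (simp add: ev_shift ev_vpl sp_vpl ev r gf_square_add)
  then have c3: "c3 = c1 + c2 + r + r\<^sup>2" by simp
  have "c4\<^sup>2 = (k1 * c1 + k2 * c2 + m * r + (m * r)\<^sup>2)\<^sup>2"
    unfolding c ev(4)[symmetric]
    by (simp add: ev_shift ev_vpl ev_scl sp_vpl sp_scl ev r gf_square_add power_mult_distrib m x y algebra_simps)
  then have c4: "c4 = k1 * c1 + k2 * c2 + m * r + (m * r)\<^sup>2" by simp
  have "quad_check x y" using k k12 x y by (intro quad_check) auto
  then have chk: "if m * m + m = 0 then c1 + c2 + c3 = 0 \<and> \<not> tr (c1 * c2)
     else c4 + k1 * c1 + k2 * c2 + m * m * (c1 + c2 + c3) = 0 \<or>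
       (c4 + k1 * c1 + k2 * c2 + m * m * (c1 + c2 + c3)) *
       (c4 + k1 * c1 + k2 * c2 + m * m * (c1 + c2 + c3) + (m * m + m)) \<noteq>
       (c1 + c2 + c3) * ((m * m + m) * (m * m + m))"
    unfolding quad_check_def Let_def c m k3 k4 by (simp only: x y power2_eq_square)
  have A: "c1 + c2 + c3 = r + r * r" by (simp add: c3 power2_eq_square ac_simps)
  have D: "c4 + k1 * c1 + k2 * c2 + m * m * (c1 + c2 + c3) = (m * m + m) * r"
    unfolding A by (simp add: c4 power2_eq_square algebra_simps)
  have r0: "r \<noteq> 0" using r s by auto
  show False
  proof (cases "m * m + m = 0")
    case True
    then have "r + r * r = 0" "\<not> tr (c1 * c2)" using chk A by simp_all
    moreover from this have "r = 1" using r0 by (simp add: gf_add_eq_0_iff)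
    moreover have "tr (ev p u * ev p v / (sp u v)\<^sup>2)" using arf_invariant[OF s, of p] p by (simp add: pts_def)
    ultimately show False by (simp add: r ev c tr_square flip: power_mult_distrib)
  next
    case False
    then have "(m * m + m) * r \<noteq> 0" using r0 by simp
    moreover have "(m * m + m) * r * ((m * m + m) * r + (m * m + m)) = (r + r * r) * ((m * m + m) * (m * m + m))"
      by (simp add: algebra_simps)
    ultimately show False using chk[unfolded if_not_P[OF False] D, unfolded A] by blast
  qed
qed

text \<open>Seen from the common point, the two lines have directions \<open>u\<close> and
  \<open>v\<close>. Once these are proportional, so are the vectors of the two blocks, and both have
  value 1 at the common point, which makes them equal.\<close>

lemma quad_coplanar:
  assumes "quad l m" obtains w where "l \<subseteq> blk w" "m \<subseteq> blk w"
proof -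
  obtain p a a' b b' c n n' where q: "l \<in> dlines" "m \<in> dlines" "l \<noteq> m" "n \<in> dlines" "n' \<in> dlines" "p \<in> l" "p \<in> m"
    "a \<in> l" "a' \<in> l" "a \<noteq> p" "a' \<noteq> p" "a \<noteq> a'" "b \<in> m" "b' \<in> m" "b \<noteq> p" "b' \<noteq> p" "b \<noteq> b'"
    "a \<in> n" "b \<in> n" "c \<in> n" "a' \<in> n'" "b' \<in> n'" "c \<in> n'"
    using assms unfolding quad_def by metis
  have lm: "x \<notin> m" if "x \<in> l" "x \<noteq> p" for x using that q dlines_unique by metis
  have nl: "n \<noteq> l" "n' \<noteq> l" "n \<noteq> m" "n' \<noteq> m" using lm q dlines_unique by metis+
  have ab: "a \<noteq> b" "a' \<noteq> b'" using lm q by metis+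
  have c: "c \<noteq> a" "c \<noteq> a'" "c \<noteq> b" "c \<noteq> b'" using nl q dlines_unique by metis+
  obtain u k1 where u: "a = shift p u" "a' = shift p (scl k1 u)" "k1 \<noteq> 0" "k1 \<noteq> 1" "ev p u = (apex k1)\<^sup>2"
    using collinear_apex[of l p a a'] q by metis
  obtain v k2 where v: "b = shift p v" "b' = shift p (scl k2 v)" "k2 \<noteq> 0" "k2 \<noteq> 1" "ev p v = (apex k2)\<^sup>2"
    using collinear_apex[of m p b b'] q by metis
  obtain x k3 where x: "b = shift a x" "c = shift a (scl k3 x)" "ev a x = (apex k3)\<^sup>2"
    using collinear_apex[of n a b c] q c ab by metis
  obtain y k4 where y: "b' = shift a' y" "c = shift a' (scl k4 y)" "ev a' y = (apex k4)\<^sup>2"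
    using collinear_apex[of n' a' b' c] q c ab by metis
  have "v = vpl u x" "scl k2 v = vpl (scl k1 u) y"
    using u v x(1) y(1) by (auto simp: shift_shift)
  then have xy: "x = vpl u v" "y = vpl (scl k1 u) (scl k2 v)"
    by simp_all
  have "vpl u (scl k3 x) = vpl (scl k1 u) (scl k4 y)"
    using u x(2) y(2) by (auto simp: shift_shift)
  moreover have p: "p \<in> pts" using q dlines_sub by blast
  ultimately have s: "sp u v = 0"
    using u v x y xy by (intro no_skew_quad[of p k1 k2 u v k3 k4]) auto
  obtain w d where w: "p \<in> blk w" "d \<in> T0" "l = dline p w d" "a = shift p (scl d w)"
    using dlines_obtain[of l p a] q by metis
  obtain w' d' where w': "p \<in> blk w'" "d' \<in> T0" "m = dline p w' d'" "b = shift p (scl d' w')"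
    using dlines_obtain[of m p b] q by metis
  have "u = scl d w" "v = scl d' w'" using u v w w' by auto
  then have "sp w' w = 0" using s w w' by (auto simp: sp_scl T0_def sp_commute)
  then obtain e where e: "w' = scl e w" using blk_nonzero[OF w(1)] by (rule sp_eq_0)
  then have "e = 1" using w w' by (simp add: blk_def ev_scl)
  then have "w' = w" using e by simp
  then show thesis using w w' dline_sub_blk by (intro that[of w]) blast+
qed

lemma plane_quad:
  assumes "c \<in> T0" "d \<in> T0" "d \<notin> spr c"
  obtains c' d' z z' where "c' \<in> spr c" "c' \<noteq> 0" "c' \<noteq> c" "d' \<in> spr d" "d' \<noteq> 0" "d' \<noteq> d"
    "z \<in> spr (c + d)" "z' \<in> spr (c' + d')" "c + z = c' + z'"
proof -
  have "plane_check c d"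
    using bspec[OF plane_check_list assms(1)] assms(2,3)
    by (auto simp: list_all_iff set_gf_list T0_def spr_def)
  then obtain c' d' z z' where *: "c' \<in> {rot c, c + rot c}" "d' \<in> {rot d, d + rot d}"
      "z \<in> {rot (c + d), c + d + rot (c + d)}" "z' \<in> {rot (c' + d'), c' + d' + rot (c' + d')}"
      "c + z = c' + z'"
    unfolding plane_check_def list_ex_iff list.set by blast
  have mem: "x \<in> spr c \<and> x \<noteq> 0 \<and> x \<noteq> c" if "x \<in> {rot c, c + rot c}" "c \<in> T0" for x c
    using that rot_T0[of c] add_rot_T0[of c] rot_neq[of c] by (auto simp: spr_def T0_def)
  show thesis
  proof (rule that)
    show "c' \<in> spr c" "c' \<noteq> 0" "c' \<noteq> c" using mem[OF *(1) assms(1)] by simp_all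
    show "d' \<in> spr d" "d' \<noteq> 0" "d' \<noteq> d" using mem[OF *(2) assms(2)] by simp_all
    show "z \<in> spr (c + d)" "z' \<in> spr (c' + d')" using *(3,4) by (simp_all only: spr_def insert_iff simp_thms)
    show "c + z = c' + z'" by (fact *(5))
  qed
qed

lemma blk_quad:
  assumes p: "p \<in> blk w" and c: "c \<in> T0" and d: "d \<in> T0" "d \<notin> spr c"
  shows "quad (dline p w c) (dline p w d)"
proof -
  obtain c' d' z z' where *: "c' \<in> spr c" "c' \<noteq> 0" "c' \<noteq> c" "d' \<in> spr d" "d' \<noteq> 0" "d' \<noteq> d"
    "z \<in> spr (c + d)" "z' \<in> spr (c' + d')" "c + z = c' + z'"
    using plane_quad[OF c d] by metis
  let ?P = "\<lambda>x. shift p (scl x w)"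
  have w: "w \<noteq> (0, 0)" using p by (rule blk_nonzero)
  have inj: "?P x = ?P y \<longleftrightarrow> x = y" for x y by (simp add: scl_inject w)
  have P0: "?P x = p \<longleftrightarrow> x = 0" for x using inj[of x 0] by simp
  have mem: "?P (e + z) \<in> dline (?P e) w x" if "z \<in> spr x" for e z x
    using that by (simp add: dline_def shift_shift vpl_scl image_iff) (metis add.commute)
  have mem0: "?P z \<in> dline p w x" if "z \<in> spr x" for z x using mem[OF that, of 0] by simp
  have T0_sum: "x + y \<in> T0" if "x \<in> spr c" "y \<in> spr d" "x \<noteq> 0" for x y
  proof -
    have "y \<noteq> x"
    proof
      assume "y = x"
      then have "spr d = spr c" using that c d spr_eq by metis
      then show False using d by auto
    qed
    then show ?thesis using that spr_not_tr c d by (auto simp: T0_def tr_add gf_add_eq_0_iff)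
  qed
  have blk: "?P x \<in> blk w" if "\<not> tr x" for x using p that by (auto simp: shift_in_blk)
  have "c \<noteq> 0" "d \<noteq> 0" using c d by (auto simp: T0_def)
  have "?P c \<notin> dline p w d"
  proof
    assume "?P c \<in> dline p w d"
    then have "c \<in> spr d" using w by (auto simp: dline_def scl_inject)
    then show False using spr_eq[OF d(1) _ \<open>c \<noteq> 0\<close>] d(2) by auto
  qed
  then have neq: "dline p w c \<noteq> dline p w d" using mem0[of c c] by auto
  have "dline (?P c) w (c + d) \<in> dlines"
    using c d by (intro dlinesI blk T0_sum) (auto simp: T0_def)
  moreover have "dline (?P c') w (c' + d') \<in> dlines"
    using c d * by (intro dlinesI blk T0_sum spr_not_tr) auto
  moreover have "?P (c + z) \<in> dline (?P c) w (c + d)" using * mem by blast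
  moreover have "?P (c + z) \<in> dline (?P c') w (c' + d')" using * mem by metis
  moreover have "?P d \<in> dline (?P c) w (c + d)" using mem[of "c + d" "c + d" c] by simp
  moreover have "?P d' \<in> dline (?P c') w (c' + d')" using mem[of "c' + d'" "c' + d'" c'] by simp
  moreover have "?P c \<noteq> p" "?P c' \<noteq> p" "?P c \<noteq> ?P c'" "?P d \<noteq> p" "?P d' \<noteq> p" "?P d \<noteq> ?P d'"
    using * \<open>c \<noteq> 0\<close> \<open>d \<noteq> 0\<close> by (simp_all add: P0 scl_inject w)
  moreover have "?P c \<in> dline p w c" "?P c' \<in> dline p w c" "?P d \<in> dline p w d" "?P d' \<in> dline p w d"
    using * mem0 by simp_all
  ultimately show ?thesis
    unfolding quad_def
    apply (intro conjI dlinesI[OF p c] dlinesI[OF p d(1)] neq)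
    apply (rule exI[of _ p], rule exI[of _ "?P c"], rule exI[of _ "?P c'"], rule exI[of _ "?P d"],
      rule exI[of _ "?P d'"], rule exI[of _ "?P (c + z)"], rule exI[of _ "dline (?P c) w (c + d)"],
      rule exI[of _ "dline (?P c') w (c' + d')"])
    apply (intro conjI dline_self dline_point; assumption)
    done
qed

section \<open>Automorphisms permute the blocks\<close>

definition aut :: "(form \<Rightarrow> form) \<Rightarrow> bool" where
  "aut f \<longleftrightarrow> bij_betw f pts pts \<and> (\<lambda>l. f ` l) ` dlines = dlines"

lemma aut_quad:
  assumes f: "aut f" and q: "quad l m" shows "quad (f ` l) (f ` m)"
proof -
  have inj: "inj_on f pts" using f by (auto simp: aut_def bij_betw_def)
  have im: "f ` x \<in> dlines" if "x \<in> dlines" for x using f that by (auto simp: aut_def)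
  obtain p a a' b b' c n n' where q: "l \<in> dlines" "m \<in> dlines" "l \<noteq> m" "n \<in> dlines" "n' \<in> dlines" "p \<in> l" "p \<in> m"
    "a \<in> l" "a' \<in> l" "a \<noteq> p" "a' \<noteq> p" "a \<noteq> a'" "b \<in> m" "b' \<in> m" "b \<noteq> p" "b' \<noteq> p" "b \<noteq> b'"
    "a \<in> n" "b \<in> n" "c \<in> n" "a' \<in> n'" "b' \<in> n'" "c \<in> n'"
    using q unfolding quad_def by metis
  have sub: "l \<subseteq> pts" "m \<subseteq> pts" using q dlines_sub by auto
  have fneq: "f x \<noteq> f y" if "x \<noteq> y" "x \<in> pts" "y \<in> pts" for x y
    using inj that by (auto simp: inj_on_def)
  have "f ` l \<noteq> f ` m" using inj_on_image_eq_iff[OF inj sub] q by simp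
  then show ?thesis
    unfolding quad_def
    apply (intro conjI im q)
    apply assumption
    apply (rule exI[of _ "f p"], rule exI[of _ "f a"], rule exI[of _ "f a'"], rule exI[of _ "f b"],
      rule exI[of _ "f b'"], rule exI[of _ "f c"], rule exI[of _ "f ` n"], rule exI[of _ "f ` n'"])
    apply (intro conjI im q imageI fneq)
    using q sub apply auto
    done
qed

lemma gf_root_T0: "gf_root \<in> T0"
  by (simp add: T0_def gf_root_def zero_gf32_def)

text \<open>Every point of the block off \<open>?l\<close> lies on a line through \<open>p\<close>
  forming a quadrilateral with \<open>?l\<close>. The images of all these quadrilaterals share the
  points \<open>f p\<close> and \<open>f q\<close>, which lie in one block only.\<close>

lemma aut_blk:
  assumes f: "aut f" and p: "p \<in> blk w"
  obtains w' where "f ` blk w = blk w'"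
proof -
  let ?l = "dline p w gf_root"
  have inj: "inj_on f pts" using f by (auto simp: aut_def bij_betw_def)
  have l: "?l \<in> dlines" using p gf_root_T0 by (rule dlinesI)
  then have "f ` ?l \<in> dlines" using f by (auto simp: aut_def)
  then obtain Q w' c where "f ` ?l = dline Q w' c" "Q \<in> blk w'" "c \<in> T0"
    unfolding dlines_def by blast
  then have w': "f ` ?l \<subseteq> blk w'" using dline_sub_blk by metis
  define q where "q = shift p (scl gf_root w)"
  have q: "q \<in> ?l" "q \<in> pts" "q \<noteq> p"
    using p gf_root_T0 dlines_sub[OF l] blk_nonzero[OF p] scl_inject[of w gf_root 0]
    by (auto simp: q_def T0_def scl_eq_0) (metis scl_0 scl_eq_0 shift_inject shift_zero)+
  then have fq: "f p \<noteq> f q" using inj p by (auto simp: inj_on_def blk_def)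
  have "f x \<in> blk w'" if x: "x \<in> blk w" for x
  proof (cases "x \<in> ?l")
    case False
    obtain d where d: "x = shift p (scl d w)" "\<not> tr d" using x blk_eq_image[OF p] by auto
    have "d \<notin> spr gf_root" using False d by (auto simp: dline_def)
    moreover from this have "d \<in> T0" using d zero_spr by (auto simp: T0_def)
    ultimately have "quad ?l (dline p w d)" using p gf_root_T0 by (intro blk_quad)
    then have "quad (f ` ?l) (f ` dline p w d)" using f by (intro aut_quad)
    then obtain w'' where w'': "f ` ?l \<subseteq> blk w''" "f ` dline p w d \<subseteq> blk w''"
      by (rule quad_coplanar)
    have "w' = w''"
      using blk_unique[of "f p" w' "f q" w''] w' w'' q fq dline_self by blast
    then show ?thesis using w'' d by auto
  qed (use w' in auto)
  then have "f ` blk w \<subseteq> blk w'" by auto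
  moreover have "card (f ` blk w) = card (blk w')"
  proof -
    have "f p \<in> blk w'" using w' by auto
    then show ?thesis
      using card_image[OF inj_on_subset[OF inj blk_sub[of w]]] card_blk[OF p] card_blk[of "f p" w'] by simp
  qed
  ultimately have "f ` blk w = blk w'" by (intro card_subset_eq) (auto intro: finite_subset[OF blk_sub])
  then show thesis by (rule that)
qed

section \<open>Semilinear maps\<close>

definition vm :: "gf32 \<Rightarrow> gf32 \<Rightarrow> gf32 \<Rightarrow> gf32 \<Rightarrow> nat \<Rightarrow> vec \<Rightarrow> vec" where
  "vm a b c d n v = (a * frob n (fst v) + b * frob n (snd v), c * frob n (fst v) + d * frob n (snd v))"

text \<open>The form \<open>fm a b c d n Q\<close> is the transport of \<open>Q\<close> along \<open>vm a b c d n\<close>.\<close>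

definition fm :: "gf32 \<Rightarrow> gf32 \<Rightarrow> gf32 \<Rightarrow> gf32 \<Rightarrow> nat \<Rightarrow> form \<Rightarrow> form" where
  "fm a b c d n Q = (frob n (fst Q) * d\<^sup>2 + c * d + frob n (snd Q) * c\<^sup>2,
                     frob n (fst Q) * b\<^sup>2 + a * b + frob n (snd Q) * a\<^sup>2)"

lemma vm_vpl: "vm a b c d n (vpl u v) = vpl (vm a b c d n u) (vm a b c d n v)"
  by (simp add: vm_def vpl_def frob_add algebra_simps)

lemma vm_scl: "vm a b c d n (scl k v) = scl (frob n k) (vm a b c d n v)"
  by (simp add: vm_def scl_def frob_mult algebra_simps)

lemma fm_shift: "fm a b c d n (shift Q u) = shift (fm a b c d n Q) (vm a b c d n u)"
  by (simp add: fm_def shift_def vm_def frob_add frob_power gf_square_add power_mult_distrib algebra_simps)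

lemma vm_comp:
  "vm a b c d m (vm a' b' c' d' n v) = vm (a * frob m a' + b * frob m c') (a * frob m b' + b * frob m d')
     (c * frob m a' + d * frob m c') (c * frob m b' + d * frob m d') (m + n) v"
  by (simp add: vm_def frob_add frob_mult frob_frob algebra_simps)

text \<open>Forms are normalised to have mixed coefficient 1, and the inner determinant is the
  factor by which the inner map would change this coefficient; hence the condition concerns only the
  inner matrix.\<close>

lemma fm_comp:
  assumes "a' * d' + b' * c' = 1"
  shows "fm a b c d m (fm a' b' c' d' n Q) = fm (a * frob m a' + b * frob m c') (a * frob m b' + b * frob m d')
     (c * frob m a' + d * frob m c') (c * frob m b' + d * frob m d') (m + n) Q"
proof -
  have e: "frob m a' * frob m d' + frob m b' * frob m c' = 1"
    using arg_cong[OF assms, of "frob m"] by (simp add: frob_add frob_mult)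
  have *: "x * y * (frob m a' * frob m d') + x * y * (frob m b' * frob m c') = x * y" for x y
    using arg_cong[OF e, of "\<lambda>z. x * y * z"] by (simp only: distrib_left mult_1_right)
  have "(x * frob m a' + y * frob m c') * (x * frob m b' + y * frob m d') =
      x\<^sup>2 * (frob m a' * frob m b') + x * y + y\<^sup>2 * (frob m c' * frob m d')" for x y
    by (subst *[symmetric]) (simp add: power2_eq_square algebra_simps)
  then show ?thesis
    by (simp add: fm_def frob_add frob_mult frob_power frob_frob gf_square_add power_mult_distrib)
      (simp add: algebra_simps)
qed

lemma fm_id [simp]: "fm 1 0 0 1 0 Q = Q"
  by (simp add: fm_def)

locale sl2 =
  fixes a b c d :: gf32
  assumes det: "a * d + b * c = 1"
begin

lemma sp_vm: "sp (vm a b c d n u) (vm a b c d n v) = frob n (sp u v)"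
proof -
  have "sp (vm a b c d n u) (vm a b c d n v) = (a * d + b * c) * frob n (sp u v)"
    by (simp add: vm_def sp_def frob_add frob_mult algebra_simps)
  then show ?thesis by (simp add: det)
qed

lemma ev_fm: "ev (fm a b c d n Q) (vm a b c d n v) = frob n (ev Q v)"
proof -
  \<comment> \<open>The last summand vanishes for determinant one; with it the equation is a
    polynomial identity.\<close>
  have "ev (fm a b c d n Q) (vm a b c d n v) =
      (a * d + b * c)\<^sup>2 * (frob n (fst Q) * (frob n (fst v))\<^sup>2 + frob n (snd Q) * (frob n (snd v))\<^sup>2) +
      (a * d + b * c) * (frob n (fst v) * frob n (snd v)) +
      (a * d + b * c + 1) * (a * c * (frob n (fst v))\<^sup>2 + b * d * (frob n (snd v))\<^sup>2)"
    by (simp add: vm_def fm_def ev_def power2_eq_square algebra_simps)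
  then show ?thesis by (simp add: det ev_def frob_add frob_mult frob_power algebra_simps)
qed

lemma vm_eq_0: "vm a b c d n v = (0, 0) \<longleftrightarrow> v = (0, 0)"
proof
  assume v: "vm a b c d n v = (0, 0)"
  have "sp v u = 0" for u
  proof -
    have "frob n (sp v u) = 0" by (subst sp_vm[symmetric]) (simp add: v sp_def)
    then show ?thesis by simp
  qed
  from this[of "(1, 0)"] this[of "(0, 1)"] show "v = (0, 0)"
    by (cases v) (simp add: sp_def)
qed (simp add: vm_def)

text \<open>The images of the standard basis vectors have symplectic product 1, and on them the
  image form takes the Frobenius images of the old values, so the trace of the Arf invariant is
  kept.\<close>

lemma fm_in_pts: "Q \<in> pts \<Longrightarrow> fm a b c d n Q \<in> pts"
proof -
  assume Q: "Q \<in> pts"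
  have s: "sp (vm a b c d n (1, 0)) (vm a b c d n (0, 1)) = 1" by (simp add: sp_vm) (simp add: sp_def)
  have "tr (ev (fm a b c d n Q) (vm a b c d n (1, 0)) * ev (fm a b c d n Q) (vm a b c d n (0, 1))) =
      tr (fst (fm a b c d n Q) * snd (fm a b c d n Q))"
    using arf_invariant[of _ _ "fm a b c d n Q"] s by (metis div_by_1 one_power2 zero_neq_one)
  then show ?thesis using Q
    by (simp add: ev_fm pts_def flip: frob_mult) (simp add: ev_def)
qed

lemma fm_in_blk: "Q \<in> blk w \<Longrightarrow> fm a b c d n Q \<in> blk (vm a b c d n w)"
  by (simp add: blk_def fm_in_pts ev_fm)

lemma fm_inject: "fm a b c d n Q = fm a b c d n Q' \<longleftrightarrow> Q = Q'"
proof
  assume e: "fm a b c d n Q = fm a b c d n Q'"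
  obtain u where u: "Q' = shift Q u" by (rule shift_surj)
  have "shift (fm a b c d n Q) (vm a b c d n u) = shift (fm a b c d n Q) (0, 0)"
    using e u by (simp add: fm_shift)
  then have "u = (0, 0)" by (simp only: shift_inject vm_eq_0)
  then show "Q = Q'" using u by simp
qed simp

lemma fm_dline: "c' \<in> T0 \<Longrightarrow> fm a b c d n ` dline Q w c' = dline (fm a b c d n Q) (vm a b c d n w) (frob n c')"
proof -
  assume c': "c' \<in> T0"
  have "dline (fm a b c d n Q) (vm a b c d n w) (frob n c') =
      (\<lambda>e. shift (fm a b c d n Q) (scl e (vm a b c d n w))) ` frob n ` spr c'"
    by (simp only: dline_def frob_spr[OF c'])
  then show ?thesis by (simp add: dline_def image_image fm_shift vm_scl)
qed

lemma fm_dlines: "l \<in> dlines \<Longrightarrow> fm a b c d n ` l \<in> dlines"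
proof -
  assume "l \<in> dlines"
  then obtain Q w c' where "l = dline Q w c'" "Q \<in> blk w" "c' \<in> T0" unfolding dlines_def by blast
  then show ?thesis by (simp add: fm_dline dlinesI fm_in_blk frob_T0)
qed

lemma aut_fm: "aut (fm a b c d n)"
  unfolding aut_def
proof
  have inj: "inj_on (fm a b c d n) A" for A by (auto simp: inj_on_def fm_inject)
  have "fm a b c d n ` pts = pts"
    by (intro endo_inj_surj) (auto simp: fm_in_pts inj)
  then show "bij_betw (fm a b c d n) pts pts" by (simp add: bij_betw_def inj)
  show "(\<lambda>l. fm a b c d n ` l) ` dlines = dlines"
    by (intro endo_inj_surj) (auto simp: fm_dlines inj_on_def inj_image_eq_iff[OF inj])
qed

end

lemma vm_transitive:
  assumes "w \<noteq> (0, 0)" obtains a b c d where "sl2 a b c d" "vm a b c d 0 (1, 0) = w"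
proof (cases "fst w = 0")
  case True
  then show thesis
    using assms by (cases w) (auto intro!: that[of 0 "inverse (snd w)" "snd w" 0] simp: sl2_def vm_def)
next
  case False
  then show thesis
    using assms by (cases w) (auto intro!: that[of "fst w" 0 "snd w" "inverse (fst w)"] simp: sl2_def vm_def)
qed

lemma vm_transitive_pair:
  assumes "sp w z \<noteq> 0"
  obtains a b c d where "sl2 a b c d" "vm a b c d 0 (1, 0) = w" "vm a b c d 0 (0, sp w z) = z"
proof
  show "sl2 (fst w) (fst z / sp w z) (snd w) (snd z / sp w z)"
  proof
    have "fst w * (snd z / sp w z) + fst z / sp w z * snd w = (fst w * snd z + snd w * fst z) / sp w z"
      by (simp add: add_divide_distrib mult.commute)
    also have "\<dots> = sp w z / sp w z" by (simp only: sp_def)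
    finally show "fst w * (snd z / sp w z) + fst z / sp w z * snd w = 1" using assms by simp
  qed
qed (use assms in \<open>simp_all add: vm_def\<close>)

lemma blk_nonempty:
  assumes "w \<noteq> (0, 0)" obtains Q where "Q \<in> blk w"
proof -
  obtain a b c d where g: "sl2 a b c d" "vm a b c d 0 (1, 0) = w" using vm_transitive[OF assms] .
  have "(1, 1) \<in> blk (1, 0)" by (simp add: blk_def pts_def ev_def)
  then have "fm a b c d 0 (1, 1) \<in> blk w" using sl2.fm_in_blk[OF g(1)] g(2) by metis
  then show thesis by (rule that)
qed

lemma blk_inject:
  assumes "w \<noteq> (0, 0)" "blk w = blk w'" shows "w = w'"
proof -
  obtain Q where Q: "Q \<in> blk w" using blk_nonempty[OF assms(1)] .
  have "shift Q (scl gf_root w) \<in> blk w" using Q gf_root_T0 by (auto simp: shift_in_blk T0_def)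
  moreover have "shift Q (scl gf_root w) \<noteq> Q"
    using shift_inject[of Q "scl gf_root w" "(0, 0)"] assms(1) gf_root_T0 by (simp add: scl_eq_0 T0_def)
  ultimately show ?thesis using blk_unique Q assms(2) by metis
qed

lemma aut_vec:
  assumes f: "aut f"
  obtains g where "\<And>w. w \<noteq> (0, 0) \<Longrightarrow> f ` blk w = blk (g w)" "bij_betw g (- {(0, 0)}) (- {(0, 0)})"
proof -
  have inj: "inj_on f pts" using f by (auto simp: aut_def bij_betw_def)
  have "\<exists>w'. f ` blk w = blk w'" if "w \<noteq> (0, 0)" for w
    using blk_nonempty[OF that] aut_blk[OF f] by metis
  then obtain g where g: "\<And>w. w \<noteq> (0, 0) \<Longrightarrow> f ` blk w = blk (g w)" by metis
  have "g ` (- {(0, 0)}) \<subseteq> - {(0, 0)}"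
    using g blk_nonempty blk_zero by (metis ComplD ComplI empty_iff image_is_empty image_subsetI singletonD singletonI)
  moreover have "inj_on g (- {(0, 0)})"
  proof (rule inj_onI)
    fix w w' assume w: "w \<in> - {(0, 0)}" "w' \<in> - {(0, 0)}" "g w = g w'"
    then have "f ` blk w = f ` blk w'" using g by auto
    then have "blk w = blk w'" using inj_on_image_eq_iff[OF inj blk_sub blk_sub] by simp
    then show "w = w'" using blk_inject w by auto
  qed
  ultimately have bij: "bij_betw g (- {(0, 0)}) (- {(0, 0)})"
    unfolding bij_betw_def by (intro conjI endo_inj_surj) auto
  show thesis by (rule that[OF g bij])
qed

section \<open>Parallel classes of blocks\<close>

definition meets :: "vec \<Rightarrow> vec \<Rightarrow> bool" where "meets w z \<longleftrightarrow> blk w \<inter> blk z \<noteq> {}"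

text \<open>A form with value 1 at both vectors has Arf invariant \<open>1 / (sp w z)^2\<close>,
  whose trace is that of \<open>1 / sp w z\<close>.\<close>

lemma meets_iff:
  assumes s: "sp w z \<noteq> 0" shows "meets w z \<longleftrightarrow> tr (inverse (sp w z))"
proof
  assume "meets w z"
  then obtain Q where "Q \<in> pts" "ev Q w = 1" "ev Q z = 1" by (auto simp: meets_def blk_def)
  then show "tr (inverse (sp w z))"
    using arf_invariant[OF s, of Q] tr_square[of "inverse (sp w z)"]
    by (simp add: pts_def divide_inverse power_inverse)
next
  assume t: "tr (inverse (sp w z))"
  \<comment> \<open>Cramer's rule for the two linear equations \<open>ev Q w = 1\<close> and
    \<open>ev Q z = 1\<close> in the coefficients of \<open>Q\<close>; their determinant is the
    square of \<open>sp w z\<close>.\<close>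
  define Q where "Q = (((1 + fst w * snd w) * (snd z)\<^sup>2 + (1 + fst z * snd z) * (snd w)\<^sup>2) / (sp w z)\<^sup>2,
     ((1 + fst w * snd w) * (fst z)\<^sup>2 + (1 + fst z * snd z) * (fst w)\<^sup>2) / (sp w z)\<^sup>2)"
  have "(sp w z)\<^sup>2 * ev Q v = ((1 + fst w * snd w) * (snd z)\<^sup>2 + (1 + fst z * snd z) * (snd w)\<^sup>2) * (fst v)\<^sup>2
     + (sp w z)\<^sup>2 * (fst v * snd v)
     + ((1 + fst w * snd w) * (fst z)\<^sup>2 + (1 + fst z * snd z) * (fst w)\<^sup>2) * (snd v)\<^sup>2" for v
    using s by (simp add: Q_def ev_def distrib_left)
  moreover have "((1 + fst w * snd w) * (snd z)\<^sup>2 + (1 + fst z * snd z) * (snd w)\<^sup>2) * (fst w)\<^sup>2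
     + (sp w z)\<^sup>2 * (fst w * snd w)
     + ((1 + fst w * snd w) * (fst z)\<^sup>2 + (1 + fst z * snd z) * (fst w)\<^sup>2) * (snd w)\<^sup>2 = (sp w z)\<^sup>2"
    by (simp add: sp_def power2_eq_square algebra_simps)
  moreover have "((1 + fst w * snd w) * (snd z)\<^sup>2 + (1 + fst z * snd z) * (snd w)\<^sup>2) * (fst z)\<^sup>2
     + (sp w z)\<^sup>2 * (fst z * snd z)
     + ((1 + fst w * snd w) * (fst z)\<^sup>2 + (1 + fst z * snd z) * (fst w)\<^sup>2) * (snd z)\<^sup>2 = (sp w z)\<^sup>2"
    by (simp add: sp_def power2_eq_square algebra_simps)
  ultimately have "(sp w z)\<^sup>2 * ev Q w = (sp w z)\<^sup>2" "(sp w z)\<^sup>2 * ev Q z = (sp w z)\<^sup>2" by simp_all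
  then have e: "ev Q w = 1" "ev Q z = 1" using s by simp_all
  then have "Q \<in> pts"
    using arf_invariant[OF s, of Q] t tr_square[of "inverse (sp w z)"]
    by (simp add: pts_def divide_inverse power_inverse)
  then show "meets w z" using e by (auto simp: meets_def blk_def)
qed

lemma meets_parallel: "meets (scl k w) w \<Longrightarrow> k = 1"
  by (auto simp: meets_def blk_def ev_scl)

text \<open>A table of the traces of inverses, so that the search below does not evaluate any
  inverse.\<close>

fun tr_inv :: "gf32 \<Rightarrow> bool" where
  "tr_inv (GF True False False False False) \<longleftrightarrow> True"
| "tr_inv (GF True True False False False) \<longleftrightarrow> True"
| "tr_inv (GF True False True False False) \<longleftrightarrow> True"
| "tr_inv (GF False True True False False) \<longleftrightarrow> True"
| "tr_inv (GF True True True False False) \<longleftrightarrow> True"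
| "tr_inv (GF False False True True False) \<longleftrightarrow> True"
| "tr_inv (GF True False False False True) \<longleftrightarrow> True"
| "tr_inv (GF False False True False True) \<longleftrightarrow> True"
| "tr_inv (GF True False True False True) \<longleftrightarrow> True"
| "tr_inv (GF False True True False True) \<longleftrightarrow> True"
| "tr_inv (GF True True True False True) \<longleftrightarrow> True"
| "tr_inv (GF False False False True True) \<longleftrightarrow> True"
| "tr_inv (GF True False False True True) \<longleftrightarrow> True"
| "tr_inv (GF False True False True True) \<longleftrightarrow> True"
| "tr_inv (GF False False True True True) \<longleftrightarrow> True"
| "tr_inv (GF True False True True True) \<longleftrightarrow> True"
| "tr_inv _ \<longleftrightarrow> False"

lemma tr_inv: "tr_inv x \<longleftrightarrow> tr (inverse x)"
proof -
  have "list_all (\<lambda>x. tr_inv x \<longleftrightarrow> tr (inverse x)) gf_list"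
    unfolding gf_list_def by code_simp
  then show ?thesis by (simp add: list_all_iff set_gf_list)
qed

text \<open>The first five elements of \<open>gf_list\<close> whose inverse has trace one. They
  already suffice as values for both unknowns.\<close>

definition tr_inv_sample :: "gf32 list" where
  "tr_inv_sample = [GF True False False False False, GF True True False False False, GF True False True False False, GF False True True False False, GF True True True False False]"

lemma inverse_trace_check:
  "list_all (\<lambda>p. let py = map ((*) p) tr_inv_sample in list_all (\<lambda>q. p = 0 \<and> q = 0 \<or>
      list_ex (\<lambda>x. let u = q * x in list_ex (\<lambda>y. tr_inv (y + u)) py) tr_inv_sample) gf_list) gf_list"
  unfolding gf_list_def by code_simp

text \<open>For independent \<open>w\<close>, \<open>w'\<close> and a third vector p w + q w', the
  unknowns are the products of the desired vector \<open>z\<close> with \<open>w'\<close> and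
  \<open>w\<close>. The three traces then say that the block of \<open>z\<close> meets the three
  given blocks.\<close>

lemma inverse_trace_solvable:
  assumes "p \<noteq> 0 \<or> q \<noteq> 0"
  obtains x y where "tr (inverse x)" "tr (inverse y)" "tr (inverse (p * y + q * x))"
proof -
  have "list_ex (\<lambda>x. list_ex (\<lambda>y. tr_inv (p * y + q * x)) tr_inv_sample) tr_inv_sample"
    using inverse_trace_check assms by (auto simp: list_all_iff list_ex_iff set_gf_list Let_def)
  moreover have "list_all tr_inv tr_inv_sample" by code_simp
  ultimately show thesis using that by (auto simp: list_ex_iff list_all_iff tr_inv)
qed

text \<open>Hence proportionality of the vectors of two blocks is a combinatorial property.  If \<open>w' = scl k w\<close>, the
  third vector \<open>scl e w\<close> with \<open>1 / e = 1 + 1 / k\<close> makes the three trace conditions for \<open>z\<close> inconsistent.\<close>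

lemma parallel_iff:
  assumes w: "w \<noteq> (0, 0)" "w' \<noteq> (0, 0)" "w \<noteq> w'"
  shows "sp w w' = 0 \<longleftrightarrow>
    (\<exists>w''. w'' \<noteq> (0, 0) \<and> (\<forall>z. z \<noteq> (0, 0) \<longrightarrow> \<not> (meets z w \<and> meets z w' \<and> meets z w'')))"
proof
  assume "sp w w' = 0"
  then have "sp w' w = 0" by (simp add: sp_commute)
  then obtain k where k: "w' = scl k w" using w(1) by (rule sp_eq_0)
  have k0: "k \<noteq> 0" "k \<noteq> 1" using w k by auto
  define e where "e = inverse (1 + inverse k)"
  have "1 + inverse k \<noteq> 0" using k0 by (simp add: gf_add_eq_0_iff)
  then have e: "e \<noteq> 0" "inverse e = 1 + inverse k" by (simp_all add: e_def)
  have False if z: "z \<noteq> (0, 0)" "meets z w" "meets z w'" "meets z (scl e w)" for z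
  proof (cases "sp z w = 0")
    case True
    then obtain c where c: "z = scl c w" using w(1) by (rule sp_eq_0)
    then have "c = 1" using z meets_parallel by blast
    then have "z = w" using c by simp
    then have "meets (scl k w) w" using z k by (simp add: meets_def Int_commute)
    then show False using meets_parallel k0 by blast
  next
    case False
    then have "tr (inverse (sp z w))" "tr (inverse k * inverse (sp z w))" "tr (inverse e * inverse (sp z w))"
      using z k k0 e meets_iff[of z w] meets_iff[of z w'] meets_iff[of z "scl e w"] by (simp_all add: sp_scl)
    then show False by (simp add: e distrib_right tr_add)
  qed
  then show "\<exists>w''. w'' \<noteq> (0, 0) \<and> (\<forall>z. z \<noteq> (0, 0) \<longrightarrow> \<not> (meets z w \<and> meets z w' \<and> meets z w''))"
    using e w by (intro exI[of _ "scl e w"]) (auto simp: scl_eq_0)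
next
  assume "\<exists>w''. w'' \<noteq> (0, 0) \<and> (\<forall>z. z \<noteq> (0, 0) \<longrightarrow> \<not> (meets z w \<and> meets z w' \<and> meets z w''))"
  then obtain w'' where w'': "w'' \<noteq> (0, 0)"
    "\<And>z. z \<noteq> (0, 0) \<Longrightarrow> \<not> (meets z w \<and> meets z w' \<and> meets z w'')"
    by blast
  show "sp w w' = 0"
  proof (rule ccontr)
    assume s: "sp w w' \<noteq> 0"
    define p q where pq: "p = sp w'' w' / sp w w'" "q = sp w'' w / sp w w'"
    have w''_eq: "w'' = vpl (scl p w) (scl q w')"
    proof -
      have "sp w w' * fst w'' = sp w'' w' * fst w + sp w'' w * fst w'"
        "sp w w' * snd w'' = sp w'' w' * snd w + sp w'' w * snd w'"
        by (simp_all add: sp_def algebra_simps)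
      then have "fst w'' = p * fst w + q * fst w'" "snd w'' = p * snd w + q * snd w'"
        using s by (simp_all add: pq field_simps)
      then show ?thesis by (cases w'') (simp add: vpl_def scl_def)
    qed
    have "p \<noteq> 0 \<or> q \<noteq> 0" using w'' w''_eq by (auto simp: vpl_def)
    then obtain x y where xy: "tr (inverse x)" "tr (inverse y)" "tr (inverse (p * y + q * x))"
      by (rule inverse_trace_solvable)
    \<comment> \<open>The vector whose products with \<open>w\<close> and \<open>w'\<close> are
      \<open>y\<close> and \<open>x\<close>.\<close>
    define z where "z = vpl (scl (x / sp w w') w) (scl (y / sp w w') w')"
    have z: "sp z w = y" "sp z w' = x" "sp z w'' = p * y + q * x"
      using s by (simp_all add: z_def w''_eq sp_vpl sp_scl sp_commute[of w' w])
    have "y \<noteq> 0" "x \<noteq> 0" "p * y + q * x \<noteq> 0" using xy by auto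
    then have "meets z w" "meets z w'" "meets z w''" using z xy by (simp_all add: meets_iff)
    moreover have "z \<noteq> (0, 0)" using z(1) \<open>y \<noteq> 0\<close> by (auto simp: sp_def)
    ultimately show False using w'' by blast
  qed
qed

lemma scl_class:
  assumes "ev Q v \<noteq> 0" obtains k where "k \<noteq> 0" "ev Q (scl k v) = 1"
proof -
  obtain k where "inverse (ev Q v) = k\<^sup>2" by (rule gf_square_surj)
  then have "k\<^sup>2 * ev Q v = 1" using assms by (simp flip: \<open>inverse (ev Q v) = k\<^sup>2\<close>)
  then show thesis by (intro that[of k]) (auto simp: ev_scl)
qed

text \<open>Translates equality of two forms at \<open>v\<close> into a common block from the class
  of \<open>v\<close>, a relation that automorphisms carry along.\<close>

lemma parallel_blocks:
  assumes v: "v \<noteq> (0, 0)" and Q: "Q \<in> pts" "Q' \<in> pts"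
  shows "ev Q v = ev Q' v \<longleftrightarrow> (\<exists>w. w \<noteq> (0, 0) \<and> sp w v = 0 \<and> Q \<in> blk w \<and> Q' \<in> blk w)"
proof
  assume e: "ev Q v = ev Q' v"
  have "ev Q v \<noteq> 0" using v Q by (simp add: ev_eq_0_iff)
  then obtain k where "k \<noteq> 0" "ev Q (scl k v) = 1" by (rule scl_class)
  then show "\<exists>w. w \<noteq> (0, 0) \<and> sp w v = 0 \<and> Q \<in> blk w \<and> Q' \<in> blk w"
    using v Q e by (intro exI[of _ "scl k v"]) (auto simp: scl_eq_0 sp_scl blk_def ev_scl)
next
  assume "\<exists>w. w \<noteq> (0, 0) \<and> sp w v = 0 \<and> Q \<in> blk w \<and> Q' \<in> blk w"
  then obtain w where w: "w \<noteq> (0, 0)" "sp w v = 0" "Q \<in> blk w" "Q' \<in> blk w" by blast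
  obtain k where k: "w = scl k v" using w(2) v by (rule sp_eq_0)
  then have "k\<^sup>2 * ev Q v = k\<^sup>2 * ev Q' v" using w by (simp add: blk_def ev_scl)
  moreover have "k \<noteq> 0" using w k by auto
  ultimately show "ev Q v = ev Q' v" by simp
qed

section \<open>The automorphism group\<close>

locale design_aut =
  fixes f :: "form \<Rightarrow> form" and g :: "vec \<Rightarrow> vec"
  assumes f: "aut f" and g: "\<And>w. w \<noteq> (0, 0) \<Longrightarrow> f ` blk w = blk (g w)"
    and bij_g: "bij_betw g (- {(0, 0)}) (- {(0, 0)})"
begin

lemma f_pts: "Q \<in> pts \<Longrightarrow> f Q \<in> pts"
  using f by (auto simp: aut_def bij_betw_def)

lemma f_surj: assumes "Q \<in> pts" obtains Q' where "Q' \<in> pts" "Q = f Q'"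
proof -
  have "Q \<in> f ` pts" using f assms by (auto simp: aut_def bij_betw_def)
  then show thesis using that by blast
qed

lemma f_inject: "Q \<in> pts \<Longrightarrow> Q' \<in> pts \<Longrightarrow> f Q = f Q' \<longleftrightarrow> Q = Q'"
  using f by (auto simp: aut_def bij_betw_def inj_on_def)

lemma g_nonzero: "w \<noteq> (0, 0) \<Longrightarrow> g w \<noteq> (0, 0)"
  using bij_g by (auto simp: bij_betw_def)

lemma g_surj: assumes "w \<noteq> (0, 0)" obtains w' where "w' \<noteq> (0, 0)" "w = g w'"
proof -
  have "w \<in> g ` (- {(0, 0)})" using bij_g assms by (auto simp: bij_betw_def)
  then show thesis using that by blast
qed

lemma g_inject: "w \<noteq> (0, 0) \<Longrightarrow> w' \<noteq> (0, 0) \<Longrightarrow> g w = g w' \<longleftrightarrow> w = w'"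
  using bij_g by (auto simp: bij_betw_def inj_on_def)

lemma f_in_blk: "Q \<in> pts \<Longrightarrow> w \<noteq> (0, 0) \<Longrightarrow> f Q \<in> blk (g w) \<longleftrightarrow> Q \<in> blk w"
  using g[of w] f_inject blk_sub[of w] by blast

lemma meets_g: "w \<noteq> (0, 0) \<Longrightarrow> z \<noteq> (0, 0) \<Longrightarrow> meets (g w) (g z) \<longleftrightarrow> meets w z"
proof -
  assume "w \<noteq> (0, 0)" "z \<noteq> (0, 0)"
  moreover have "f ` blk w \<inter> f ` blk z = f ` (blk w \<inter> blk z)"
    using f by (intro inj_on_image_Int[symmetric, of f pts] blk_sub) (auto simp: aut_def bij_betw_def)
  ultimately show ?thesis by (simp add: meets_def flip: g)
qed

lemma ex_g: "(\<exists>z. z \<noteq> (0, 0) \<and> P z) \<longleftrightarrow> (\<exists>z. z \<noteq> (0, 0) \<and> P (g z))"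
  using g_surj g_nonzero by metis

lemma sp_g:
  assumes "w \<noteq> (0, 0)" "w' \<noteq> (0, 0)" shows "sp (g w) (g w') = 0 \<longleftrightarrow> sp w w' = 0"
proof (cases "w = w'")
  case False
  have all: "(\<forall>z. z \<noteq> (0, 0) \<longrightarrow> P z) \<longleftrightarrow> (\<forall>z. z \<noteq> (0, 0) \<longrightarrow> P (g z))" for P
    using g_surj g_nonzero by metis
  have "sp (g w) (g w') = 0 \<longleftrightarrow> (\<exists>w''. w'' \<noteq> (0, 0) \<and>
      (\<forall>z. z \<noteq> (0, 0) \<longrightarrow> \<not> (meets z (g w) \<and> meets z (g w') \<and> meets z w'')))"
    using assms False by (intro parallel_iff) (simp_all add: g_nonzero g_inject)
  also have "\<dots> \<longleftrightarrow> (\<exists>w''. w'' \<noteq> (0, 0) \<and>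
      (\<forall>z. z \<noteq> (0, 0) \<longrightarrow> \<not> (meets z (g w) \<and> meets z (g w') \<and> meets z (g w''))))"
    by (rule ex_g)
  also have "\<dots> \<longleftrightarrow> (\<exists>w''. w'' \<noteq> (0, 0) \<and>
      (\<forall>z. z \<noteq> (0, 0) \<longrightarrow> \<not> (meets (g z) (g w) \<and> meets (g z) (g w') \<and> meets (g z) (g w''))))"
    by (intro arg_cong[of _ _ Ex] ext conj_cong refl all)
  also have "\<dots> \<longleftrightarrow> (\<exists>w''. w'' \<noteq> (0, 0) \<and>
      (\<forall>z. z \<noteq> (0, 0) \<longrightarrow> \<not> (meets z w \<and> meets z w' \<and> meets z w'')))"
    using assms by (simp add: meets_g del: split_paired_Ex split_paired_All cong: conj_cong imp_cong)
  also have "\<dots> \<longleftrightarrow> sp w w' = 0"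
    using assms False by (intro parallel_iff[symmetric])
  finally show ?thesis .
qed simp

text \<open>The right-hand side of \<open>parallel_blocks\<close> is transported by \<open>f\<close>
  and \<open>g\<close>. Any representative \<open>v'\<close> of the image class may be used, as
  scaling a vector does not affect where two forms agree.\<close>

lemma ev_class:
  assumes v: "v \<noteq> (0, 0)" and v': "v' \<noteq> (0, 0)" "sp (g v) v' = 0" and Q: "Q \<in> pts" "Q' \<in> pts"
  shows "ev (f Q) v' = ev (f Q') v' \<longleftrightarrow> ev Q v = ev Q' v"
proof -
  obtain k where k: "g v = scl k v'" using v'(2,1) by (rule sp_eq_0)
  then have "k \<noteq> 0" using g_nonzero[OF v] by auto
  then have par: "sp (g w) v' = 0 \<longleftrightarrow> sp w v = 0" if "w \<noteq> (0, 0)" for w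
    using sp_g[OF that v] k by (simp add: sp_scl)
  have "ev (f Q) v' = ev (f Q') v' \<longleftrightarrow> (\<exists>w. w \<noteq> (0, 0) \<and> sp w v' = 0 \<and> f Q \<in> blk w \<and> f Q' \<in> blk w)"
    using v' Q by (intro parallel_blocks) (auto simp: f_pts)
  also have "\<dots> \<longleftrightarrow> (\<exists>w. w \<noteq> (0, 0) \<and> sp w v = 0 \<and> Q \<in> blk w \<and> Q' \<in> blk w)"
    by (subst ex_g) (simp add: par f_in_blk Q del: split_paired_Ex cong: conj_cong)
  also have "\<dots> \<longleftrightarrow> ev Q v = ev Q' v"
    using v Q by (intro parallel_blocks[symmetric]) auto
  finally show ?thesis .
qed

end

text \<open>An automorphism fixing the parallel classes of \<open>(1, 0)\<close> and \<open>(0, 1)\<close> acts on the two coordinates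
  separately.  The trace form forces both coordinate maps to be additive, and the remaining parallel
  classes force them to be multiplicative up to a scalar.\<close>

locale design_aut_fix = design_aut +
  assumes fix1: "sp (g (1, 0)) (1, 0) = 0" and fix2: "sp (g (0, 1)) (0, 1) = 0"
begin

text \<open>The partner \<open>inverse x\<close> makes the pair elliptic, because 1 has trace one.
  No elliptic form has a zero coordinate, so the value at 0 is a convention; it is the one that
  additivity forces.\<close>

definition M :: "gf32 \<Rightarrow> gf32" where "M x = (if x = 0 then 0 else fst (f (x, inverse x)))"
definition N :: "gf32 \<Rightarrow> gf32" where "N x = (if x = 0 then 0 else snd (f (inverse x, x)))"

lemma pts_iff: "(x, y) \<in> pts \<longleftrightarrow> tr (x * y)"
  by (simp add: pts_def)

lemma pts_nonzero: "(x, y) \<in> pts \<Longrightarrow> x \<noteq> 0 \<and> y \<noteq> 0"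
  by (auto simp: pts_def)

lemma f_eq: "(x, y) \<in> pts \<Longrightarrow> f (x, y) = (M x, N y)"
proof -
  assume xy: "(x, y) \<in> pts"
  then have nz: "x \<noteq> 0" "y \<noteq> 0" using pts_nonzero by auto
  have "fst (f (x, y)) = fst (f (x, inverse x))"
    using ev_class[OF _ _ fix1, of "(x, y)" "(x, inverse x)"] xy nz by (simp add: ev_def pts_iff)
  moreover have "snd (f (x, y)) = snd (f (inverse y, y))"
    using ev_class[OF _ _ fix2, of "(x, y)" "(inverse y, y)"] xy nz by (simp add: ev_def pts_iff)
  ultimately show ?thesis using nz by (simp add: M_def N_def prod_eq_iff)
qed

lemma M_zero [simp]: "M 0 = 0" and N_zero [simp]: "N 0 = 0"
  by (simp_all add: M_def N_def)

lemma MN_pts: "(x, y) \<in> pts \<Longrightarrow> (M x, N y) \<in> pts"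
  using f_eq f_pts by metis

lemma M_nonzero: "x \<noteq> 0 \<Longrightarrow> M x \<noteq> 0" and N_nonzero: "x \<noteq> 0 \<Longrightarrow> N x \<noteq> 0"
  using pts_nonzero MN_pts[of x "inverse x"] MN_pts[of "inverse x" x] by (auto simp: pts_iff)

lemma M_inj: "M x = M y \<Longrightarrow> x = y"
proof (cases "x = 0 \<or> y = 0")
  case False
  assume "M x = M y"
  then show ?thesis
    using ev_class[OF _ _ fix1, of "(x, inverse x)" "(y, inverse y)"] False
    by (simp add: ev_def pts_iff f_eq)
qed (use M_nonzero in force)

lemma N_inj: "N x = N y \<Longrightarrow> x = y"
proof (cases "x = 0 \<or> y = 0")
  case False
  assume "N x = N y"
  then show ?thesis
    using ev_class[OF _ _ fix2, of "(inverse x, x)" "(inverse y, y)"] False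
    by (simp add: ev_def pts_iff f_eq)
qed (use N_nonzero in force)

lemma M_surj: obtains y where "x = M y"
proof -
  have "surj M" using M_inj by (intro finite_UNIV_inj_surj) (auto simp: inj_def)
  then show thesis using that by (metis surjD)
qed

lemma N_surj: obtains y where "x = N y"
proof -
  have "surj N" using N_inj by (intro finite_UNIV_inj_surj) (auto simp: inj_def)
  then show thesis using that by (metis surjD)
qed

lemma tr_MN: "tr (M x * N y) \<longleftrightarrow> tr (x * y)"
proof
  assume "tr (x * y)" then show "tr (M x * N y)" using MN_pts by (simp add: pts_iff)
next
  assume "tr (M x * N y)"
  then have "(M x, N y) \<in> pts" by (simp add: pts_iff)
  then obtain Q where Q: "Q \<in> pts" "(M x, N y) = f Q" by (rule f_surj)
  obtain x' y' where xy: "Q = (x', y')" by (cases Q)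
  then have "M x = M x'" "N y = N y'" using Q by (simp_all add: f_eq)
  then have "x = x'" "y = y'" by (blast intro: M_inj N_inj)+
  then show "tr (x * y)" using Q xy by (simp add: pts_iff)
qed

lemma M_add: "M (x + y) = M x + M y"
proof (rule tr_nondegenerate)
  fix z obtain z' where "z = N z'" by (rule N_surj)
  then show "tr (M (x + y) * z) = tr ((M x + M y) * z)" by (simp add: distrib_right tr_add tr_MN)
qed

lemma N_add: "N (x + y) = N x + N y"
proof (rule tr_nondegenerate)
  fix z obtain z' where "z = M z'" by (rule M_surj)
  then show "tr (N (x + y) * z) = tr ((N x + N y) * z)"
    using tr_MN by (simp add: distrib_left tr_add mult.commute[of _ "M z'"])
qed

text \<open>The class of \<open>(1, e)\<close> is mapped to the class of some \<open>(1, e')\<close>; comparing the values at these vectors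
  of two forms differing by \<open>(e\<^sup>2 y, y)\<close> gives \<open>M (e\<^sup>2 y) = e'\<^sup>2 N y\<close>.\<close>

lemma M_scale:
  assumes "z \<noteq> 0" obtains k where "k \<noteq> 0" "\<And>y. M (z * y) = k * N y"
proof -
  obtain e where e: "z = e\<^sup>2" by (rule gf_square_surj)
  have e0: "e \<noteq> 0" using e assms by auto
  define u where "u = g (1, e)"
  have "sp (1, e) (1, 0) \<noteq> 0" "sp (1, e) (0, 1) \<noteq> 0" using e0 by (simp_all add: sp_def)
  then have *: "sp u (g (1, 0)) \<noteq> 0" "sp u (g (0, 1)) \<noteq> 0"
    unfolding u_def by (simp_all add: sp_g)
  have "fst u \<noteq> 0"
  proof
    assume "fst u = 0"
    then have "sp u (g (0, 1)) = 0" using fix2 by (simp add: sp_def)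
    then show False using * by simp
  qed
  moreover have "snd u \<noteq> 0"
  proof
    assume "snd u = 0"
    then have "sp u (g (1, 0)) = 0" using fix1 by (simp add: sp_def)
    then show False using * by simp
  qed
  ultimately have e'0: "snd u / fst u \<noteq> 0" by simp
  define e' where "e' = snd u / fst u"
  have par: "sp (g (1, e)) (1, e') = 0"
    using \<open>fst u \<noteq> 0\<close> by (simp add: sp_def e'_def flip: u_def)
  show thesis
  proof (rule that[of "e'\<^sup>2"])
    show "e'\<^sup>2 \<noteq> 0" using e'0 by (simp add: e'_def)
    fix y show "M (z * y) = e'\<^sup>2 * N y"
    proof (cases "y = 0")
      case False
      \<comment> \<open>Two forms differing by \<open>(z * y, y)\<close> agree at (1, e); both must
        be made elliptic. Below, \<open>\<alpha> * \<beta>\<close> equals x^2 + x + 1, and the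
        product for the second form exceeds it by d^2 + d + d k. So \<open>k\<close> is chosen to
        make d k nonzero of trace zero.\<close>
      define d where "d = y * e"
      have d: "d \<noteq> 0" using False e0 by (simp add: d_def)
      define k where "k = gf_root / d"
      have root: "gf_root \<noteq> 0" "\<not> tr gf_root" using gf_root_T0 by (simp_all add: T0_def)
      have k: "k \<noteq> 0" "d * k = gf_root" using d root by (simp_all add: k_def)
      define x where "x = inverse k"
      have xk: "x * k = 1" using k by (simp add: x_def)
      define \<alpha> \<beta> where "\<alpha> = e * x" and "\<beta> = (x + 1 + k) * inverse e"
      have "\<alpha> * \<beta> = (e * inverse e) * (x * (x + 1 + k))"
        by (simp only: \<alpha>_def \<beta>_def ac_simps)
      then have "\<alpha> * \<beta> = (x\<^sup>2 + x) + x * k"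
        using e0 by (simp add: power2_eq_square algebra_simps)
      then have p1: "tr (\<alpha> * \<beta>)" using tr_square_add[of x] xk by (simp add: tr_add)
      have "e\<^sup>2 * \<beta> = (e * inverse e) * (e * (x + 1 + k))"
        by (simp only: \<beta>_def power2_eq_square ac_simps)
      then have e\<beta>: "e\<^sup>2 * \<beta> = e * x + e + e * k"
        using e0 by (simp add: algebra_simps)
      have "(\<alpha> + z * y) * (\<beta> + y) = \<alpha> * \<beta> + y * (\<alpha> + e\<^sup>2 * \<beta>) + d\<^sup>2"
        by (simp add: e d_def power2_eq_square algebra_simps)
      also have "y * (\<alpha> + e\<^sup>2 * \<beta>) = d + d * k"
        unfolding e\<beta> by (simp add: \<alpha>_def d_def algebra_simps)
      finally have p2: "tr ((\<alpha> + z * y) * (\<beta> + y))"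
        using p1 root by (simp add: tr_add tr_square k)
      have "ev (f (\<alpha>, \<beta>)) (1, e') = ev (f (\<alpha> + z * y, \<beta> + y)) (1, e')"
        using p1 p2 by (subst ev_class[OF _ _ par]) (simp_all add: pts_iff ev_def e algebra_simps)
      then show ?thesis
        using p1 p2 by (simp add: f_eq pts_iff ev_def M_add N_add algebra_simps)
          (simp add: gf_add_eq_0_iff flip: add.assoc)
    qed simp
  qed
qed

lemma f_diagonal:
  obtains k n where "k \<noteq> 0" "n < 5" "\<And>Q. Q \<in> pts \<Longrightarrow> f Q = fm k 0 0 (inverse k) n Q"
proof -
  obtain c where c: "c \<noteq> 0" "\<And>y. M (1 * y) = c * N y" using M_scale[of 1] by auto
  define m where "m = M 1"
  have m: "m \<noteq> 0" by (simp add: m_def M_nonzero)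
  have mult: "M (x * y) * m = M x * M y" for x y
  proof (cases "x = 0")
    case False
    then obtain k where k: "k \<noteq> 0" "\<And>y. M (x * y) = k * N y" by (rule M_scale) blast
    have "M (x * y) * M 1 * c = M (x * 1) * M y * c"
      using c(2)[of 1] c(2)[of y] k(2)[of y] k(2)[of 1] by simp
    then show ?thesis using c(1) by (simp add: m_def)
  qed simp
  define s where "s x = M x / m" for x
  obtain n where n: "n < 5" "s = frob n"
  proof (rule gf32_aut_eq_frob[of s])
    show "s (x + y) = s x + s y" for x y by (simp add: s_def M_add add_divide_distrib)
    show "s (x * y) = s x * s y" for x y
      using mult[of x y] m by (simp add: s_def field_simps)
    show "s 1 = 1" using m by (simp add: s_def flip: m_def)
  qed
  have M: "M x = m * frob n x" for x using m fun_cong[OF n(2), of x] by (simp add: s_def field_simps)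
  have N: "N x = m / c * frob n x" for x using c M[of x] by (simp add: field_simps)
  \<comment> \<open>\<open>tr_MN\<close> with first argument 1 forces the scale factors of
    \<open>M\<close> and \<open>N\<close> to be inverse to each other.\<close>
  have "m * (m / c) = 1"
  proof (rule tr_nondegenerate)
    fix y obtain x where x: "y = frob n x" by (rule frob_surj)
    have "tr (M 1 * N x) = tr (1 * y)" using x by (simp add: tr_MN)
    then show "tr (m * (m / c) * y) = tr (1 * y)" by (simp add: M N x mult.assoc)
  qed
  then have mc: "m / c = inverse m" using m by (simp add: field_simps)
  obtain k where k: "inverse m = k\<^sup>2" by (rule gf_square_surj)
  have k0: "k \<noteq> 0" using k m by auto
  have m_eq: "m = (inverse k)\<^sup>2" using k by (metis inverse_inverse_eq power_inverse)
  show thesis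
  proof (rule that[OF k0 n(1)])
    fix Q assume "Q \<in> pts"
    then have "f Q = (M (fst Q), N (snd Q))" by (simp add: f_eq flip: f_eq[of "fst Q" "snd Q"])
    then show "f Q = fm k 0 0 (inverse k) n Q"
      by (simp add: fm_def M N mc k mult.commute flip: m_eq)
  qed
qed

end

lemma aut_comp: "aut f \<Longrightarrow> aut f' \<Longrightarrow> aut (f \<circ> f')"
  unfolding aut_def by (auto simp: bij_betw_trans image_comp[symmetric] simp flip: image_image)

lemma fm_left_inverse:
  assumes "sl2 a b c d" shows "fm a b c d 0 (fm d b c a 0 Q) = Q"
  using assms by (subst fm_comp) (simp_all add: sl2_def ac_simps)

text \<open>Some matrix of determinant one agrees with \<open>g\<close> on (1, 0) and on the class
  of (0, 1). Composing \<open>f\<close> with its inverse gives an automorphism covered by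
  \<open>design_aut_fix\<close>.\<close>

theorem aut_eq_fm:
  assumes f: "aut f"
  obtains a b c d n where "sl2 a b c d" "n < 5" "\<And>Q. Q \<in> pts \<Longrightarrow> f Q = fm a b c d n Q"
proof -
  obtain g where g: "\<And>w. w \<noteq> (0, 0) \<Longrightarrow> f ` blk w = blk (g w)" "bij_betw g (- {(0, 0)}) (- {(0, 0)})"
    using aut_vec[OF f] by metis
  interpret F: design_aut f g by standard (fact f, fact g(1), fact g(2))
  have s: "sp (g (1, 0)) (g (0, 1)) \<noteq> 0" by (simp add: F.sp_g) (simp add: sp_def)
  obtain a b c d where A: "sl2 a b c d" "vm a b c d 0 (1, 0) = g (1, 0)"
      "vm a b c d 0 (0, sp (g (1, 0)) (g (0, 1))) = g (0, 1)"
    using vm_transitive_pair[OF s] by metis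
  interpret A: sl2 a b c d by (fact A)
  have det': "d * a + b * c = 1" using A.det by (simp add: mult.commute)
  interpret A': sl2 d b c a by standard (fact det')
  define h where "h = fm d b c a 0 \<circ> f"
  have h: "aut h" unfolding h_def by (intro aut_comp A'.aut_fm f)
  obtain g' where g': "\<And>w. w \<noteq> (0, 0) \<Longrightarrow> h ` blk w = blk (g' w)" "bij_betw g' (- {(0, 0)}) (- {(0, 0)})"
    using aut_vec[OF h] by metis
  interpret H: design_aut h g' by standard (fact h, fact g'(1), fact g'(2))
  have inv: "vm d b c a 0 (vm a b c d 0 v) = v" for v
    using A.det by (simp add: vm_comp) (simp add: vm_def ac_simps)
  have g'_eq: "g' w = vm d b c a 0 (g w)" if w: "w \<noteq> (0, 0)" for w
  proof -
    have "h ` blk w = fm d b c a 0 ` blk (g w)" by (simp only: h_def image_comp[symmetric] g(1)[OF w])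
    also have "\<dots> \<subseteq> blk (vm d b c a 0 (g w))" using A'.fm_in_blk by blast
    finally have sub: "blk (g' w) \<subseteq> blk (vm d b c a 0 (g w))" using g'(1)[OF w] by simp
    obtain Q where Q: "Q \<in> blk (g' w)" using blk_nonempty H.g_nonzero[OF w] by metis
    have "blk (g' w) = blk (vm d b c a 0 (g w))"
      using sub card_blk[OF Q] card_blk[of Q "vm d b c a 0 (g w)"] Q by (intro card_subset_eq) auto
    then show ?thesis using blk_inject H.g_nonzero[OF w] by metis
  qed
  have "g' (1, 0) = (1, 0)" using g'_eq inv A(2) by (metis prod.inject zero_neq_one)
  moreover have "g' (0, 1) = (0, sp (g (1, 0)) (g (0, 1)))"
    using g'_eq inv A(3) by (metis prod.inject zero_neq_one)
  ultimately interpret H: design_aut_fix h g'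
    by unfold_locales (simp_all add: sp_def)
  obtain k n where k: "k \<noteq> 0" "n < 5" "\<And>Q. Q \<in> pts \<Longrightarrow> h Q = fm k 0 0 (inverse k) n Q"
    using H.f_diagonal by metis
  interpret K: sl2 k 0 0 "inverse k" by standard (use k in simp)
  have "f Q = fm (a * k) (b * inverse k) (c * k) (d * inverse k) n Q" if "Q \<in> pts" for Q
  proof -
    have "f Q = fm a b c d 0 (h Q)" by (simp add: h_def fm_left_inverse[OF A(1)])
    also have "\<dots> = fm a b c d 0 (fm k 0 0 (inverse k) n Q)" using k that by simp
    finally show ?thesis using fm_comp[OF K.det, of a b c d 0 n Q] by simp
  qed
  moreover have "sl2 (a * k) (b * inverse k) (c * k) (d * inverse k)"
    using k A.det by (simp add: sl2_def mult.assoc) (simp add: mult.left_commute mult.commute)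
  ultimately show thesis using k(2) that by metis
qed

section \<open>The automorphisms as an abstract group\<close>

abbreviation A\<^sub>0 :: "(form \<Rightarrow> form) monoid" where "A\<^sub>0 \<equiv> aut_group pts dlines"

lemma group_A0: "group A\<^sub>0"
  by (rule group_aut_group) (rule dlines_sub)

lemma mult_A0: "f \<in> carrier A\<^sub>0 \<Longrightarrow> g \<in> carrier A\<^sub>0 \<Longrightarrow> f \<otimes>\<^bsub>A\<^sub>0\<^esub> g = compose pts f g"
  by (simp add: aut_group_def BijGroup_def)

lemma one_A0: "\<one>\<^bsub>A\<^sub>0\<^esub> = (\<lambda>x\<in>pts. x)"
  by (simp add: aut_group_def BijGroup_def)

lemma in_A0_iff: "f \<in> carrier A\<^sub>0 \<longleftrightarrow> f \<in> extensional pts \<and> aut f"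
  by (auto simp: aut_group_def Bij_def aut_def)

lemma aut_cong:
  assumes "\<And>Q. Q \<in> pts \<Longrightarrow> f Q = f' Q" shows "aut f \<longleftrightarrow> aut f'"
proof -
  have "f ` l = f' ` l" if "l \<in> dlines" for l 
    by (rule image_cong[OF refl assms]) (use dlines_sub[OF that] in auto)
  then have "(\<lambda>l. f ` l) ` dlines = (\<lambda>l. f' ` l) ` dlines" by (rule image_cong[OF refl])
  then show ?thesis using bij_betw_cong[of pts f f' pts] assms by (simp add: aut_def)
qed

lemma fm_in_A0: "sl2 a b c d \<Longrightarrow> restrict (fm a b c d n) pts \<in> carrier A\<^sub>0"
  using sl2.aut_fm[of a b c d n] aut_cong[of "restrict (fm a b c d n) pts" "fm a b c d n"]
  by (simp add: in_A0_iff)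

lemma A0E:
  assumes "f \<in> carrier A\<^sub>0"
  obtains a b c d n where "sl2 a b c d" "n < 5" "f = restrict (fm a b c d n) pts"
proof -
  have f: "f \<in> extensional pts" "aut f" using assms by (simp_all add: in_A0_iff)
  obtain a b c d n where *: "sl2 a b c d" "n < 5" "\<And>Q. Q \<in> pts \<Longrightarrow> f Q = fm a b c d n Q"
    using aut_eq_fm[OF f(2)] by metis
  have "f = restrict (fm a b c d n) pts" using f(1) * by (intro extensionalityI[of _ pts]) auto
  with * that show thesis by metis
qed

lemma A0_pts: "f \<in> carrier A\<^sub>0 \<Longrightarrow> Q \<in> pts \<Longrightarrow> f Q \<in> pts"
  by (auto simp: in_A0_iff aut_def bij_betw_def)

section \<open>Flag-transitivity\<close>

text \<open>The five conjugates of the root meet all five members of the spread, so the Frobenius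
  map is transitive on the directions of lines in the base block.\<close>

lemma frob_root_check: "\<forall>c\<in>T0. list_ex (\<lambda>x. x = c \<or> x = rot c \<or> x = c + rot c)
   (let r = gf_root; a = r * r; b = a * a; c = b * b; d = c * c in [r, a, b, c, d])"
  unfolding T0_list gf_list_def by code_simp

lemma frob_root_in_spr:
  assumes "c \<in> T0" obtains n where "frob n gf_root \<in> spr c"
proof -
  have "\<exists>n\<in>{0, 1, 2, 3, 4}. frob n gf_root \<in> spr c"
    using bspec[OF frob_root_check assms]
    by (auto simp: Let_def spr_def frob_Suc numeral_eq_Suc power2_eq_square)
  with that show thesis by blast
qed

abbreviation base_line :: "form set" where "base_line \<equiv> dline (1, 1) (1, 0) gf_root"

lemma base_point: "(1, 1) \<in> blk (1, 0)"
  by (simp add: blk_def pts_def ev_def)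

text \<open>The map \<open>fm 1 b 0 1 n\<close> adds b^2 + b to the second coordinate of (1, 1), and
  by \<open>tr_0E\<close> these are all elements of trace zero. The exponent stays free, because (1,
  1) is fixed by the Frobenius map; it is used later to adjust the direction of a line.\<close>

lemma base_blkE:
  assumes "Q \<in> blk (1, 0)" obtains b where "Q = fm 1 b 0 1 n (1, 1)"
proof -
  have Q: "fst Q = 1" "tr (snd Q)" using assms by (auto simp: blk_def ev_def pts_def)
  then have "\<not> tr (snd Q + 1)" by (simp add: tr_add)
  then obtain b where "snd Q + 1 = b\<^sup>2 + b" by (rule tr_0E)
  then have "snd Q = b\<^sup>2 + b + 1" by (metis add.commute gf_double_left)
  then have "Q = fm 1 b 0 1 n (1, 1)" using Q by (cases Q) (simp add: fm_def)
  then show thesis by (rule that)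
qed

lemma blk_transitive:
  assumes x: "x \<in> blk w"
  obtains a b c d where "sl2 a b c d" "fm a b c d n (1, 1) = x" "vm a b c d n (1, 0) = w"
proof -
  obtain a b c d where A: "sl2 a b c d" "vm a b c d 0 (1, 0) = w"
    using vm_transitive[OF blk_nonzero[OF x]] .
  interpret A: sl2 a b c d by (fact A)
  interpret A': sl2 d b c a by standard (use A.det in \<open>simp add: mult.commute\<close>)
  have "vm d b c a 0 w = (1, 0)"
    using A.det by (simp add: vm_comp flip: A(2)) (simp add: vm_def ac_simps)
  then have "fm d b c a 0 x \<in> blk (1, 0)" using A'.fm_in_blk[OF x] by metis
  then obtain e where e: "fm d b c a 0 x = fm 1 e 0 1 n (1, 1)" by (rule base_blkE)
  have "x = fm a b c d 0 (fm 1 e 0 1 n (1, 1))" by (simp add: fm_left_inverse A flip: e)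
  also have "\<dots> = fm a (a * e + b) c (c * e + d) n (1, 1)"
    using fm_comp[of 1 1 e 0 a b c d 0 n "(1, 1)"] by simp
  finally have "fm a (a * e + b) c (c * e + d) n (1, 1) = x" by simp
  moreover have "sl2 a (a * e + b) c (c * e + d)"
    using A.det by (simp add: sl2_def algebra_simps)
  moreover have "vm a (a * e + b) c (c * e + d) n (1, 0) = w"
    using A(2) by (simp add: vm_def)
  ultimately show thesis using that by metis
qed

lemma flag_from_base:
  assumes "l \<in> dlines" "x \<in> l"
  obtains f where "f \<in> carrier A\<^sub>0" "f (1, 1) = x" "f ` base_line = l"
proof -
  have "card l = 4" using assms(1) design2_dlines by (simp add: design2_def)
  then have "\<not> l \<subseteq> {x}" using card_mono[of "{x}" l] by auto
  then obtain y where "y \<in> l" "y \<noteq> x" by blast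
  then obtain w e where l: "x \<in> blk w" "e \<in> T0" "l = dline x w e"
    using dlines_obtain assms by metis
  obtain n where n: "frob n gf_root \<in> spr e" using frob_root_in_spr[OF l(2)] .
  obtain a b c d where A: "sl2 a b c d" "fm a b c d n (1, 1) = x" "vm a b c d n (1, 0) = w"
    using blk_transitive[OF l(1)] .
  have "frob n gf_root \<noteq> 0" using gf_root_T0 by (simp add: T0_def)
  then have spr: "spr (frob n gf_root) = spr e" using spr_eq l n by blast
  have "restrict (fm a b c d n) pts ` base_line = fm a b c d n ` base_line"
    using dlines_sub[OF dlinesI[OF base_point gf_root_T0]] by (intro image_cong) auto
  also have "\<dots> = dline x w (frob n gf_root)" using A by (simp add: sl2.fm_dline gf_root_T0)
  also have "\<dots> = l" by (simp add: dline_def spr l(3))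
  finally have "restrict (fm a b c d n) pts ` base_line = l" .
  moreover have "restrict (fm a b c d n) pts (1, 1) = x" using A base_point by (simp add: blk_def)
  ultimately show thesis using fm_in_A0[OF A(1)] that by metis
qed

lemma flag_transitive_A0: "flag_transitive dlines (carrier A\<^sub>0)"
  unfolding flag_transitive_def
proof (intro ballI)
  fix l x m y assume *: "l \<in> dlines" "x \<in> l" "m \<in> dlines" "y \<in> m"
  interpret A: group "A\<^sub>0" by (rule group_A0)
  obtain f where f: "f \<in> carrier A\<^sub>0" "f (1, 1) = x" "f ` base_line = l"
    using flag_from_base[of l x] * by metis
  obtain g where g: "g \<in> carrier A\<^sub>0" "g (1, 1) = y" "g ` base_line = m"
    using flag_from_base[of m y] * by metis
  let ?i = "inv\<^bsub>A\<^sub>0\<^esub> f"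
  have i: "?i \<in> carrier A\<^sub>0" using f by simp
  have "?i \<otimes>\<^bsub>A\<^sub>0\<^esub> f = \<one>\<^bsub>A\<^sub>0\<^esub>" using f by simp
  then have "compose pts ?i f = (\<lambda>x\<in>pts. x)" using f i by (simp add: mult_A0 one_A0)
  then have if_id: "?i (f Q) = Q" if "Q \<in> pts" for Q using that by (metis compose_eq restrict_apply')
  have sub: "base_line \<subseteq> pts" using dlines_sub[OF dlinesI[OF base_point gf_root_T0]] .
  let ?h = "g \<otimes>\<^bsub>A\<^sub>0\<^esub> ?i"
  have h: "?h (f Q) = g Q" if "Q \<in> pts" for Q
    using that f g i by (simp add: mult_A0 compose_def A0_pts if_id)
  have "?h x = y" using h[of "(1, 1)"] f g base_point by (simp add: blk_def)
  moreover have "?h ` l = m"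
  proof -
    have "?h ` l = (\<lambda>Q. ?h (f Q)) ` base_line" by (simp add: image_image flip: f(3))
    also have "\<dots> = g ` base_line" using sub h by (intro image_cong) auto
    finally show ?thesis using g by simp
  qed
  ultimately show "\<exists>h\<in>carrier A\<^sub>0. h x = y \<and> h ` l = m" using g i by blast
qed

section \<open>The isomorphism with \<open>P\<Gamma>L(2, 32)\<close>\<close>

lemma vm_inject:
  assumes "a * d + b * c \<noteq> 0" "vm a b c d n = vm a' b' c' d' n'"
  shows "a' = a" "b' = b" "c' = c" "d' = d" "frob n' = frob n"
proof -
  have e: "vm a b c d n v = vm a' b' c' d' n' v" for v using assms by simp
  show a: "a' = a" "c' = c" using e[of "(1, 0)"] by (auto simp: vm_def)
  show "b' = b" "d' = d" using e[of "(0, 1)"] by (auto simp: vm_def)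
  have "a \<noteq> 0 \<or> c \<noteq> 0" using assms(1) by auto
  then have "frob n' k = frob n k" for k using e[of "(k, 0)"] a by (auto simp: vm_def)
  then show "frob n' = frob n" by auto
qed

lemma vm_0_10 [simp]: "vm a b c d n (1, 0) = (a, c)" and vm_0_01 [simp]: "vm a b c d n (0, 1) = (b, d)"
  by (simp_all add: vm_def)

text \<open>Faithfulness: each block is mapped to itself, and a block determines its vector.\<close>

lemma fm_trivial:
  assumes A: "sl2 a b c d" and id: "\<And>Q. Q \<in> pts \<Longrightarrow> fm a b c d n Q = Q"
  shows "vm a b c d n v = v"
proof (cases "v = (0, 0)")
  case True
  then show ?thesis by (simp add: vm_def)
next
  case False
  interpret sl2 a b c d by (fact A)
  obtain Q where Q: "Q \<in> blk v" using blk_nonempty[OF False] .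
  have sub: "blk v \<subseteq> blk (vm a b c d n v)"
    using fm_in_blk id by (metis blk_sub subset_iff)
  then have "Q \<in> blk (vm a b c d n v)" using Q by blast
  then have "blk v = blk (vm a b c d n v)"
    using sub card_blk[OF Q] card_blk[of Q "vm a b c d n v"] by (intro card_subset_eq) auto
  then show ?thesis using blk_inject[OF False] by metis
qed

text \<open>Dividing by the determinant makes the action invariant under multiplying the matrix by a scalar.\<close>

definition pfm :: "gf32 \<Rightarrow> gf32 \<Rightarrow> gf32 \<Rightarrow> gf32 \<Rightarrow> nat \<Rightarrow> form \<Rightarrow> form" where
  "pfm a b c d n Q = scl (inverse (a * d + b * c)) (fm a b c d n Q)"

lemma normalize_det:
  fixes a b c d :: gf32
  assumes "a * d + b * c \<noteq> 0"
  obtains k where "k \<noteq> 0" "k\<^sup>2 * (a * d + b * c) = 1"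
proof -
  obtain k where k: "inverse (a * d + b * c) = k\<^sup>2" by (rule gf_square_surj)
  have "k\<^sup>2 * (a * d + b * c) = 1" unfolding k[symmetric] using assms by simp
  then show thesis by (intro that[of k]) auto
qed

lemma pfm_normalize:
  fixes a b c d k :: gf32
  assumes "k\<^sup>2 * (a * d + b * c) = 1"
  shows "sl2 (k * a) (k * b) (k * c) (k * d)" "pfm a b c d n Q = fm (k * a) (k * b) (k * c) (k * d) n Q"
proof -
  have "a * d + b * c \<noteq> 0" using assms by auto
  then have i: "inverse (a * d + b * c) = k\<^sup>2" using assms by (metis inverse_unique mult.commute)
  show "sl2 (k * a) (k * b) (k * c) (k * d)"
    using assms by (simp add: sl2_def power2_eq_square algebra_simps)
  show "pfm a b c d n Q = fm (k * a) (k * b) (k * c) (k * d) n Q"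
    unfolding pfm_def i by (simp add: scl_def fm_def power2_eq_square algebra_simps)
qed

lemma pfm_comp:
  assumes "a * d + b * c \<noteq> 0" "a' * d' + b' * c' \<noteq> 0"
  shows "pfm a b c d m (pfm a' b' c' d' n Q) =
    pfm (a * frob m a' + b * frob m c') (a * frob m b' + b * frob m d')
     (c * frob m a' + d * frob m c') (c * frob m b' + d * frob m d') (m + n) Q" (is "_ = pfm ?a ?b ?c ?d _ _")
    and "(a * frob m a' + b * frob m c') * (c * frob m b' + d * frob m d') +
      (a * frob m b' + b * frob m d') * (c * frob m a' + d * frob m c') \<noteq> 0"
proof -
  have det: "?a * ?d + ?b * ?c = (a * d + b * c) * frob m (a' * d' + b' * c')"
    by (simp add: frob_add frob_mult algebra_simps)
  show "?a * ?d + ?b * ?c \<noteq> 0" unfolding det using assms by simp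
  obtain k where k: "k\<^sup>2 * (a * d + b * c) = 1" using normalize_det[OF assms(1)] by metis
  obtain l where l: "l\<^sup>2 * (a' * d' + b' * c') = 1" using normalize_det[OF assms(2)] by metis
  have kl: "(k * frob m l)\<^sup>2 * (?a * ?d + ?b * ?c) = 1"
  proof -
    have "(k * frob m l)\<^sup>2 * (?a * ?d + ?b * ?c) =
        (k\<^sup>2 * (a * d + b * c)) * frob m (l\<^sup>2 * (a' * d' + b' * c'))"
      unfolding det by (simp add: frob_mult frob_power power_mult_distrib)
    then show ?thesis using k l by simp
  qed
  have l': "l * a' * (l * d') + l * b' * (l * c') = 1"
    using pfm_normalize(1)[OF l] by (simp add: sl2_def)
  show "pfm a b c d m (pfm a' b' c' d' n Q) = pfm ?a ?b ?c ?d (m + n) Q"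
    unfolding pfm_normalize(2)[OF k] pfm_normalize(2)[OF l] pfm_normalize(2)[OF kl] fm_comp[OF l']
    by (simp add: frob_mult algebra_simps)
qed

locale gf32_model = field +
  fixes \<phi> :: "gf32 \<Rightarrow> 'a"
  assumes bij: "bij_betw \<phi> UNIV (carrier R)"
    and \<phi>_add: "\<phi> (x + y) = \<phi> x \<oplus> \<phi> y" and \<phi>_mult: "\<phi> (x * y) = \<phi> x \<otimes> \<phi> y" and \<phi>_1: "\<phi> 1 = \<one>"
begin

definition \<psi> where "\<psi> = inv_into UNIV \<phi>"

lemma \<phi>_closed [simp]: "\<phi> x \<in> carrier R"
  using bij by (auto simp: bij_betw_def)

lemma \<psi>_\<phi> [simp]: "\<psi> (\<phi> x) = x"
  using bij by (simp add: \<psi>_def bij_betw_def)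

lemma \<phi>_\<psi>: "x \<in> carrier R \<Longrightarrow> \<phi> (\<psi> x) = x"
  using bij by (simp add: \<psi>_def bij_betw_def f_inv_into_f)

lemma \<phi>_inject: "\<phi> x = \<phi> y \<longleftrightarrow> x = y"
  by (metis \<psi>_\<phi>)

lemma \<phi>_0: "\<phi> 0 = \<zero>"
proof -
  have "\<phi> 0 \<oplus> \<phi> 0 = \<phi> 0" by (simp flip: \<phi>_add)
  then show ?thesis by (metis \<phi>_closed add.r_cancel_one)
qed

definition to_R :: "vec \<Rightarrow> 'a \<times> 'a" where "to_R v = (\<phi> (fst v), \<phi> (snd v))"
definition of_R :: "'a \<times> 'a \<Rightarrow> vec" where "of_R u = (\<psi> (fst u), \<psi> (snd u))"

lemma to_R_closed [simp]: "to_R v \<in> vec2 R"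
  by (simp add: to_R_def vec2_def)

lemma of_R_to_R [simp]: "of_R (to_R v) = v"
  by (simp add: to_R_def of_R_def)

lemma to_R_of_R: "u \<in> vec2 R \<Longrightarrow> to_R (of_R u) = u"
  by (auto simp: to_R_def of_R_def vec2_def \<phi>_\<psi>)

lemma to_R_vpl: "to_R (vpl u v) = vadd R (to_R u) (to_R v)"
  by (simp add: to_R_def vpl_def vadd_def \<phi>_add)

lemma to_R_scl: "to_R (scl k v) = vsmult R (\<phi> k) (to_R v)"
  by (simp add: to_R_def scl_def vsmult_def \<phi>_mult)

definition hat :: "('a \<times> 'a \<Rightarrow> 'a \<times> 'a) \<Rightarrow> vec \<Rightarrow> vec" where
  "hat f v = of_R (f (to_R v))"

lemma GammaL2_vec2: "f \<in> carrier (GammaL2 R) \<Longrightarrow> u \<in> vec2 R \<Longrightarrow> f u \<in> vec2 R"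
  using Bij_imp_funcset[of f "vec2 R"] by (auto simp: GammaL2_def)

lemma to_R_hat: "f \<in> carrier (GammaL2 R) \<Longrightarrow> to_R (hat f v) = f (to_R v)"
  by (simp add: hat_def to_R_of_R GammaL2_vec2)

lemma hat_comp:
  "f \<in> carrier (GammaL2 R) \<Longrightarrow> g \<in> carrier (GammaL2 R) \<Longrightarrow> hat (f \<otimes>\<^bsub>GammaL2 R\<^esub> g) v = hat f (hat g v)"
  by (simp add: GammaL2_mult hat_def compose_eq to_R_of_R GammaL2_vec2)

text \<open>In the model the companion automorphism is a power of the Frobenius map, and the columns
  of the matrix are the images of the basis vectors. Injectivity makes them independent.\<close>

lemma hat_vm:
  assumes f: "f \<in> carrier (GammaL2 R)"
  obtains a b c d n where "a * d + b * c \<noteq> 0" "hat f = vm a b c d n"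
proof -
  have fB: "f \<in> Bij (vec2 R)" "semilinear2 R f" using f by (auto simp: GammaL2_def)
  obtain s where s: "s \<in> ring_iso R R"
    "\<And>u w. u \<in> vec2 R \<Longrightarrow> w \<in> vec2 R \<Longrightarrow> f (vadd R u w) = vadd R (f u) (f w)"
    "\<And>a u. a \<in> carrier R \<Longrightarrow> u \<in> vec2 R \<Longrightarrow> f (vsmult R a u) = vsmult R (s a) (f u)"
    using fB(2) unfolding semilinear2_def by blast
  have s_hom: "s \<in> ring_hom R R" and s_closed: "\<And>x. x \<in> carrier R \<Longrightarrow> s x \<in> carrier R"
    using s(1) by (auto simp: ring_iso_def bij_betw_def)
  define t where "t x = \<psi> (s (\<phi> x))" for x
  have t: "\<phi> (t x) = s (\<phi> x)" for x by (simp add: t_def \<phi>_\<psi> s_closed)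
  have "t (x + y) = t x + t y" for x y
    by (subst \<phi>_inject[symmetric]) (simp add: t \<phi>_add ring_hom_add[OF s_hom])
  moreover have "t (x * y) = t x * t y" for x y
    by (subst \<phi>_inject[symmetric]) (simp add: t \<phi>_mult ring_hom_mult[OF s_hom])
  moreover have "t 1 = 1"
    by (subst \<phi>_inject[symmetric]) (simp add: t \<phi>_1 ring_hom_one[OF s_hom])
  ultimately obtain n where n: "t = frob n" by (rule gf32_aut_eq_frob)
  have to_R_inject: "to_R u = to_R v \<longleftrightarrow> u = v" for u v by (metis of_R_to_R)
  have add: "hat f (vpl u v) = vpl (hat f u) (hat f v)" for u v
    by (subst to_R_inject[symmetric]) (simp add: to_R_hat f to_R_vpl s)
  have scale: "hat f (scl k v) = scl (frob n k) (hat f v)" for k v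
    by (subst to_R_inject[symmetric]) (simp add: to_R_hat f to_R_scl s t flip: n)
  obtain a c where ac: "hat f (1, 0) = (a, c)" by (cases "hat f (1, 0)")
  obtain b d where bd: "hat f (0, 1) = (b, d)" by (cases "hat f (0, 1)")
  have hat: "hat f = vm a b c d n"
  proof
    fix v
    have "v = vpl (scl (fst v) (1, 0)) (scl (snd v) (0, 1))" by (simp add: vpl_def scl_def)
    then have "hat f v = vpl (scl (frob n (fst v)) (a, c)) (scl (frob n (snd v)) (b, d))"
      by (metis add scale ac bd)
    then show "hat f v = vm a b c d n v" by (simp add: vm_def vpl_def scl_def mult.commute)
  qed
  have inj: "hat f u = hat f v \<Longrightarrow> u = v" for u v
  proof -
    assume "hat f u = hat f v"
    then have "f (to_R u) = f (to_R v)" by (simp flip: to_R_hat[OF f])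
    moreover have "inj_on f (vec2 R)" using fB(1) by (simp add: Bij_def bij_betw_def)
    ultimately have "to_R u = to_R v" by (meson inj_on_eq_iff to_R_closed)
    then show "u = v" by (simp add: to_R_inject)
  qed
  have "hat f (0, 0) = (0, 0)" by (simp add: hat vm_def)
  then have ac0: "(a, c) \<noteq> (0, 0)" using inj[of "(1, 0)" "(0, 0)"] ac by auto
  have "a * d + b * c \<noteq> 0"
  proof
    assume "a * d + b * c = 0"
    then have "sp (b, d) (a, c) = 0" by (simp add: sp_def algebra_simps)
    then obtain k where k: "(b, d) = scl k (a, c)" using ac0 by (rule sp_eq_0)
    obtain k' where k': "k = frob n k'" by (rule frob_surj)
    have "hat f (0, 1) = hat f (scl k' (1, 0))" using scale[of k' "(1, 0)"] k k' ac bd by simp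
    then show False using inj by (fastforce simp: scl_def)
  qed
  with hat that show thesis by metis
qed

text \<open>Well defined because an invertible \<open>vm\<close> determines its matrix and the
  Frobenius power, though not the exponent, and \<open>pfm\<close> depends on nothing else.\<close>

definition proj :: "('a \<times> 'a \<Rightarrow> 'a \<times> 'a) \<Rightarrow> form \<Rightarrow> form" where
  "proj f = (THE h. \<exists>a b c d n. a * d + b * c \<noteq> 0 \<and> hat f = vm a b c d n \<and> h = restrict (pfm a b c d n) pts)"

lemma proj_eq:
  assumes "a * d + b * c \<noteq> 0" "hat f = vm a b c d n"
  shows "proj f = restrict (pfm a b c d n) pts"
  unfolding proj_def
proof (rule the_equality)
  show "\<exists>a' b' c' d' n'. a' * d' + b' * c' \<noteq> 0 \<and> hat f = vm a' b' c' d' n' \<and>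
      restrict (pfm a b c d n) pts = restrict (pfm a' b' c' d' n') pts"
    using assms by blast
next
  fix h assume "\<exists>a b c d n. a * d + b * c \<noteq> 0 \<and> hat f = vm a b c d n \<and> h = restrict (pfm a b c d n) pts"
  then obtain a' b' c' d' n' where h: "hat f = vm a' b' c' d' n'" "h = restrict (pfm a' b' c' d' n') pts"
    by blast
  have "vm a b c d n = vm a' b' c' d' n'" using h assms by simp
  note e = vm_inject[OF assms(1) this]
  have "pfm a' b' c' d' n' = pfm a b c d n" by (rule ext) (simp add: pfm_def fm_def e)
  then show "h = restrict (pfm a b c d n) pts" by (simp only: h(2))
qed

lemma proj_in_A0: "f \<in> carrier (GammaL2 R) \<Longrightarrow> proj f \<in> carrier A\<^sub>0"
proof -
  assume "f \<in> carrier (GammaL2 R)"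
  then obtain a b c d n where A: "a * d + b * c \<noteq> 0" "hat f = vm a b c d n" by (rule hat_vm)
  obtain k where k: "k\<^sup>2 * (a * d + b * c) = 1" using normalize_det[OF A(1)] by metis
  show ?thesis
    using fm_in_A0[OF pfm_normalize(1)[OF k]] pfm_normalize(2)[OF k] by (simp add: proj_eq[OF A] cong: restrict_cong)
qed

lemma proj_hom: "group_hom (GammaL2 R) A\<^sub>0 proj"
proof (intro group_hom.intro group_hom_axioms.intro homI group_GammaL2 group_A0)
  show "proj f \<in> carrier A\<^sub>0" if "f \<in> carrier (GammaL2 R)" for f using that by (rule proj_in_A0)
next
  fix f g assume fg: "f \<in> carrier (GammaL2 R)" "g \<in> carrier (GammaL2 R)"
  obtain a b c d m where A: "a * d + b * c \<noteq> 0" "hat f = vm a b c d m" using fg(1) by (rule hat_vm)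
  obtain a' b' c' d' n where A': "a' * d' + b' * c' \<noteq> 0" "hat g = vm a' b' c' d' n" using fg(2) by (rule hat_vm)
  have "hat (f \<otimes>\<^bsub>GammaL2 R\<^esub> g) = vm (a * frob m a' + b * frob m c') (a * frob m b' + b * frob m d')
     (c * frob m a' + d * frob m c') (c * frob m b' + d * frob m d') (m + n)"
    using fg A(2) A'(2) by (intro ext) (simp add: hat_comp vm_comp)
  note e = proj_eq[OF pfm_comp(2)[OF A(1) A'(1), of m] this]
  show "proj (f \<otimes>\<^bsub>GammaL2 R\<^esub> g) = proj f \<otimes>\<^bsub>A\<^sub>0\<^esub> proj g"
    unfolding mult_A0[OF proj_in_A0[OF fg(1)] proj_in_A0[OF fg(2)]]
  proof
    fix Q show "proj (f \<otimes>\<^bsub>GammaL2 R\<^esub> g) Q = compose pts (proj f) (proj g) Q"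
    proof (cases "Q \<in> pts")
      case True
      then have "proj g Q \<in> pts" using A0_pts[OF proj_in_A0[OF fg(2)]] by blast
      then show ?thesis using True
        by (simp add: compose_eq e proj_eq[OF A] proj_eq[OF A'] pfm_comp(1)[OF A(1) A'(1)])
    qed (simp add: e compose_def)
  qed
qed

lemma proj_surj: "proj ` carrier (GammaL2 R) = carrier A\<^sub>0"
proof
  show "proj ` carrier (GammaL2 R) \<subseteq> carrier A\<^sub>0" using proj_in_A0 by blast
  show "carrier A\<^sub>0 \<subseteq> proj ` carrier (GammaL2 R)"
  proof
    fix h assume "h \<in> carrier A\<^sub>0"
    then obtain a b c d n where h: "sl2 a b c d" "h = restrict (fm a b c d n) pts" by (rule A0E)
    interpret A: sl2 a b c d by (fact h(1))
    define f where "f = (\<lambda>u\<in>vec2 R. to_R (vm a b c d n (of_R u)))"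
    have f: "f (to_R v) = to_R (vm a b c d n v)" for v by (simp add: f_def)
    have inj_vm: "inj (vm a b c d n)"
    proof (rule injI)
      fix u v assume e: "vm a b c d n u = vm a b c d n v"
      have "vm a b c d n (vpl u v) = (0, 0)" unfolding vm_vpl e by (simp add: vpl_def)
      then have "vpl u v = (0, 0)" by (simp add: A.vm_eq_0)
      then show "u = v" by (auto simp: vpl_def gf_add_eq_0_iff prod_eq_iff)
    qed
    have "bij (vm a b c d n)" using finite_UNIV_inj_surj[OF _ inj_vm] inj_vm by (simp add: bij_def)
    moreover have "bij_betw to_R UNIV (vec2 R)"
      by (rule bij_betw_byWitness[where f' = of_R]) (auto simp: to_R_of_R)
    moreover have "bij_betw of_R (vec2 R) UNIV"
      by (rule bij_betw_byWitness[where f' = to_R]) (auto simp: to_R_of_R)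
    ultimately have "bij_betw (to_R \<circ> (vm a b c d n \<circ> of_R)) (vec2 R) (vec2 R)"
      by (blast intro: bij_betw_trans)
    then have bij_f: "f \<in> Bij (vec2 R)" 
      by (simp add: Bij_def f_def o_def cong: bij_betw_cong)
    define s where "s x = \<phi> (frob n (\<psi> x))" for x
    have s\<phi>: "s (\<phi> x) = \<phi> (frob n x)" for x by (simp add: s_def)
    have ex: "\<exists>y. x = \<phi> y" if "x \<in> carrier R" for x using \<phi>_\<psi>[OF that] by metis
    have s: "s \<in> ring_iso R R"
      unfolding ring_iso_def
    proof (intro CollectI conjI ring_hom_memI)
      show "s x \<in> carrier R" for x by (simp add: s_def)
      show "s (x \<otimes> y) = s x \<otimes> s y" if xy: "x \<in> carrier R" "y \<in> carrier R" for x y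
      proof -
        obtain x' y' where "x = \<phi> x'" "y = \<phi> y'" using xy ex by metis
        then show ?thesis by (simp add: s\<phi> frob_mult flip: \<phi>_mult)
      qed
      show "s (x \<oplus> y) = s x \<oplus> s y" if xy: "x \<in> carrier R" "y \<in> carrier R" for x y
      proof -
        obtain x' y' where "x = \<phi> x'" "y = \<phi> y'" using xy ex by metis
        then show ?thesis by (simp add: s\<phi> frob_add flip: \<phi>_add)
      qed
      show "s \<one> = \<one>" using s\<phi>[of 1] by (simp add: \<phi>_1)
      show "bij_betw s (carrier R) (carrier R)"
        unfolding bij_betw_def
      proof
        show "inj_on s (carrier R)"
        proof (rule inj_onI)
          fix x y assume xy: "x \<in> carrier R" "y \<in> carrier R" "s x = s y"
          obtain x' y' where "x = \<phi> x'" "y = \<phi> y'" using xy ex by metis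
          then show "x = y" using xy(3) by (simp add: s\<phi> \<phi>_inject)
        qed
        show "s ` carrier R = carrier R"
        proof
          show "carrier R \<subseteq> s ` carrier R"
          proof
            fix x assume "x \<in> carrier R"
            then obtain x' where x': "x = \<phi> x'" using ex by metis
            obtain y where "x' = frob n y" by (rule frob_surj)
            then have "x = s (\<phi> y)" by (simp add: x' s\<phi>)
            then show "x \<in> s ` carrier R" by simp
          qed
        qed (auto simp: s_def)
      qed
    qed
    have exv: "\<exists>v. u = to_R v" if "u \<in> vec2 R" for u using to_R_of_R[OF that] by metis
    have "semilinear2 R f"
      unfolding semilinear2_def
    proof (intro bexI[OF _ s] conjI ballI)
      fix u w assume "u \<in> vec2 R" "w \<in> vec2 R"
      then obtain u' w' where "u = to_R u'" "w = to_R w'" using exv by metis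
      then show "f (vadd R u w) = vadd R (f u) (f w)" by (simp add: f vm_vpl flip: to_R_vpl)
    next
      fix x u assume "x \<in> carrier R" "u \<in> vec2 R"
      then obtain x' u' where "x = \<phi> x'" "u = to_R u'" using exv ex by metis
      then show "f (vsmult R x u) = vsmult R (s x) (f u)" by (simp add: f vm_scl s\<phi> flip: to_R_scl)
    qed
    then have fG: "f \<in> carrier (GammaL2 R)" using bij_f by (simp add: GammaL2_def)
    have "hat f = vm a b c d n" by (rule ext) (simp add: hat_def f)
    then have "proj f = restrict (pfm a b c d n) pts" using A.det by (intro proj_eq) auto
    also have "pfm a b c d n = fm a b c d n" by (rule ext) (simp add: pfm_def A.det)
    finally have "h = proj f" using h(2) by (simp only: restrict_def)
    then show "h \<in> proj ` carrier (GammaL2 R)" using fG by simp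
  qed
qed

lemma kernel_proj: "kernel (GammaL2 R) A\<^sub>0 proj = scalars2 R"
proof
  show "kernel (GammaL2 R) A\<^sub>0 proj \<subseteq> scalars2 R"
  proof
    fix f assume "f \<in> kernel (GammaL2 R) A\<^sub>0 proj"
    then have f: "f \<in> carrier (GammaL2 R)" "proj f = (\<lambda>x\<in>pts. x)" by (auto simp: kernel_def one_A0)
    obtain a b c d n where A: "a * d + b * c \<noteq> 0" "hat f = vm a b c d n" using f(1) by (rule hat_vm)
    obtain k where k: "k \<noteq> 0" "k\<^sup>2 * (a * d + b * c) = 1" using normalize_det[OF A(1)] .
    have "fm (k * a) (k * b) (k * c) (k * d) n Q = Q" if "Q \<in> pts" for Q
    proof -
      have "pfm a b c d n Q = Q" using fun_cong[OF f(2)[unfolded proj_eq[OF A]], of Q] that by simp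
      then show ?thesis by (simp add: pfm_normalize(2)[OF k(2)])
    qed
    then have "vm (k * a) (k * b) (k * c) (k * d) n v = v" for v
      using fm_trivial pfm_normalize(1)[OF k(2)] by blast
    moreover have "vm (k * a) (k * b) (k * c) (k * d) n v = scl k (vm a b c d n v)" for v
      by (simp add: vm_def scl_def algebra_simps)
    ultimately have "scl k (hat f v) = v" for v using A by simp
    then have hat: "hat f v = scl (inverse k) v" for v
      using k(1) by (metis scl_scl scl_1 left_inverse)
    have "f = (\<lambda>u\<in>vec2 R. vsmult R (\<phi> (inverse k)) u)"
    proof (rule extensionalityI[of _ "vec2 R"])
      show "f \<in> extensional (vec2 R)" using f(1) by (simp add: GammaL2_def Bij_def)
      show "f u = (\<lambda>u\<in>vec2 R. vsmult R (\<phi> (inverse k)) u) u" if "u \<in> vec2 R" for u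
        using to_R_hat[OF f(1), of "of_R u"] that by (simp add: hat to_R_scl to_R_of_R)
    qed simp
    moreover have "\<phi> (inverse k) \<in> carrier R - {\<zero>}" using k \<phi>_inject[of "inverse k" 0] by (simp add: \<phi>_0)
    ultimately show "f \<in> scalars2 R" unfolding scalars2_def by blast
  qed
  show "scalars2 R \<subseteq> kernel (GammaL2 R) A\<^sub>0 proj"
  proof
    fix f assume f: "f \<in> scalars2 R"
    then obtain x where x: "x \<in> carrier R - {\<zero>}" "f = (\<lambda>u\<in>vec2 R. vsmult R x u)"
      by (auto simp: scalars2_def)
    define k where "k = \<psi> x"
    have k: "x = \<phi> k" "k \<noteq> 0" using x \<phi>_\<psi>[of x] \<phi>_0 by (auto simp: k_def)
    have "hat f = vm k 0 0 k 0"
      by (rule ext) (simp add: hat_def x(2) k(1) vm_def scl_def flip: to_R_scl)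
    then have "proj f = restrict (pfm k 0 0 k 0) pts" using k by (intro proj_eq) auto
    also have "\<dots> = (\<lambda>x\<in>pts. x)"
      using k by (intro restrict_ext) (simp add: pfm_def fm_def scl_def power2_eq_square field_simps)
    finally show "f \<in> kernel (GammaL2 R) A\<^sub>0 proj"
      using f scalars2_subset by (auto simp: kernel_def one_A0)
  qed
qed

theorem PGammaL2_iso_A0: "PGammaL2 R \<cong> A\<^sub>0"
  unfolding PGammaL2_def kernel_proj[symmetric]
  by (rule group_hom.FactGroup_iso[OF proj_hom proj_surj])

end

section \<open>Every field of order 32 is isomorphic to the model\<close>

text \<open>Polynomials over the prime field as coefficient lists, constant term first. Trailing
  \<open>False\<close> entries are permitted, so equality is expressed by
  \<open>list_all Not\<close> of the sum.\<close>

fun padd :: "bool list \<Rightarrow> bool list \<Rightarrow> bool list" where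
  "padd [] q = q"
| "padd (a # p) [] = a # p"
| "padd (a # p) (b # q) = (a \<noteq> b) # padd p q"

fun pmul :: "bool list \<Rightarrow> bool list \<Rightarrow> bool list" where
  "pmul [] q = []"
| "pmul (a # p) q = padd (if a then q else []) (False # pmul p q)"

definition pmon :: "nat \<Rightarrow> bool list" where
  "pmon n = replicate n False @ [True]"

text \<open>The irreducible factors of degree five of \<open>X\<^sup>3\<^sup>1 - 1\<close> over the prime field, each with an exponent \<open>k\<close>
  such that the \<open>k\<close>-th power of a root is a root of \<open>X\<^sup>5 + X\<^sup>2 + 1\<close>, the residues of \<open>2 k\<close> and \<open>5 k\<close>
  modulo 31, and the cofactor of the factor in \<open>X\<^bsup>5 k\<^esup> + X\<^bsup>2 k\<^esup> + 1\<close> with exponents so reduced.\<close>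

definition quintics :: "(bool list \<times> nat \<times> nat \<times> nat \<times> bool list) list" where
  "quintics = [([True, False, True, False, False, True], 1, 2, 5, [True]),
    ([True, False, False, True, False, True], 15, 30, 13, [True, False, False, True, False, True, True, False, False, True, True, True, True, False, False, False, True, True, False, True, True, True, False, True, False, True]),
    ([True, True, True, True, False, True], 5, 10, 25, [True, True, False, False, True, False, False, True, True, True, False, False, False, True, False, True, False, True, True, False, True]),
    ([True, True, True, False, True, True], 7, 14, 4, [True, True, False, True, True, False, False, True, True, True]),
    ([True, True, False, True, True, True], 3, 6, 15, [True, True, True, False, False, True, False, True, False, True, True]),
    ([True, False, True, True, True, True], 11, 22, 24, [True, False, True, True, False, True, False, True, False, False, False, True, True, True, False, True, True, True, True, True])]"

text \<open>The first part is the complete factorisation of X^31 + 1, in which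
  \<open>[True, True]\<close> is the linear factor X + 1.\<close>

lemma quintics_check:
  "list_all Not (padd (foldr pmul (map fst quintics) [True, True]) (padd (pmon 0) (pmon 31)))"
  "list_all (\<lambda>(p, k, i, j, q). list_all Not (padd (pmul p q) (padd (pmon 0) (padd (pmon i) (pmon j)))) \<and>
     2 * k mod 31 = i \<and> 5 * k mod 31 = j) quintics"
  by code_simp+

context field
begin

definition bit :: "bool \<Rightarrow> 'a" where "bit b = (if b then \<one> else \<zero>)"

primrec lev :: "'a \<Rightarrow> bool list \<Rightarrow> 'a" where
  "lev t [] = \<zero>"
| "lev t (b # p) = bit b \<oplus> t \<otimes> lev t p"

lemma bit_closed [simp]: "bit b \<in> carrier R"
  by (simp add: bit_def)

lemma lev_closed [simp]: "t \<in> carrier R \<Longrightarrow> lev t p \<in> carrier R"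
  by (induction p) auto

lemma lev_all_False: "t \<in> carrier R \<Longrightarrow> list_all Not p \<Longrightarrow> lev t p = \<zero>"
  by (induction p) (auto simp: bit_def)

lemma lev_pmon: "t \<in> carrier R \<Longrightarrow> lev t (pmon n) = t [^] n"
proof (induction n)
  case (Suc n)
  have "pmon (Suc n) = False # pmon n" by (simp add: pmon_def)
  then show ?case using Suc by (simp add: bit_def m_comm)
qed (simp add: pmon_def bit_def)

text \<open>The additive order of 1 divides 32, so the fifth power of 1 + 1 is zero.\<close>

lemma char_2_of_order_32:
  assumes "order R = 32" shows "\<one> \<oplus> \<one> = \<zero>"
proof -
  define t where "t = \<one> \<oplus> \<one>"
  have t: "t \<in> carrier R" by (simp add: t_def)
  have double: "[(2 * n :: nat)] \<cdot> \<one> = t \<otimes> ([n] \<cdot> \<one>)" for n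
  proof -
    have "[(2 * n :: nat)] \<cdot> \<one> = [n] \<cdot> \<one> \<oplus> [n] \<cdot> \<one>"
      by (simp add: mult_2 add.nat_pow_mult)
    then show ?thesis by (simp add: t_def l_distr)
  qed
  have "[(32 :: nat)] \<cdot> \<one> = \<zero>"
    using group.pow_order_eq_1[OF a_group, of \<one>] assms
    by (simp add: order_def add_pow_def)
  moreover have "[(32 :: nat)] \<cdot> \<one> = t \<otimes> (t \<otimes> (t \<otimes> (t \<otimes> (t \<otimes> \<one>))))"
    using double[of 16] double[of 8] double[of 4] double[of 2] double[of 1] by simp
  ultimately show ?thesis using t by (simp add: integral_iff flip: t_def)
qed

context
  assumes char_2: "\<one> \<oplus> \<one> = \<zero>"
begin

lemma add_self: "x \<in> carrier R \<Longrightarrow> x \<oplus> x = \<zero>"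
proof -
  assume x: "x \<in> carrier R"
  then have "x \<oplus> x = (\<one> \<oplus> \<one>) \<otimes> x" by (simp add: l_distr)
  then show ?thesis using x by (simp add: char_2)
qed

lemma bit_xor: "bit (a = (\<not> b)) = bit a \<oplus> bit b"
  by (auto simp: bit_def char_2)

lemma lev_padd: "t \<in> carrier R \<Longrightarrow> lev t (padd p q) = lev t p \<oplus> lev t q"
  by (induction p q rule: padd.induct) (auto simp: bit_xor r_distr a_ac)

lemma lev_pmul: "t \<in> carrier R \<Longrightarrow> lev t (pmul p q) = lev t p \<otimes> lev t q"
  by (induction p) (auto simp: lev_padd l_distr m_assoc bit_def)

lemma lev_foldr_pmul:
  "t \<in> carrier R \<Longrightarrow> lev t (foldr pmul ps q) = \<zero> \<Longrightarrow> lev t q \<noteq> \<zero> \<Longrightarrow> \<exists>p\<in>set ps. lev t p = \<zero>"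
  by (induction ps) (auto simp: lev_pmul integral_iff)

lemma lev_cancel:
  assumes "t \<in> carrier R" "list_all Not (padd p q)" shows "lev t p = lev t q"
proof -
  have "lev t p \<oplus> lev t q = \<zero>" using assms lev_all_False by (simp flip: lev_padd)
  then have "lev t p \<oplus> lev t q = lev t q \<oplus> lev t q" using assms by (simp add: add_self)
  then show ?thesis using assms by simp
qed

text \<open>Any element other than 0 and 1 satisfies t^31 = 1 and hence annihilates one of the six
  quintics; its listed power is the root sought.\<close>

lemma root_exists:
  assumes "order R = 32"
  obtains u where "u \<in> carrier R" "lev u (padd (pmon 0) (padd (pmon 2) (pmon 5))) = \<zero>"
proof -
  have fin: "finite (carrier R)" using assms by (simp add: order_def card_ge_0_finite)
  have "card {\<zero>, \<one>} < card (carrier R)" using assms by (simp add: order_def card_insert_if)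
  then have "\<not> carrier R \<subseteq> {\<zero>, \<one>}" using card_mono[of "{\<zero>, \<one>}" "carrier R"] by auto
  then obtain t where t: "t \<in> carrier R" "t \<noteq> \<zero>" "t \<noteq> \<one>" by blast
  interpret M: group "Multiplicative_Group.mult_of R" by (rule field_mult_group)
  have "order (Multiplicative_Group.mult_of R) = 31" using assms fin by (simp add: order_def)
  then have t31: "t [^] (31 :: nat) = \<one>"
    using M.pow_order_eq_1[of t] t by (simp add: Multiplicative_Group.nat_pow_mult_of)
  have "lev t (padd (pmon 0) (pmon 31)) = \<zero>"
    using t t31 by (simp add: lev_padd lev_pmon char_2)
  then have "lev t (foldr pmul (map fst quintics) [True, True]) = \<zero>"
    using lev_cancel[OF t(1) quintics_check(1)] by simp
  moreover have "lev t [True, True] \<noteq> \<zero>"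
  proof
    assume "lev t [True, True] = \<zero>"
    then have "\<one> \<oplus> t = \<one> \<oplus> \<one>" using t by (simp add: bit_def char_2)
    then show False using t by simp
  qed
  ultimately obtain p k i j q where q: "(p, k, i, j, q) \<in> set quintics" "lev t p = \<zero>"
    using lev_foldr_pmul[OF t(1)] by force
  have chk: "list_all Not (padd (pmul p q) (padd (pmon 0) (padd (pmon i) (pmon j))))"
    "2 * k mod 31 = i" "5 * k mod 31 = j"
    using quintics_check(2) q(1) by (auto simp: list_all_iff)
  have red: "t [^] (n mod 31) = t [^] n" for n :: nat
  proof -
    have "t [^] n = t [^] (n mod 31 + 31 * (n div 31))" by simp
    also have "\<dots> = t [^] (n mod 31) \<otimes> (t [^] (31 :: nat)) [^] (n div 31)"
      using t by (simp only: nat_pow_mult[symmetric] nat_pow_pow)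
    finally show ?thesis using t by (simp add: t31)
  qed
  have "lev t (padd (pmon 0) (padd (pmon i) (pmon j))) = \<zero>"
    using lev_cancel[OF t(1) chk(1)] q(2) t by (simp add: lev_pmul)
  then have "\<one> \<oplus> (t [^] (2 * k) \<oplus> t [^] (5 * k)) = \<zero>"
    using t by (simp add: lev_padd lev_pmon red flip: chk(2,3))
  moreover have "t [^] (2 * k) = (t [^] k) [^] (2 :: nat)" "t [^] (5 * k) = (t [^] k) [^] (5 :: nat)"
    using t by (simp_all add: nat_pow_pow mult.commute)
  ultimately have "lev (t [^] k) (padd (pmon 0) (padd (pmon 2) (pmon 5))) = \<zero>"
    using t by (simp add: lev_padd lev_pmon)
  with t show thesis by (intro that[of "t [^] k"]) auto
qed

primrec eval_at :: "'a \<Rightarrow> gf32 \<Rightarrow> 'a" where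
  "eval_at u (GF a b c d e) = lev u [a, b, c, d, e]"

text \<open>Evaluation at the root is an injective ring homomorphism, and both sides have 32
  elements. Multiplicativity follows the Horner scheme of the model, so the defining polynomial
  enters only through \<open>xtimes\<close>.\<close>

lemma gf32_model_exists:
  assumes "order R = 32" shows "\<exists>\<phi>. gf32_model R \<phi>"
proof -
  obtain u where u: "u \<in> carrier R" "lev u (padd (pmon 0) (padd (pmon 2) (pmon 5))) = \<zero>"
    using root_exists[OF assms] .
  let ?\<phi> = "eval_at u"
  have closed: "?\<phi> x \<in> carrier R" for x using u by (cases x) (simp del: lev.simps)
  have add: "?\<phi> (x + y) = ?\<phi> x \<oplus> ?\<phi> y" for x y
    using u by (cases x; cases y) (simp add: lev_padd[symmetric] del: lev.simps)
  have zero: "?\<phi> 0 = \<zero>" using u by (simp add: zero_gf32_def bit_def)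
  have one: "?\<phi> 1 = \<one>" using u by (simp add: one_gf32_def bit_def)
  have xtimes: "?\<phi> (xtimes x) = u \<otimes> ?\<phi> x" for x
  proof (cases x)
    case (GF a b c d e)
    let ?r = "padd (pmon 0) (padd (pmon 2) (pmon 5))"
    have "list_all Not (padd [e, a, b \<noteq> e, c, d] (padd (False # [a, b, c, d, e]) (if e then ?r else [])))"
      by (cases e) (simp_all add: pmon_def numeral_eq_Suc)
    then have "lev u [e, a, b \<noteq> e, c, d] = lev u (padd (False # [a, b, c, d, e]) (if e then ?r else []))"
      using u(1) by (intro lev_cancel)
    also have "\<dots> = lev u (False # [a, b, c, d, e])" using u by (simp add: lev_padd del: lev.simps(2))
    finally show ?thesis using u by (simp add: GF bit_def)
  qed
  have bscale: "?\<phi> (bscale b x) = bit b \<otimes> ?\<phi> x" for b x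
    using closed by (simp add: bscale_def bit_def zero)
  have mult: "?\<phi> (x * y) = ?\<phi> x \<otimes> ?\<phi> y" for x y
  proof (cases y)
    case (GF a b c d e)
    have step: "?\<phi> x \<otimes> lev u (b # p) = bit b \<otimes> ?\<phi> x \<oplus> u \<otimes> (?\<phi> x \<otimes> lev u p)" for b p
      using u closed by (simp add: r_distr m_ac)
    have "?\<phi> x \<otimes> ?\<phi> y = bit a \<otimes> ?\<phi> x \<oplus> u \<otimes> (bit b \<otimes> ?\<phi> x \<oplus> u \<otimes> (bit c \<otimes> ?\<phi> x \<oplus>
        u \<otimes> (bit d \<otimes> ?\<phi> x \<oplus> u \<otimes> (bit e \<otimes> ?\<phi> x))))"
      using u closed[of x] by (simp only: GF eval_at.simps step) (simp add: r_distr)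
    then show ?thesis by (simp only: GF times_gf32.simps add xtimes bscale)
  qed
  have inj: "inj ?\<phi>"
  proof (rule injI)
    fix x y assume "?\<phi> x = ?\<phi> y"
    then have z: "?\<phi> (x + y) = \<zero>" using closed by (simp add: add add_self)
    have "x + y = 0"
    proof (rule ccontr)
      assume "x + y \<noteq> 0"
      then have "?\<phi> ((x + y) * inverse (x + y)) = \<one>" by (simp add: one)
      then show False using z closed by (simp add: mult)
    qed
    then show "x = y" by (simp add: gf_add_eq_0_iff)
  qed
  have "?\<phi> ` UNIV = carrier R"
  proof (rule card_subset_eq)
    show "finite (carrier R)" using assms by (simp add: order_def card_ge_0_finite)
    show "?\<phi> ` UNIV \<subseteq> carrier R" using closed by auto
    show "card (?\<phi> ` UNIV) = card (carrier R)"
      using assms by (simp add: card_image[OF inj] card_gf order_def)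
  qed
  then have "gf32_model R ?\<phi>"
    by unfold_locales (simp_all add: bij_betw_def inj add mult one)
  then show ?thesis by blast
qed

end

end

section \<open>Counting with group actions\<close>

locale set_action = group G for G (structure) +
  fixes act :: "'a \<Rightarrow> 'x \<Rightarrow> 'x" and S :: "'x set"
  assumes act_closed: "g \<in> carrier G \<Longrightarrow> x \<in> S \<Longrightarrow> act g x \<in> S"
    and act_one: "x \<in> S \<Longrightarrow> act \<one> x = x"
    and act_mult: "g \<in> carrier G \<Longrightarrow> h \<in> carrier G \<Longrightarrow> x \<in> S \<Longrightarrow> act (g \<otimes> h) x = act g (act h x)"
begin

definition stab :: "'a set \<Rightarrow> 'x \<Rightarrow> 'a set" where "stab H x = {g \<in> H. act g x = x}"

lemma act_inv:
  assumes "g \<in> carrier G" "x \<in> S" shows "act (inv g) (act g x) = x" "act g (act (inv g) x) = x"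
  using assms by (simp_all flip: act_mult add: act_one)

lemma act_inject: "g \<in> carrier G \<Longrightarrow> x \<in> S \<Longrightarrow> y \<in> S \<Longrightarrow> act g x = act g y \<longleftrightarrow> x = y"
  by (metis act_inv(1))

lemma subgroup_stab:
  assumes "subgroup H G" "x \<in> S" shows "subgroup (stab H x) G"
proof -
  interpret H: subgroup H G by fact
  show ?thesis
  proof (rule subgroupI)
    show "stab H x \<noteq> {}" using act_one assms H.one_closed unfolding stab_def by blast
    show "inv g \<in> stab H x" if "g \<in> stab H x" for g
      using that assms act_inv(1)[of g x] by (auto simp: stab_def)
    show "g \<otimes> h \<in> stab H x" if "g \<in> stab H x" "h \<in> stab H x" for g h
      using that assms by (auto simp: stab_def act_mult)
  qed (auto simp: stab_def)
qed

lemma orbit_stab: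
  assumes H: "subgroup H G" and fin: "finite H" and x: "x \<in> S"
  shows "card H = card ((\<lambda>g. act g x) ` H) * card (stab H x)"
proof -
  interpret H: subgroup H G by fact
  have fiber: "card {g \<in> H. act g x = y} = card (stab H x)" if y: "y \<in> (\<lambda>g. act g x) ` H" for y
  proof -
    obtain h where h: "h \<in> H" "y = act h x" using y by auto
    have "bij_betw ((\<otimes>) h) (stab H x) {g \<in> H. act g x = y}"
    proof (rule bij_betw_byWitness[where f' = "(\<otimes>) (inv h)"])
      show "\<forall>g\<in>stab H x. inv h \<otimes> (h \<otimes> g) = g" "\<forall>g\<in>{g \<in> H. act g x = y}. h \<otimes> (inv h \<otimes> g) = g"
        using h by (auto simp: stab_def simp flip: m_assoc)
      show "(\<otimes>) h ` stab H x \<subseteq> {g \<in> H. act g x = y}"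
        using h x by (auto simp: stab_def act_mult)
      show "(\<otimes>) (inv h) ` {g \<in> H. act g x = y} \<subseteq> stab H x"
        using h x by (auto simp: stab_def act_mult act_inv)
    qed
    then show ?thesis by (simp add: bij_betw_same_card)
  qed
  have "card H = (\<Sum>g\<in>H. 1)" by simp
  also have "\<dots> = (\<Sum>y\<in>(\<lambda>g. act g x) ` H. \<Sum>g\<in>{g \<in> H. act g x = y}. 1)"
    by (rule sum.image_gen[OF fin])
  also have "\<dots> = (\<Sum>y\<in>(\<lambda>g. act g x) ` H. card (stab H x))"
    by (rule sum.cong[OF refl]) (simp add: fiber)
  finally show ?thesis by simp
qed

text \<open>The points that move split into orbits of full length, since an orbit length divides the
  prime.\<close>

lemma prime_order_nonfixed:
  assumes K: "subgroup K G" and p: "Factorial_Ring.prime (card K)" and Y: "finite Y" "Y \<subseteq> S"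
    and closed: "\<And>g y. g \<in> K \<Longrightarrow> y \<in> Y \<Longrightarrow> act g y \<in> Y"
  shows "card K dvd card {y \<in> Y. \<exists>g\<in>K. act g y \<noteq> y}" (is "_ dvd card ?N")
proof -
  interpret K: subgroup K G by fact
  have finK: "finite K" using p by (metis card.infinite not_prime_0)
  let ?O = "\<lambda>y. (\<lambda>g. act g y) ` K"
  have self: "y \<in> ?O y" if "y \<in> Y" for y
    using that Y act_one by (intro image_eqI[of _ _ \<one>]) auto
  have orbit_eq: "?O z = ?O y" if yz: "y \<in> Y" "z \<in> ?O y" for y z
  proof -
    obtain h where h: "h \<in> K" "z = act h y" using yz(2) by auto
    have yX: "y \<in> S" using yz Y by auto
    show ?thesis
    proof
      show "?O z \<subseteq> ?O y"
      proof
        fix u assume "u \<in> ?O z"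
        then obtain g where "g \<in> K" "u = act g z" by auto
        then show "u \<in> ?O y" using h yX by (intro image_eqI[of _ _ "g \<otimes> h"]) (auto simp: act_mult)
      qed
      show "?O y \<subseteq> ?O z"
      proof
        fix u assume "u \<in> ?O y"
        then obtain g where "g \<in> K" "u = act g y" by auto
        then show "u \<in> ?O z"
          using h yX by (intro image_eqI[of _ _ "g \<otimes> inv h"]) (auto simp: act_mult act_inv act_closed)
      qed
    qed
  qed
  have card_orbit: "card (?O y) = card K" if y: "y \<in> ?N" for y
  proof -
    have yX: "y \<in> S" "y \<in> Y" using y Y by auto
    have "card (?O y) dvd card K" using orbit_stab[OF K finK yX(1)] by simp
    moreover have "card (?O y) \<noteq> 1"
    proof
      assume "card (?O y) = 1"
      then obtain u where "?O y = {u}" by (rule card_1_singletonE)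
      then have "act g y = y" if "g \<in> K" for g using that self[OF yX(2)] by auto
      then show False using y by auto
    qed
    ultimately show ?thesis using p by (meson prime_nat_iff)
  qed
  have N: "?N = \<Union> (?O ` ?N)"
  proof
    show "?N \<subseteq> \<Union> (?O ` ?N)" using self by blast
    show "\<Union> (?O ` ?N) \<subseteq> ?N"
    proof
      fix z assume "z \<in> \<Union> (?O ` ?N)"
      then obtain y where y: "y \<in> ?N" "z \<in> ?O y" by blast
      then have zY: "z \<in> Y" using closed by auto
      have "?O z = ?O y" using orbit_eq y by blast
      then have "card (?O z) = card K" using card_orbit y by simp
      moreover have "?O z = {z}" if "\<forall>g\<in>K. act g z = z" using that self[OF zY] by auto
      ultimately show "z \<in> ?N" using zY p by (metis (mono_tags, lifting) is_singletonI is_singleton_altdef mem_Collect_eq not_prime_1)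
    qed
  qed
  have "card K * card (?O ` ?N) = card (\<Union> (?O ` ?N))"
  proof (rule card_partition)
    show "finite (?O ` ?N)" using Y by simp
    show "finite (\<Union> (?O ` ?N))" using Y finK by auto
    show "card c = card K" if "c \<in> ?O ` ?N" for c using that card_orbit by auto
    show "c1 \<inter> c2 = {}" if c12: "c1 \<in> ?O ` ?N" "c2 \<in> ?O ` ?N" "c1 \<noteq> c2" for c1 c2
    proof (rule ccontr)
      assume "c1 \<inter> c2 \<noteq> {}"
      then obtain z where z: "z \<in> c1" "z \<in> c2" by blast
      obtain y1 where y1: "y1 \<in> Y" "c1 = ?O y1" using c12(1) by blast
      obtain y2 where y2: "y2 \<in> Y" "c2 = ?O y2" using c12(2) by blast
      have "?O z = c1" unfolding y1(2) using y1 z(1) by (intro orbit_eq) simp_all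
      moreover have "?O z = c2" unfolding y2(2) using y2 z(2) by (intro orbit_eq) simp_all
      ultimately show False using c12(3) by simp
    qed
  qed
  then have "card K * card (?O ` ?N) = card ?N" by (simp only: N[symmetric])
  then have "card ?N = card K * card (?O ` ?N)" by (rule sym)
  then show ?thesis by (rule dvdI)
qed

end

section \<open>Orders of automorphisms\<close>

interpretation A0: group A\<^sub>0 by (rule group_A0)

lemma A0_apply: "f \<in> carrier A\<^sub>0 \<Longrightarrow> g \<in> carrier A\<^sub>0 \<Longrightarrow> Q \<in> pts \<Longrightarrow> (f \<otimes>\<^bsub>A\<^sub>0\<^esub> g) Q = f (g Q)"
  by (simp add: mult_A0 compose_eq)

interpretation pts_act: set_action A\<^sub>0 "\<lambda>f. f" pts
  by unfold_locales (auto simp: A0_pts A0_apply one_A0)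

lemma A0_eqI: "f \<in> carrier A\<^sub>0 \<Longrightarrow> g \<in> carrier A\<^sub>0 \<Longrightarrow> (\<And>Q. Q \<in> pts \<Longrightarrow> f Q = g Q) \<Longrightarrow> f = g"
  by (rule extensionalityI[of _ pts]) (auto simp: in_A0_iff)

lemma frob_root_inject: "m < 5 \<Longrightarrow> n < 5 \<Longrightarrow> frob m gf_root = frob n gf_root \<Longrightarrow> m = n"
proof -
  assume mn: "m < 5" "n < 5" "frob m gf_root = frob n gf_root"
  have "let r = gf_root; a = r * r; b = a * a; c = b * b; d = c * c in distinct [r, a, b, c, d]"
    by code_simp
  then have "distinct (map (\<lambda>n. frob n gf_root) [0, 1, 2, 3, 4])"
    by (simp only: Let_def list.map frob_Suc power2_eq_square frob_zero_nat numeral_eq_Suc One_nat_def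
      pred_numeral_simps BitM.simps power_Suc power_0 mult_1_right)
  then have "inj_on (\<lambda>n. frob n gf_root) (set [0, 1, 2, 3, 4])" by (simp only: distinct_map)
  moreover have "m \<in> set [0, 1, 2, 3, 4]" "n \<in> set [0, 1, 2, 3, 4]" using mn by auto
  ultimately show "m = n" using mn(3) by (meson inj_onD)
qed

text \<open>Two points separate these maps. The first coordinates for (root, 1/root) give the
  exponents; the second coordinates there and at (1, 1) give two equations whose sum has the factor
  \<open>frob m gf_root + 1\<close>, which is nonzero because the root and 1 have different
  traces.\<close>

lemma base_stab_inject:
  assumes "m < 5" "n < 5" "restrict (fm 1 b 0 1 m) pts = restrict (fm 1 b' 0 1 n) pts"
  shows "b = b' \<and> m = n"
proof -
  have e: "fm 1 b 0 1 m Q = fm 1 b' 0 1 n Q" if "Q \<in> pts" for Q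
    using fun_cong[OF assms(3), of Q] that by simp
  have root: "gf_root \<noteq> 0" using gf_root_T0 by (simp add: T0_def)
  then have "(gf_root, inverse gf_root) \<in> pts" by (simp add: pts_def)
  note e1 = e[OF this]
  have "(1, 1) \<in> pts" by (simp add: pts_def)
  note e2 = e[OF this]
  have mn: "m = n" using e1 assms by (intro frob_root_inject) (simp_all add: fm_def)
  have 1: "b\<^sup>2 + b = b'\<^sup>2 + b'" using e2 by (simp add: fm_def)
  have 2: "frob m gf_root * b\<^sup>2 + b = frob m gf_root * b'\<^sup>2 + b'" using e1 mn by (simp add: fm_def)
  have "(frob m gf_root + 1) * (b\<^sup>2 + b'\<^sup>2) = 
      (frob m gf_root * b\<^sup>2 + b) + (frob m gf_root * b'\<^sup>2 + b') + ((b\<^sup>2 + b) + (b'\<^sup>2 + b'))"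
    by (simp add: algebra_simps)
  then have "(frob m gf_root + 1) * (b\<^sup>2 + b'\<^sup>2) = 0" by (simp add: 1 2)
  moreover have "frob m gf_root + 1 \<noteq> 0"
    using gf_root_T0 tr_frob[of m gf_root] by (metis T0_def gf_add_eq_0_iff mem_Collect_eq tr_1)
  ultimately have "b\<^sup>2 + b'\<^sup>2 = 0" by simp
  then show ?thesis using mn by (simp add: gf_add_eq_0_iff)
qed

lemma A0_blk:
  assumes "sl2 a b c d" shows "restrict (fm a b c d n) pts ` blk w = blk (vm a b c d n w)"
proof (cases "w = (0, 0)")
  case True
  then show ?thesis by (simp add: blk_zero vm_def)
next
  case False
  interpret sl2 a b c d by fact
  obtain Q where Q: "Q \<in> blk w" using blk_nonempty[OF False] .
  have "restrict (fm a b c d n) pts ` blk w = fm a b c d n ` blk w"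
    using blk_sub[of w] by (intro image_cong refl) auto
  also have "\<dots> = blk (vm a b c d n w)"
  proof (rule card_subset_eq)
    show "fm a b c d n ` blk w \<subseteq> blk (vm a b c d n w)" using fm_in_blk by blast
    show "card (fm a b c d n ` blk w) = card (blk (vm a b c d n w))"
      using card_blk[OF Q] card_blk[OF fm_in_blk[OF Q]] by (subst card_image) (auto simp: inj_on_def fm_inject)
  qed simp
  finally show ?thesis .
qed

interpretation set_act: set_action A\<^sub>0 "\<lambda>f. (`) f" "Pow pts"
proof
  show "f ` B \<in> Pow pts" if "f \<in> carrier A\<^sub>0" "B \<in> Pow pts" for f B using that A0_pts by blast
  show "\<one>\<^bsub>A\<^sub>0\<^esub> ` B = B" if "B \<in> Pow pts" for B using that by (force simp: one_A0)
  show "(f \<otimes>\<^bsub>A\<^sub>0\<^esub> g) ` B = f ` g ` B" if "f \<in> carrier A\<^sub>0" "g \<in> carrier A\<^sub>0" "B \<in> Pow pts" for f g B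
    using that unfolding image_image by (intro image_cong refl) (auto simp: A0_apply)
qed

text \<open>There are 1023 blocks, permuted transitively, and a block stabilizer has order 32 *
  5.\<close>

lemma order_A0: "card (carrier A\<^sub>0) = 163680" and finite_A0: "finite (carrier A\<^sub>0)"
proof -
  show fin: "finite (carrier A\<^sub>0)"
  proof (rule finite_subset)
    show "carrier A\<^sub>0 \<subseteq> pts \<rightarrow>\<^sub>E pts" using A0_pts by (auto simp: in_A0_iff PiE_def)
  qed (simp add: finite_PiE)
  let ?B = "blk (1, 0)"
  have "(\<lambda>f. f ` ?B) ` carrier A\<^sub>0 = blk ` (- {(0, 0)})"
  proof
    show "(\<lambda>f. f ` ?B) ` carrier A\<^sub>0 \<subseteq> blk ` (- {(0, 0)})"
    proof
      fix B assume "B \<in> (\<lambda>f. f ` ?B) ` carrier A\<^sub>0"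
      then obtain f where f: "f \<in> carrier A\<^sub>0" "B = f ` ?B" by auto
      obtain a b c d n where A: "sl2 a b c d" "f = restrict (fm a b c d n) pts" using f(1) by (rule A0E)
      then have "B = blk (vm a b c d n (1, 0))" using f A0_blk by simp
      moreover have "vm a b c d n (1, 0) \<noteq> (0, 0)" 
        using sl2.vm_eq_0[OF A(1), of n "(1, 0)"] by (simp del: vm_0_10)
      ultimately show "B \<in> blk ` (- {(0, 0)})" by blast
    qed
    show "blk ` (- {(0, 0)}) \<subseteq> (\<lambda>f. f ` ?B) ` carrier A\<^sub>0"
    proof
      fix B assume "B \<in> blk ` (- {(0, 0)})"
      then obtain w where w: "w \<noteq> (0, 0)" "B = blk w" by auto
      obtain a b c d where A: "sl2 a b c d" "vm a b c d 0 (1, 0) = w" using vm_transitive[OF w(1)] .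
      then have "B = restrict (fm a b c d 0) pts ` ?B" using w A0_blk by simp
      then show "B \<in> (\<lambda>f. f ` ?B) ` carrier A\<^sub>0" using fm_in_A0[OF A(1)] by blast
    qed
  qed
  moreover have "inj_on blk (- {(0, 0)})" using blk_inject by (auto simp: inj_on_def)
  ultimately have orbit: "card ((\<lambda>f. f ` ?B) ` carrier A\<^sub>0) = 1023"
    by (simp add: card_image Compl_eq_Diff_UNIV card_Diff_singleton card_gf flip: UNIV_Times_UNIV)
  have "bij_betw (\<lambda>(b, n). restrict (fm 1 b 0 1 n) pts) (UNIV \<times> {..<5}) (set_act.stab (carrier A\<^sub>0) ?B)"
    unfolding bij_betw_def
  proof
    show "inj_on (\<lambda>(b, n). restrict (fm 1 b 0 1 n) pts) (UNIV \<times> {..<5})"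
      using base_stab_inject by (auto simp: inj_on_def)
    show "(\<lambda>(b, n). restrict (fm 1 b 0 1 n) pts) ` (UNIV \<times> {..<5}) = set_act.stab (carrier A\<^sub>0) ?B"
    proof
      show "(\<lambda>(b, n). restrict (fm 1 b 0 1 n) pts) ` (UNIV \<times> {..<5}) \<subseteq> set_act.stab (carrier A\<^sub>0) ?B"
      proof (clarify)
        fix b n
        have "sl2 1 b 0 1" by (simp add: sl2_def)
        then show "restrict (fm 1 b 0 1 n) pts \<in> set_act.stab (carrier A\<^sub>0) ?B"
          unfolding set_act.stab_def using fm_in_A0[of 1 b 0 1 n] A0_blk[of 1 b 0 1 n "(1, 0)"]
          by (simp del: image_restrict_eq)
      qed
      show "set_act.stab (carrier A\<^sub>0) ?B \<subseteq> (\<lambda>(b, n). restrict (fm 1 b 0 1 n) pts) ` (UNIV \<times> {..<5})"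
      proof
        fix f assume f: "f \<in> set_act.stab (carrier A\<^sub>0) ?B"
        then obtain a b c d n where A: "sl2 a b c d" "n < 5" "f = restrict (fm a b c d n) pts"
          unfolding set_act.stab_def using A0E by blast
        have "blk (a, c) = blk (1, 0)" using f A0_blk[OF A(1), of n "(1, 0)"] A(3) by (simp add: set_act.stab_def)
        then have "a = 1" "c = 0" using blk_inject[of "(1, 0)" "(a, c)"] by auto
        moreover from this have "d = 1" using A(1) by (simp add: sl2_def)
        ultimately show "f \<in> (\<lambda>(b, n). restrict (fm 1 b 0 1 n) pts) ` (UNIV \<times> {..<5})"
          using A by (intro image_eqI[of _ _ "(b, n)"]) auto
      qed
    qed
  qed
  then have "card (set_act.stab (carrier A\<^sub>0) ?B) = 160"
    by (simp add: bij_betw_same_card[symmetric] card_cartesian_product card_gf)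
  then show "card (carrier A\<^sub>0) = 163680"
    using set_act.orbit_stab[OF A0.subgroup_self fin, of ?B] blk_sub orbit by simp
qed

text \<open>Powers are followed on vectors as well as on forms, because matrix entries can be read
  off from \<open>vm\<close>.\<close>

lemma A0_pow:
  assumes A: "sl2 a b c d"
  shows "\<exists>a' b' c' d'. sl2 a' b' c' d' \<and>
    restrict (fm a b c d n) pts [^]\<^bsub>A\<^sub>0\<^esub> (k :: nat) = restrict (fm a' b' c' d' (k * n)) pts \<and>
    vm a' b' c' d' (k * n) = vm a b c d n ^^ k"
proof (induction k)
  case 0
  show ?case
    by (rule exI[of _ 1], rule exI[of _ 0], rule exI[of _ 0], rule exI[of _ 1])
      (auto simp: sl2_def one_A0 vm_def fun_eq_iff)
next
  case (Suc k)
  then obtain a' b' c' d' where *: "sl2 a' b' c' d'"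
    "restrict (fm a b c d n) pts [^]\<^bsub>A\<^sub>0\<^esub> k = restrict (fm a' b' c' d' (k * n)) pts"
    "vm a' b' c' d' (k * n) = vm a b c d n ^^ k" by blast
  let ?m = "k * n"
  let ?a = "a' * frob ?m a + b' * frob ?m c" and ?b = "a' * frob ?m b + b' * frob ?m d"
    and ?c = "c' * frob ?m a + d' * frob ?m c" and ?d = "c' * frob ?m b + d' * frob ?m d"
  have det: "?a * ?d + ?b * ?c = (a' * d' + b' * c') * frob ?m (a * d + b * c)"
    by (simp add: frob_add frob_mult algebra_simps)
  have "sl2 ?a ?b ?c ?d" using * A unfolding sl2_def det by simp
  moreover have "restrict (fm a b c d n) pts [^]\<^bsub>A\<^sub>0\<^esub> Suc k = restrict (fm ?a ?b ?c ?d (Suc k * n)) pts"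
  proof (rule A0_eqI)
    fix Q assume "Q \<in> pts"
    then show "(restrict (fm a b c d n) pts [^]\<^bsub>A\<^sub>0\<^esub> Suc k) Q = restrict (fm ?a ?b ?c ?d (Suc k * n)) pts Q"
      using fm_in_A0[OF A, of n] fm_in_A0[OF *(1)] fm_comp[of a d b c a' b' c' d' ?m n Q] A sl2.fm_in_pts[OF A]
      by (simp add: A0_apply *(2) sl2_def add.commute)
  qed (use fm_in_A0 A \<open>sl2 ?a ?b ?c ?d\<close> in auto)
  moreover have "vm ?a ?b ?c ?d (Suc k * n) = vm a b c d n ^^ Suc k"
  proof
    fix v
    have "(vm a b c d n ^^ Suc k) v = vm a' b' c' d' ?m (vm a b c d n v)"
      by (simp only: funpow_Suc_right o_apply *(3))
    then show "vm ?a ?b ?c ?d (Suc k * n) v = (vm a b c d n ^^ Suc k) v"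
      by (simp add: vm_comp add.commute del: funpow.simps)
  qed
  ultimately show ?case by blast
qed

lemma funpow_fixpoint: "f x = x \<Longrightarrow> (f ^^ k) x = x"
  by (induction k) auto

lemma vm_square: "vm a b c d 0 (vm a b c d 0 v) = vm (a\<^sup>2 + b * c) (b * (a + d)) (c * (a + d)) (d\<^sup>2 + b * c) 0 v"
  by (simp add: vm_comp power2_eq_square algebra_simps)

text \<open>Squaring a matrix of determinant one squares its trace, so an element whose order divides 8 has trace zero.\<close>

lemma A0_order_8:
  assumes g: "g \<in> carrier A\<^sub>0" "g [^]\<^bsub>A\<^sub>0\<^esub> (8 :: nat) = \<one>\<^bsub>A\<^sub>0\<^esub>"
  obtains a b c where "sl2 a b c a" "g = restrict (fm a b c a 0) pts"
proof -
  obtain a b c d n where A: "sl2 a b c d" "n < 5" "g = restrict (fm a b c d n) pts" using g(1) by (rule A0E)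
  obtain a' b' c' d' where A': "sl2 a' b' c' d'" "g [^]\<^bsub>A\<^sub>0\<^esub> (8 :: nat) = restrict (fm a' b' c' d' (8 * n)) pts"
    "vm a' b' c' d' (8 * n) = vm a b c d n ^^ 8"
    using A0_pow[OF A(1), of n 8] A(3) by auto
  have "fm a' b' c' d' (8 * n) Q = Q" if "Q \<in> pts" for Q
    using fun_cong[OF A'(2), of Q] g(2) that by (simp add: one_A0)
  then have id: "vm a' b' c' d' (8 * n) v = v" for v using fm_trivial[OF A'(1)] by blast
  have "a' = 1" using id[of "(1, 0)"] by simp
  \<comment> \<open>As 8 is prime to 5, the field automorphism involved must be trivial.\<close>
  then have "frob (8 * n mod 5) gf_root = frob 0 gf_root"
    using id[of "(gf_root, 0)"] by (simp add: vm_def frob_mod)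
  then have "8 * n mod 5 = 0" by (intro frob_root_inject) auto
  then have n: "n = 0" using A(2) by presburger
  let ?f = "vm a b c d 0"
  have f8: "?f (?f (?f (?f (?f (?f (?f (?f v))))))) = v" for v
    using fun_cong[OF A'(3), of v] n id[of v] by (simp add: numeral_eq_Suc)
  have tr: "\<exists>a' b' c' d'. (\<forall>v. vm a b c d 0 (vm a b c d 0 v) = vm a' b' c' d' 0 v) \<and> a' + d' = (a + d)\<^sup>2" for a b c d
    by (intro exI conjI allI, rule vm_square) (simp add: gf_square_add ac_simps)
  obtain a2 b2 c2 d2 where 2: "\<And>v. ?f (?f v) = vm a2 b2 c2 d2 0 v" "a2 + d2 = (a + d)\<^sup>2" using tr by metis
  obtain a4 b4 c4 d4 where 4: "\<And>v. vm a2 b2 c2 d2 0 (vm a2 b2 c2 d2 0 v) = vm a4 b4 c4 d4 0 v" "a4 + d4 = (a2 + d2)\<^sup>2"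
    using tr by metis
  obtain a8 b8 c8 d8 where 8: "\<And>v. vm a4 b4 c4 d4 0 (vm a4 b4 c4 d4 0 v) = vm a8 b8 c8 d8 0 v" "a8 + d8 = (a4 + d4)\<^sup>2"
    using tr by metis
  have "vm a8 b8 c8 d8 0 v = v" for v using f8[of v] by (simp add: 2(1) 4(1) 8(1))
  from this[of "(1, 0)"] this[of "(0, 1)"] have "a8 + d8 = 0" by simp
  then have "a + d = 0" by (simp add: 2(2) 4(2) 8(2))
  then have "d = a" by (simp add: gf_add_eq_0_iff)
  with A n that show thesis by metis
qed

text \<open>Determinant one and trace zero describe the transvection sending v to v +
  \<open>sp w v\<close> w, where \<open>w\<close> consists of the square roots of \<open>b\<close>
  and \<open>c\<close>. It shifts a form \<open>Q\<close> by the multiple of \<open>w\<close> whose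
  factor has square \<open>ev Q w + 1\<close>.\<close>

lemma fm_fixed_points:
  assumes "sl2 a b c a"
  obtains w where "\<And>Q. Q \<in> pts \<Longrightarrow> fm a b c a 0 Q = Q \<longleftrightarrow> w = (0, 0) \<or> Q \<in> blk w"
proof -
  obtain x where x: "b = x\<^sup>2" by (rule gf_square_surj)
  obtain y where y: "c = y\<^sup>2" by (rule gf_square_surj)
  have "(a + x * y)\<^sup>2 = 1"
    using assms by (simp add: gf_square_add power_mult_distrib sl2_def x y) (simp add: power2_eq_square)
  then have "a + x * y = 1" by simp
  then have a: "a = 1 + x * y" by (simp add: gf_add_move add.commute)
  have "fm a b c a 0 Q = (fst Q + y\<^sup>2 * (ev Q (x, y) + 1), snd Q + x\<^sup>2 * (ev Q (x, y) + 1))" for Q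
    by (simp add: fm_def ev_def a x y power2_eq_square algebra_simps)
  then have "fm a b c a 0 Q = Q \<longleftrightarrow> (x, y) = (0, 0) \<or> ev Q (x, y) = 1" for Q
    by (auto simp: prod_eq_iff gf_add_eq_0_iff)
  then show thesis by (intro that[of "(x, y)"]) (auto simp: blk_def)
qed

text \<open>Two fixed points fix the vector of their block. The fifth power is linear, since
  five-fold field automorphisms cancel; having determinant one and a fixed vector, it has trace zero
  and so squares to the identity. Thus the tenth power is trivial, and with the eleventh so is
  \<open>x\<close> itself.\<close>

lemma A0_order_11:
  assumes x: "x \<in> carrier A\<^sub>0" "x [^]\<^bsub>A\<^sub>0\<^esub> (11 :: nat) = \<one>\<^bsub>A\<^sub>0\<^esub>" "x \<noteq> \<one>\<^bsub>A\<^sub>0\<^esub>"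
    and Q: "Q \<in> pts" "x Q = Q" and Q': "Q' \<in> pts" "x Q' = Q'"
  shows "Q = Q'"
proof (rule ccontr)
  assume neq: "Q \<noteq> Q'"
  obtain a b c d n where A: "sl2 a b c d" "n < 5" "x = restrict (fm a b c d n) pts" using x(1) by (rule A0E)
  obtain w e where w: "Q \<in> blk w" "Q' = shift Q (scl e w)" "e \<noteq> 0" "\<not> tr e"
    using pts_joined[OF Q(1) Q'(1) neq] .
  have wQ': "Q' \<in> blk w" using w by (auto simp: shift_in_blk)
  have "fm a b c d n Q = Q" "fm a b c d n Q' = Q'" using Q Q' A(3) by simp_all
  then have "Q \<in> blk (vm a b c d n w)" "Q' \<in> blk (vm a b c d n w)"
    using sl2.fm_in_blk[OF A(1) w(1), of n] sl2.fm_in_blk[OF A(1) wQ', of n] by simp_all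
  then have vm_w: "vm a b c d n w = w" using blk_unique w(1) wQ' neq by metis
  obtain a' b' c' d' where A': "sl2 a' b' c' d'" "x [^]\<^bsub>A\<^sub>0\<^esub> (5 :: nat) = restrict (fm a' b' c' d' (5 * n)) pts"
    "vm a' b' c' d' (5 * n) = vm a b c d n ^^ 5"
    using A0_pow[OF A(1), of n 5] A(3) by auto
  have "vm a' b' c' d' (5 * n) w = w" by (simp only: A'(3) funpow_fixpoint[of "vm a b c d n" w, OF vm_w])
  moreover have f0: "frob (5 * n) k = k" for k using frob_mod[of "5 * n" k] by simp
  ultimately have e: "a' * fst w + b' * snd w = fst w" "c' * fst w + d' * snd w = snd w"
    by (auto simp: vm_def prod_eq_iff)
  have e1: "(a' + 1) * fst w = b' * snd w"
    using e(1) by (metis add.commute distrib_right gf_add_move mult_1)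
  have e2: "(d' + 1) * snd w = c' * fst w"
    using e(2) by (metis add.commute distrib_right gf_add_move mult_1)
  have "(a' + 1) * (d' + 1) = b' * c'"
  proof (cases "fst w = 0")
    case False
    have "((a' + 1) * (d' + 1)) * fst w = (b' * c') * fst w"
      using e1 e2 by (metis mult.assoc mult.commute)
    then show ?thesis using False by simp
  next
    case True
    then have "snd w \<noteq> 0" using blk_nonzero[OF w(1)] by (cases w) auto
    moreover have "((a' + 1) * (d' + 1)) * snd w = (b' * c') * snd w"
      using e1 e2 by (metis mult.assoc mult.commute)
    ultimately show ?thesis by simp
  qed
  moreover have "(a' * d' + b' * c') + 1 + (a' + d') = (a' + 1) * (d' + 1) + b' * c'"
    by (simp add: algebra_simps)
  ultimately have "(a' * d' + b' * c') + 1 + (a' + d') = 0" by simp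
  then have d': "d' = a'" using A'(1) by (simp add: sl2_def gf_add_eq_0_iff)
  have pts5: "x [^]\<^bsub>A\<^sub>0\<^esub> (5 :: nat) \<in> carrier A\<^sub>0" using x by simp
  have fm0: "fm a' b' c' d' (5 * n) = fm a' b' c' a' 0"
    by (rule ext) (simp add: fm_def d' f0)
  have x5: "x [^]\<^bsub>A\<^sub>0\<^esub> (5 :: nat) = restrict (fm a' b' c' a' 0) pts" by (simp only: A'(2) fm0)
  have "x [^]\<^bsub>A\<^sub>0\<^esub> (5 :: nat) \<otimes>\<^bsub>A\<^sub>0\<^esub> x [^]\<^bsub>A\<^sub>0\<^esub> (5 :: nat) = \<one>\<^bsub>A\<^sub>0\<^esub>"
  proof (rule A0_eqI)
    fix P assume P: "P \<in> pts"
    have "fm a' b' c' a' 0 P \<in> pts" using sl2.fm_in_pts[OF A'(1) P] d' by simp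
    then have "(x [^]\<^bsub>A\<^sub>0\<^esub> (5 :: nat)) ((x [^]\<^bsub>A\<^sub>0\<^esub> (5 :: nat)) P) = P"
      unfolding x5 using P fm_left_inverse[of a' b' c' a' P] A'(1) by (simp add: d')
    then show "(x [^]\<^bsub>A\<^sub>0\<^esub> (5 :: nat) \<otimes>\<^bsub>A\<^sub>0\<^esub> x [^]\<^bsub>A\<^sub>0\<^esub> (5 :: nat)) P = \<one>\<^bsub>A\<^sub>0\<^esub> P"
      by (subst A0_apply[OF pts5 pts5 P]) (simp add: one_A0 P)
  qed (use pts5 in auto)
  then have "x [^]\<^bsub>A\<^sub>0\<^esub> (10 :: nat) = \<one>\<^bsub>A\<^sub>0\<^esub>" using x(1) by (simp add: A0.nat_pow_mult)
  moreover have "x [^]\<^bsub>A\<^sub>0\<^esub> (11 :: nat) = x [^]\<^bsub>A\<^sub>0\<^esub> (10 :: nat) \<otimes>\<^bsub>A\<^sub>0\<^esub> x"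
    using A0.nat_pow_Suc[of x 10] by simp
  ultimately show False using x by simp
qed

section \<open>The lines of an invariant design\<close>

lemma card_lines_through:
  assumes D: "design2 496 4 P L" and p: "p \<in> P" shows "card {l \<in> L. p \<in> l} = 165"
proof -
  have fin: "finite P" and cP: "card P = 496" and L: "\<And>l. l \<in> L \<Longrightarrow> l \<subseteq> P \<and> card l = 4"
    and un: "\<And>x y. x \<in> P \<Longrightarrow> y \<in> P \<Longrightarrow> x \<noteq> y \<Longrightarrow> \<exists>!l. l \<in> L \<and> x \<in> l \<and> y \<in> l"
    using D by (auto simp: design2_def)
  let ?C = "(\<lambda>l. l - {p}) ` {l \<in> L. p \<in> l}"
  have U: "\<Union> ?C = P - {p}"
  proof
    show "\<Union> ?C \<subseteq> P - {p}" using L by auto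
    show "P - {p} \<subseteq> \<Union> ?C"
    proof
      fix q assume q: "q \<in> P - {p}"
      then obtain l where "l \<in> L" "p \<in> l" "q \<in> l" using un[of p q] p by blast
      then show "q \<in> \<Union> ?C" using q by auto
    qed
  qed
  have "3 * card ?C = card (\<Union> ?C)"
  proof (rule card_partition)
    have "?C \<subseteq> Pow P" using L by auto
    then show "finite ?C" using fin by (rule finite_subset[OF _ finite_Pow_iff[THEN iffD2]])
    show "finite (\<Union> ?C)" using fin U by simp
    show "card c = 3" if "c \<in> ?C" for c using that L by auto
    show "c1 \<inter> c2 = {}" if c12: "c1 \<in> ?C" "c2 \<in> ?C" "c1 \<noteq> c2" for c1 c2
    proof (rule ccontr)
      assume "c1 \<inter> c2 \<noteq> {}"
      then obtain q where q: "q \<in> c1" "q \<in> c2" by blast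
      obtain l1 l2 where l: "c1 = l1 - {p}" "c2 = l2 - {p}" "l1 \<in> L" "l2 \<in> L" "p \<in> l1" "p \<in> l2"
        using c12 by auto
      then have "l1 = l2" using un[of p q] L[of l1] p q by blast
      then show False using l c12 by simp
    qed
  qed
  moreover have "card (P - {p}) = 495" using cP p fin by simp
  moreover have "card ?C = card {l \<in> L. p \<in> l}"
    by (rule card_image) (auto simp: inj_on_def)
  ultimately show ?thesis using U by simp
qed

locale invariant_design =
  fixes L :: "form set set"
  assumes D: "design2 496 4 pts L"
    and inv: "\<And>g l. g \<in> carrier A\<^sub>0 \<Longrightarrow> l \<in> L \<Longrightarrow> g ` l \<in> L"
    and ft: "flag_transitive L (carrier A\<^sub>0)"
begin

lemma L_sub: "l \<in> L \<Longrightarrow> l \<subseteq> pts" and L_card: "l \<in> L \<Longrightarrow> card l = 4"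
  using D by (auto simp: design2_def)

lemma L_unique:
  "l \<in> L \<Longrightarrow> m \<in> L \<Longrightarrow> x \<in> l \<Longrightarrow> y \<in> l \<Longrightarrow> x \<in> m \<Longrightarrow> y \<in> m \<Longrightarrow> x \<noteq> y \<Longrightarrow> l = m"
  using D L_sub[of l] unfolding design2_def by (metis subset_iff)

definition flags :: "(form \<times> form set) set" where "flags = {(p, l). l \<in> L \<and> p \<in> l}"

lemma card_flags: "card flags = 81840"
proof -
  have "flags = (SIGMA p:pts. {l \<in> L. p \<in> l})" using L_sub by (auto simp: flags_def)
  moreover have "finite {l \<in> L. p \<in> l}" if "p \<in> pts" for p
    using card_lines_through[OF D that] by (metis card.infinite zero_neq_numeral)
  ultimately have "card flags = (\<Sum>p\<in>pts. card {l \<in> L. p \<in> l})" by simp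
  also have "\<dots> = 496 * 165" using card_lines_through[OF D] by (simp add: card_pts)
  finally show ?thesis by simp
qed

sublocale flag_act: set_action A\<^sub>0 "\<lambda>g (p, l). (g p, g ` l)" flags
proof
  fix g x assume g: "g \<in> carrier A\<^sub>0" "x \<in> flags"
  moreover obtain p l where "x = (p, l)" by (cases x)
  ultimately show "(case x of (p, l) \<Rightarrow> (g p, g ` l)) \<in> flags" using inv by (simp add: flags_def)
next
  fix x assume "x \<in> flags"
  moreover obtain p l where "x = (p, l)" by (cases x)
  ultimately show "(case x of (p, l) \<Rightarrow> (\<one>\<^bsub>A\<^sub>0\<^esub> p, \<one>\<^bsub>A\<^sub>0\<^esub> ` l)) = x"
    using L_sub[of l] set_act.act_one[of l] pts_act.act_one[of p] by (auto simp: flags_def simp del: pts_act.act_one)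
next
  fix g h x assume "g \<in> carrier A\<^sub>0" "h \<in> carrier A\<^sub>0" "x \<in> flags"
  moreover obtain p l where "x = (p, l)" by (cases x)
  ultimately show "(case x of (p, l) \<Rightarrow> ((g \<otimes>\<^bsub>A\<^sub>0\<^esub> h) p, (g \<otimes>\<^bsub>A\<^sub>0\<^esub> h) ` l)) =
      (case case x of (p, l) \<Rightarrow> (h p, h ` l) of (p, l) \<Rightarrow> (g p, g ` l))"
    using L_sub[of l] set_act.act_mult[of g h l] pts_act.act_mult[of g h p] by (auto simp: flags_def simp del: image_iff)
qed

abbreviation line_stab :: "form set \<Rightarrow> (form \<Rightarrow> form) set" where
  "line_stab l \<equiv> set_act.stab (carrier A\<^sub>0) l"

lemma subgroup_line_stab: "l \<in> L \<Longrightarrow> subgroup (line_stab l) A\<^sub>0"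
  using L_sub by (intro set_act.subgroup_stab A0.subgroup_self) auto

lemma line_stab_transitive:
  assumes "l \<in> L" "p \<in> l" "q \<in> l" obtains g where "g \<in> line_stab l" "g p = q"
proof -
  obtain g where "g \<in> carrier A\<^sub>0" "g p = q" "g ` l = l"
    using ft[unfolded flag_transitive_def, rule_format, OF assms(1,2) assms(1,3)] by blast
  then show thesis by (intro that[of g]) (simp_all add: set_act.stab_def)
qed

lemma card_flag_stab:
  assumes l: "l \<in> L" "p \<in> l" shows "card (pts_act.stab (line_stab l) p) = 2"
proof -
  have pl: "(p, l) \<in> flags" using l by (simp add: flags_def)
  have "(\<lambda>g. (g p, g ` l)) ` carrier A\<^sub>0 = flags"
  proof
    show "(\<lambda>g. (g p, g ` l)) ` carrier A\<^sub>0 \<subseteq> flags" using l inv by (auto simp: flags_def)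
    show "flags \<subseteq> (\<lambda>g. (g p, g ` l)) ` carrier A\<^sub>0"
    proof clarify
      fix q m assume "(q, m) \<in> flags"
      then have m: "m \<in> L" "q \<in> m" by (simp_all add: flags_def)
      obtain g where "g \<in> carrier A\<^sub>0" "g p = q" "g ` l = m"
        using ft[unfolded flag_transitive_def, rule_format, OF l m] by blast
      then show "(q, m) \<in> (\<lambda>g. (g p, g ` l)) ` carrier A\<^sub>0" by (intro image_eqI[of _ _ g]) auto
    qed
  qed
  then have "163680 = 81840 * card (flag_act.stab (carrier A\<^sub>0) (p, l))"
    using flag_act.orbit_stab[OF A0.subgroup_self finite_A0 pl] by (simp add: order_A0 card_flags)
  moreover have "flag_act.stab (carrier A\<^sub>0) (p, l) = pts_act.stab (line_stab l) p"
    by (auto simp: flag_act.stab_def pts_act.stab_def set_act.stab_def)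
  ultimately show ?thesis by simp
qed

lemma card_line_stab: assumes l: "l \<in> L" shows "card (line_stab l) = 8"
proof -
  have "l \<noteq> {}" using L_card[OF l] by auto
  then obtain p where p: "p \<in> l" by blast
  have "(\<lambda>g. g p) ` line_stab l = l"
  proof
    show "(\<lambda>g. g p) ` line_stab l \<subseteq> l" using p by (auto simp: set_act.stab_def)
    show "l \<subseteq> (\<lambda>g. g p) ` line_stab l" 
    proof
      fix q assume "q \<in> l"
      then obtain g where "g \<in> line_stab l" "g p = q" by (rule line_stab_transitive[OF l p])
      then show "q \<in> (\<lambda>g. g p) ` line_stab l" by (intro image_eqI[of _ _ g]) simp_all
    qed
  qed
  moreover have "finite (line_stab l)" using finite_A0 by (simp add: set_act.stab_def)
  moreover have "p \<in> pts" using L_sub l p by blast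
  ultimately show ?thesis
    using pts_act.orbit_stab[OF subgroup_line_stab[OF l], of p] card_flag_stab[OF l p] L_card[OF l] by simp
qed

lemma line_stab_form:
  assumes l: "l \<in> L" and g: "g \<in> line_stab l"
  obtains a b c where "sl2 a b c a" "g = restrict (fm a b c a 0) pts"
proof -
  have gA: "g \<in> carrier A\<^sub>0" using g by (simp add: set_act.stab_def)
  interpret S: group "A\<^sub>0\<lparr>carrier := line_stab l\<rparr>"
    using subgroup_line_stab[OF l] by (rule subgroup.subgroup_is_group) (rule group_A0)
  have "g [^]\<^bsub>A\<^sub>0\<lparr>carrier := line_stab l\<rparr>\<^esub> (8 :: nat) = \<one>\<^bsub>A\<^sub>0\<^esub>"
    using S.pow_order_eq_1[of g] g card_line_stab[OF l] by (simp add: order_def)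
  then have "g [^]\<^bsub>A\<^sub>0\<^esub> (8 :: nat) = \<one>\<^bsub>A\<^sub>0\<^esub>" by (simp add: A0.nat_pow_consistent[symmetric])
  with gA obtain a b c where "sl2 a b c a" "g = restrict (fm a b c a 0) pts" by (rule A0_order_8)
  then show thesis by (rule that)
qed

lemma line_stab_commute:
  assumes l: "l \<in> L" and g: "g \<in> line_stab l" and h: "h \<in> line_stab l" and p: "p \<in> pts"
  shows "g (h p) = h (g p)"
proof -
  have invol: "k \<otimes>\<^bsub>A\<^sub>0\<^esub> k = \<one>\<^bsub>A\<^sub>0\<^esub>" "k \<in> carrier A\<^sub>0" if k: "k \<in> line_stab l" for k
  proof -
    show kA: "k \<in> carrier A\<^sub>0" using k by (simp add: set_act.stab_def)
    obtain a b c where A: "sl2 a b c a" "k = restrict (fm a b c a 0) pts" using line_stab_form[OF l k] .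
    show "k \<otimes>\<^bsub>A\<^sub>0\<^esub> k = \<one>\<^bsub>A\<^sub>0\<^esub>"
    proof (rule A0_eqI)
      fix Q assume "Q \<in> pts"
      then show "(k \<otimes>\<^bsub>A\<^sub>0\<^esub> k) Q = \<one>\<^bsub>A\<^sub>0\<^esub> Q"
        using A0_apply[OF kA kA] by (simp add: one_A0 A(2) sl2.fm_in_pts[OF A(1)] fm_left_inverse[OF A(1)])
    qed (use kA in simp_all)
  qed
  interpret S: subgroup "line_stab l" "A\<^sub>0" using subgroup_line_stab[OF l] .
  have inv: "inv\<^bsub>A\<^sub>0\<^esub> k = k" if "k \<in> line_stab l" for k
    using invol[OF that] A0.inv_equality by blast
  have "g \<otimes>\<^bsub>A\<^sub>0\<^esub> h = inv\<^bsub>A\<^sub>0\<^esub> (g \<otimes>\<^bsub>A\<^sub>0\<^esub> h)" using inv[OF S.m_closed[OF g h]] by simp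
  also have "\<dots> = h \<otimes>\<^bsub>A\<^sub>0\<^esub> g" 
    using A0.inv_mult_group[OF invol(2)[OF g] invol(2)[OF h]] by (simp only: inv[OF g] inv[OF h])
  finally show ?thesis using A0_apply p g h invol by metis
qed

text \<open>Flag stabilizers have order 2, so some nontrivial \<open>t\<close> fixes a point of the
  line. It commutes with the line stabilizer, which is transitive on the line; hence
  \<open>t\<close> fixes the line pointwise and the stabilizer preserves the block of points fixed
  by \<open>t\<close>.\<close>

lemma line_in_blk:
  assumes l: "l \<in> L"
  obtains w where "l \<subseteq> blk w" "\<And>g. g \<in> line_stab l \<Longrightarrow> g ` blk w \<subseteq> blk w"
proof -
  have "l \<noteq> {}" using L_card[OF l] by auto
  then obtain p where p: "p \<in> l" by blast
  have "\<not> pts_act.stab (line_stab l) p \<subseteq> {\<one>\<^bsub>A\<^sub>0\<^esub>}"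
    using card_mono[of "{\<one>\<^bsub>A\<^sub>0\<^esub>}" "pts_act.stab (line_stab l) p"] card_flag_stab[OF l p] by auto
  then obtain t where t: "t \<in> line_stab l" "t p = p" "t \<noteq> \<one>\<^bsub>A\<^sub>0\<^esub>" by (auto simp: pts_act.stab_def)
  obtain a b c where A: "sl2 a b c a" "t = restrict (fm a b c a 0) pts" using line_stab_form[OF l t(1)] .
  obtain w where w: "\<And>Q. Q \<in> pts \<Longrightarrow> fm a b c a 0 Q = Q \<longleftrightarrow> w = (0, 0) \<or> Q \<in> blk w"
    using fm_fixed_points[OF A(1)] by metis
  have "w \<noteq> (0, 0)"
  proof
    assume "w = (0, 0)"
    then have "t = \<one>\<^bsub>A\<^sub>0\<^esub>" using w by (auto simp: A(2) one_A0 intro!: restrict_ext)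
    then show False using t by simp
  qed
  then have fix_iff: "t Q = Q \<longleftrightarrow> Q \<in> blk w" if "Q \<in> pts" for Q using w that by (simp add: A(2))
  have pts: "p \<in> pts" using L_sub l p by blast
  show thesis
  proof (rule that[of w])
    show "l \<subseteq> blk w"
    proof
      fix q assume q: "q \<in> l"
      obtain g where g: "g \<in> line_stab l" "g p = q" using line_stab_transitive[OF l p q] .
      have "t q = q" using line_stab_commute[OF l t(1) g(1) pts] t g by simp
      then show "q \<in> blk w" using fix_iff L_sub[OF l] q by blast
    qed
    fix g assume g: "g \<in> line_stab l"
    show "g ` blk w \<subseteq> blk w"
    proof
      fix Q' assume "Q' \<in> g ` blk w"
      then obtain Q where Q: "Q \<in> blk w" "Q' = g Q" by blast
      then have Qp: "Q \<in> pts" using blk_sub by blast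
      have gA: "g \<in> carrier A\<^sub>0" using g by (simp add: set_act.stab_def)
      have "t (g Q) = g Q" using line_stab_commute[OF l t(1) g Qp] fix_iff[OF Qp] Q by simp
      then show "Q' \<in> blk w" using fix_iff A0_pts[OF gA Qp] Q(2) by simp
    qed
  qed
qed

text \<open>The stabilizer of a line acts on it by translations, so the line is a coset of an additive group.\<close>

lemma base_subgroup:
  obtains l x y where "l \<in> L" "l = (\<lambda>c. shift (1, 1) (scl c (1, 0))) ` {0, x, y, x + y}"
    "x \<in> T0" "y \<in> T0" "x \<noteq> y"
proof -
  have "(1, 1) \<in> pts" by (simp add: pts_def)
  then have "card {l \<in> L. (1, 1) \<in> l} = 165" using card_lines_through[OF D] by blast
  then have "{l \<in> L. (1, 1) \<in> l} \<noteq> {}" by (metis card.empty zero_neq_numeral)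
  then obtain m where m: "m \<in> L" "(1, 1) \<in> m" by blast
  obtain w where w: "m \<subseteq> blk w" using line_in_blk[OF m(1)] by metis
  obtain a b c d where A: "sl2 a b c d" "fm a b c d 0 (1, 1) = (1, 1)" "vm a b c d 0 (1, 0) = w"
    using blk_transitive[of "(1, 1)" w 0] w m by blast
  interpret A': sl2 d b c a by standard (use A(1) in \<open>simp add: sl2_def mult.commute\<close>)
  define f where "f = restrict (fm d b c a 0) pts"
  have f: "f \<in> carrier A\<^sub>0" unfolding f_def by (rule fm_in_A0) unfold_locales
  define l where "l = f ` m"
  have l: "l \<in> L" unfolding l_def using f m by (intro inv)
  have fm11: "fm d b c a 0 (1, 1) = (1, 1)"
    using fm_left_inverse[of d b c a "(1, 1)"] A'.sl2_axioms A(2) by simp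
  then have p: "(1, 1) \<in> l" unfolding l_def f_def using m L_sub by (force simp: image_iff)
  have "vm d b c a 0 w = (1, 0)"
    using A(1) by (simp add: vm_comp sl2_def flip: A(3)) (simp add: vm_def ac_simps)
  then have "f ` blk w = blk (1, 0)" unfolding f_def using A0_blk[OF A'.sl2_axioms] by simp
  then have lB: "l \<subseteq> blk (1, 0)" using w unfolding l_def by blast
  obtain w' where w': "l \<subseteq> blk w'" "\<And>g. g \<in> line_stab l \<Longrightarrow> g ` blk w' \<subseteq> blk w'"
    using line_in_blk[OF l] by metis
  have "\<not> l \<subseteq> {(1, 1)}" using card_mono[of "{(1, 1)}" l] L_card[OF l] by auto
  then obtain q where q: "q \<in> l" "q \<noteq> (1, 1)" by blast
  have "w' = (1, 0)" using blk_unique[of "(1, 1)" w' q "(1, 0)"] w' lB p q by blast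
  note stab_B = w'(2)[unfolded this]
  let ?P = "\<lambda>c. shift (1, 1) (scl c (1, 0))"
  have P_inject: "?P c = ?P d \<longleftrightarrow> c = d" for c d by (simp add: scl_def)
  define V where "V = {c. ?P c \<in> l}"
  have l_V: "l = ?P ` V"
  proof
    show "l \<subseteq> ?P ` V"
    proof
      fix Q assume Q: "Q \<in> l"
      then have "Q \<in> blk (1, 0)" using lB by blast
      then obtain c where "Q = ?P c" using blk_eq_image[OF base_point] by blast
      then show "Q \<in> ?P ` V" using Q by (auto simp: V_def)
    qed
  qed (auto simp: V_def)
  have V0: "0 \<in> V" using p by (simp add: V_def)
  \<comment> \<open>A stabilizing element that moves the base point to \<open>?P c\<close> fixes the
    vector (1, 0), and therefore acts on the line as translation by \<open>c\<close>.\<close>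
  have V_add: "c + e \<in> V" if c: "c \<in> V" and e: "e \<in> V" for c e
  proof -
    obtain g where g: "g \<in> line_stab l" "g (1, 1) = ?P c"
      using line_stab_transitive[OF l p, of "?P c"] c unfolding V_def by blast
    obtain a b c' where G: "sl2 a b c' a" "g = restrict (fm a b c' a 0) pts" using line_stab_form[OF l g(1)] .
    have "g ` blk (1, 0) = blk (a, c')" using A0_blk[OF G(1), of 0 "(1, 0)"] G(2) by simp
    then have "blk (a, c') \<subseteq> blk (1, 0)" using stab_B[OF g(1)] by simp
    moreover have "g (1, 1) \<in> blk (a, c')" "g q \<in> blk (a, c')"
      using \<open>g ` blk (1, 0) = blk (a, c')\<close> base_point q lB by blast+
    moreover have "g (1, 1) \<noteq> g q"
      using pts_act.act_inject[of g "(1, 1)" q] g(1) q p L_sub[OF l] by (auto simp: set_act.stab_def)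
    ultimately have "(a, c') = (1, 0)" using blk_unique[of "g (1, 1)" "(a, c')" "g q" "(1, 0)"] by blast
    then have gP: "g (?P u) = shift (g (1, 1)) (scl u (1, 0))" if "?P u \<in> pts" for u
      using that base_point by (simp add: G(2) fm_shift blk_def) (simp add: vm_def scl_def)
    have "g (?P e) \<in> l" using g(1) e by (auto simp: set_act.stab_def V_def)
    moreover have "?P e \<in> pts" using e L_sub[OF l] by (auto simp: V_def)
    ultimately show ?thesis using gP[of e] g(2) by (simp add: V_def shift_shift vpl_scl)
  qed
  have "card V = 4" using L_card[OF l] unfolding l_V by (subst (asm) card_image) (auto simp: inj_on_def scl_inject)
  have finV: "finite V" by simp
  have "\<not> V \<subseteq> {0}" using card_mono[of "{0}" V] \<open>card V = 4\<close> by auto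
  then obtain x where x: "x \<in> V" "x \<noteq> 0" by blast
  have "\<not> V \<subseteq> {0, x}" using card_mono[of "{0, x}" V] \<open>card V = 4\<close> x by (auto simp: card_insert_if)
  then obtain y where y: "y \<in> V" "y \<noteq> 0" "y \<noteq> x" by blast
  have "{0, x, y, x + y} = V"
  proof (rule card_subset_eq[OF finV])
    show "{0, x, y, x + y} \<subseteq> V" using V0 x y V_add by auto
    show "card {0, x, y, x + y} = card V"
      using x y \<open>card V = 4\<close> by (simp add: card_insert_if gf_add_eq_0_iff)
  qed
  moreover have "c \<in> T0" if "c \<in> V" "c \<noteq> 0" for c
  proof -
    have "?P c \<in> blk (1, 0)" using that lB by (auto simp: V_def)
    then obtain e where "scl c (1, 0) = scl e (1, 0)" "\<not> tr e" using shift_in_blk[OF base_point] by blast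
    then show ?thesis using that by (simp add: T0_def scl_def)
  qed
  ultimately show thesis using l l_V x y by (intro that[of l x y]) auto
qed

end

text \<open>The line and its Frobenius image share the base point, so as soon as they share another
  point they coincide; the condition says this for the nonzero elements of the two
  subgroups.\<close>

definition triple_cond :: "gf32 \<Rightarrow> gf32 \<Rightarrow> gf32 \<Rightarrow> gf32 \<Rightarrow> bool" where
  "triple_cond x y x' y' \<longleftrightarrow> (let z = x + y; z' = x' + y'; m = (\<lambda>c. c = x \<or> c = y \<or> c = z) in
     if m x' \<or> m y' \<or> m z' then m x' \<and> m y' \<and> m z' else True)"

text \<open>No pair outside a cycle of \<open>rot\<close> survives the four nontrivial Frobenius
  powers, so the invariant spread is forced.\<close>

lemma rot_unique_check: "\<forall>x\<in>T0. list_all (\<lambda>y. if y = 0 \<or> tr y \<or> y = x \<or> y = rot x \<or> y = x + rot x then True else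
    \<not> (let x1 = x * x; x2 = x1 * x1; x3 = x2 * x2; x4 = x3 * x3;
      y1 = y * y; y2 = y1 * y1; y3 = y2 * y2; y4 = y3 * y3 in
     triple_cond x y x1 y1 \<and> triple_cond x y x2 y2 \<and> triple_cond x y x3 y3 \<and> triple_cond x y x4 y4)) gf_list"
  unfolding T0_list gf_list_def by code_simp

lemma rot_unique:
  assumes "x \<in> T0" "y \<in> T0" "x \<noteq> y" "\<And>n. triple_cond x y (frob n x) (frob n y)"
  shows "y = rot x \<or> y = x + rot x"
proof (rule ccontr)
  assume *: "\<not> ?thesis"
  have "triple_cond x y (frob 1 x) (frob 1 y) \<and> triple_cond x y (frob 2 x) (frob 2 y) \<and>
      triple_cond x y (frob 3 x) (frob 3 y) \<and> triple_cond x y (frob 4 x) (frob 4 y)"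
    using assms(4) by blast
  then show False
    using bspec[OF rot_unique_check assms(1)] * assms(2,3)
    by (simp add: list_all_iff set_gf_list T0_def Let_def frob_Suc numeral_eq_Suc power2_eq_square split: if_splits) blast
qed

context invariant_design
begin

text \<open>The image of the line under the Frobenius map shares with it the base point and the
  point belonging to \<open>frob n c\<close>, so both are the same line.\<close>

lemma frob_line:
  fixes n :: nat
  assumes l: "l \<in> L" "l = (\<lambda>c. shift (1, 1) (scl c (1, 0))) ` V" and V: "0 \<in> V"
    and c: "c \<in> V" "c \<noteq> 0" "frob n c \<in> V" and d: "d \<in> V"
  shows "frob n d \<in> V"
proof -
  let ?P = "\<lambda>c. shift (1, 1) (scl c (1, 0))"
  have P_inject: "?P c = ?P d \<longleftrightarrow> c = d" for c d by (simp add: scl_def)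
  define f where "f = restrict (fm 1 0 0 1 n) pts"
  have f: "f \<in> carrier A\<^sub>0" unfolding f_def by (rule fm_in_A0) (simp add: sl2_def)
  have fP: "f (?P e) = ?P (frob n e)" if "e \<in> V" for e
  proof -
    have "?P e \<in> pts" using that l L_sub by blast
    then show ?thesis by (simp add: f_def fm_shift vm_scl) (simp add: fm_def)
  qed
  have mem: "?P e \<in> l" if "e \<in> V" for e using that l by blast
  have im: "?P (frob n e) \<in> f ` l" if "e \<in> V" for e using fP[OF that] mem[OF that] by (metis imageI)
  have P0: "?P 0 \<in> f ` l" using im[OF V] by simp
  have neq: "?P 0 \<noteq> ?P (frob n c)" unfolding P_inject using c(2) by simp
  have "f ` l = l" by (rule L_unique[OF inv[OF f l(1)] l(1) P0 im[OF c(1)] mem[OF V] mem[OF c(3)] neq])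
  then have "?P (frob n d) \<in> ?P ` V" using im[OF d] l(2) by simp
  then obtain e where "?P (frob n d) = ?P e" "e \<in> V" by (rule imageE)
  then show ?thesis unfolding P_inject by simp
qed

text \<open>Both sets of lines are orbits of the same group, so a single common line
  suffices.\<close>

lemma L_eq_dlines: "L = dlines"
proof -
  obtain l x y where l: "l \<in> L" "l = (\<lambda>c. shift (1, 1) (scl c (1, 0))) ` {0, x, y, x + y}"
    "x \<in> T0" "y \<in> T0" "x \<noteq> y"
    by (rule base_subgroup)
  have nz: "x \<noteq> 0" "y \<noteq> 0" "x + y \<noteq> 0" using l by (auto simp: T0_def gf_add_eq_0_iff)
  have "triple_cond x y (frob n x) (frob n y)" for n
  proof -
    have *: "frob n d \<in> {x, y, x + y}" if "c \<in> {x, y, x + y}" "frob n c \<in> {x, y, x + y}" "d \<in> {x, y, x + y}" for c d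
    proof -
      have "c \<noteq> 0" "d \<noteq> 0" using that nz by auto
      moreover have "frob n d \<in> {0, x, y, x + y}"
        by (rule frob_line[OF l(1,2), of c]) (use that \<open>c \<noteq> 0\<close> in simp_all)
      ultimately show ?thesis by simp
    qed
    then have "(\<exists>c\<in>{x, y, x + y}. frob n c \<in> {x, y, x + y}) \<longrightarrow> (\<forall>d\<in>{x, y, x + y}. frob n d \<in> {x, y, x + y})"
      by blast
    then show ?thesis
      unfolding triple_cond_def Let_def frob_add[symmetric]
      by (simp only: bex_simps ball_simps insert_iff empty_iff simp_thms split: if_split)
  qed
  then have "y = rot x \<or> y = x + rot x" using l by (intro rot_unique)
  then have "spr x = {0, x, y, x + y}" by (auto simp: spr_def)
  then have "l = dline (1, 1) (1, 0) x" using l(2) by (simp add: dline_def)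
  then have ld: "l \<in> dlines" using base_point l(3) by (simp add: dlinesI)
  have "l \<noteq> {}" using l(2) by simp
  then obtain p where p: "p \<in> l" by blast
  have ne: "\<exists>q. q \<in> m" if "m \<in> L \<or> m \<in> dlines" for m
  proof -
    have "card m = 4" using that L_card design2_dlines by (auto simp: design2_def)
    then show ?thesis by (metis card.empty equals0I zero_neq_numeral)
  qed
  show ?thesis
  proof
    show "L \<subseteq> dlines"
    proof
      fix m assume m: "m \<in> L"
      then obtain q where q: "q \<in> m" using ne by blast
      obtain g where "g \<in> carrier A\<^sub>0" "g ` l = m"
        using ft[unfolded flag_transitive_def, rule_format, OF l(1) p m q] by blast
      then show "m \<in> dlines" using ld by (auto simp: in_A0_iff aut_def)
    qed
    show "dlines \<subseteq> L"
    proof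
      fix m assume m: "m \<in> dlines"
      then obtain q where q: "q \<in> m" using ne by blast
      obtain g where "g \<in> carrier A\<^sub>0" "g ` l = m"
        using flag_transitive_A0[unfolded flag_transitive_def, rule_format, OF ld p m q] by blast
      then show "m \<in> L" using inv l(1) by blast
    qed
  qed
qed

end

section \<open>Isomorphic designs\<close>

lemma design2_image:
  assumes D: "design2 v k P L" and f: "bij_betw f P P'"
  shows "design2 v k P' ((\<lambda>l. f ` l) ` L)"
proof -
  have inj: "inj_on f P" and im: "f ` P = P'" using f by (auto simp: bij_betw_def)
  have L: "l \<subseteq> P" "card l = k" if "l \<in> L" for l using D that by (auto simp: design2_def)
  have mem: "f x \<in> f ` l \<longleftrightarrow> x \<in> l" if "l \<in> L" "x \<in> P" for l x
    using inj_on_image_mem_iff[OF inj] that L by blast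
  show ?thesis
    unfolding design2_def
  proof (intro conjI ballI impI)
    show "finite P'" "card P' = v" using D f by (auto simp: design2_def bij_betw_finite[symmetric] bij_betw_same_card)
    show "m \<subseteq> P'" if "m \<in> (\<lambda>l. f ` l) ` L" for m using that L im by auto
    show "card m = k" if "m \<in> (\<lambda>l. f ` l) ` L" for m
      using that L card_image[OF inj_on_subset[OF inj]] by auto
    fix x' y' assume "x' \<in> P'" "y' \<in> P'" "x' \<noteq> y'"
    then obtain x y where xy: "x \<in> P" "y \<in> P" "x' = f x" "y' = f y" "x \<noteq> y" using im by blast
    have ex: "\<exists>!l. l \<in> L \<and> x \<in> l \<and> y \<in> l" using D xy by (simp add: design2_def)
    then obtain l where l: "l \<in> L" "x \<in> l" "y \<in> l" by blast
    show "\<exists>!m. m \<in> (\<lambda>l. f ` l) ` L \<and> x' \<in> m \<and> y' \<in> m"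
    proof (rule ex1I[of _ "f ` l"])
      show "f ` l \<in> (\<lambda>l. f ` l) ` L \<and> x' \<in> f ` l \<and> y' \<in> f ` l"
        unfolding xy(3,4) using l by (intro conjI imageI)
      fix m assume m: "m \<in> (\<lambda>l. f ` l) ` L \<and> x' \<in> m \<and> y' \<in> m"
      then obtain l' where "l' \<in> L" "m = f ` l'" by blast
      then have l': "l' \<in> L" "m = f ` l'" "f x \<in> f ` l'" "f y \<in> f ` l'" using m xy(3,4) by simp_all
      then have "x \<in> l'" "y \<in> l'" using mem[OF l'(1) xy(1)] mem[OF l'(1) xy(2)] by simp_all
      then have "l' = l" using ex l l'(1) by blast
      then show "m = f ` l" using l' by simp
    qed
  qed
qed

definition transport :: "('p \<Rightarrow> 'q) \<Rightarrow> 'p set \<Rightarrow> 'q set \<Rightarrow> ('p \<Rightarrow> 'p) \<Rightarrow> 'q \<Rightarrow> 'q" where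
  "transport e P P' f = (\<lambda>y\<in>P'. e (f (inv_into P e y)))"

lemma transport_image:
  assumes "bij_betw e P P'" "l \<subseteq> P" shows "transport e P P' f ` e ` l = e ` f ` l"
proof -
  have "transport e P P' f (e x) = e (f x)" if "x \<in> l" for x
    using that assms by (auto simp: transport_def bij_betw_def inv_into_f_f subset_iff)
  then show ?thesis by (force simp: image_image)
qed

lemma in_aut_group_iff:
  "f \<in> carrier (aut_group P L) \<longleftrightarrow> f \<in> extensional P \<and> bij_betw f P P \<and> (\<lambda>l. f ` l) ` L = L"
  by (auto simp: aut_group_def Bij_def)

lemma transport_in_aut_group:
  assumes e: "bij_betw e P P'" and L: "\<And>l. l \<in> L \<Longrightarrow> l \<subseteq> P" and f: "f \<in> carrier (aut_group P L)"
  shows "transport e P P' f \<in> carrier (aut_group P' ((\<lambda>l. e ` l) ` L))"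
  unfolding in_aut_group_iff
proof (intro conjI)
  show "transport e P P' f \<in> extensional P'" by (simp add: transport_def)
  have "bij_betw (e \<circ> (f \<circ> inv_into P e)) P' P'"
    using e f by (intro bij_betw_trans[of _ P' P] bij_betw_trans[of _ P P]) (auto simp: in_aut_group_iff bij_betw_inv_into)
  then show "bij_betw (transport e P P' f) P' P'" by (simp add: transport_def o_def cong: bij_betw_cong)
  have "(\<lambda>l. transport e P P' f ` l) ` (\<lambda>l. e ` l) ` L = (\<lambda>l. e ` f ` l) ` L"
    unfolding image_image[of _ _ L] by (rule image_cong[OF refl]) (rule transport_image[OF e L])
  also have "\<dots> = (\<lambda>l. e ` l) ` (\<lambda>l. f ` l) ` L" by (simp only: image_image)
  also have "\<dots> = (\<lambda>l. e ` l) ` L" using f by (simp only: in_aut_group_iff)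
  finally show "(\<lambda>l. transport e P P' f ` l) ` (\<lambda>l. e ` l) ` L = (\<lambda>l. e ` l) ` L" .
qed

lemma aut_group_iso:
  assumes e: "bij_betw e P P'" and L: "\<And>l. l \<in> L \<Longrightarrow> l \<subseteq> P"
  shows "transport e P P' \<in> iso (aut_group P L) (aut_group P' ((\<lambda>l. e ` l) ` L))"
proof -
  let ?L' = "(\<lambda>l. e ` l) ` L" and ?i = "inv_into P e"
  have i: "bij_betw ?i P' P" using e by (rule bij_betw_inv_into)
  have ie: "?i (e x) = x" if "x \<in> P" for x using e that by (simp add: bij_betw_inv_into_left)
  have ei: "e (?i y) = y" if "y \<in> P'" for y using e that by (simp add: bij_betw_inv_into_right)
  have ic: "?i y \<in> P" if "y \<in> P'" for y using i that by (auto simp: bij_betw_def)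
  have ec: "e x \<in> P'" if "x \<in> P" for x using e that by (auto simp: bij_betw_def)
  have iie: "inv_into P' ?i x = e x" if "x \<in> P" for x
    using bij_betw_inv_into_left[OF i ec[OF that]] ie[OF that] by simp
  have "?i ` e ` l = l" if "l \<in> L" for l
  proof -
    have "?i ` e ` l = (\<lambda>x. x) ` l" unfolding image_image using L[OF that] ie by (intro image_cong) auto
    then show ?thesis by simp
  qed
  then have iL: "(\<lambda>l. ?i ` l) ` ?L' = L" by (simp add: image_image)
  have L': "l \<subseteq> P'" if "l \<in> ?L'" for l using that L ec by auto
  have closed: "f x \<in> P" if "f \<in> carrier (aut_group P L)" "x \<in> P" for f x
    using that by (auto simp: in_aut_group_iff bij_betw_def)
  have closed': "f x \<in> P'" if "f \<in> carrier (aut_group P' ?L')" "x \<in> P'" for f x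
    using that by (auto simp: in_aut_group_iff bij_betw_def)
  have mult: "f \<otimes>\<^bsub>aut_group S M\<^esub> g = compose S f g"
    if "f \<in> carrier (aut_group S M)" "g \<in> carrier (aut_group S M)" for S :: "'z set" and M f g
    using that by (simp add: aut_group_def BijGroup_def)
  show ?thesis
    unfolding iso_def
  proof (intro CollectI conjI homI)
    show "transport e P P' f \<in> carrier (aut_group P' ?L')" if "f \<in> carrier (aut_group P L)" for f
      using transport_in_aut_group[OF e L that] .
    show "transport e P P' (f \<otimes>\<^bsub>aut_group P L\<^esub> g) =
        transport e P P' f \<otimes>\<^bsub>aut_group P' ?L'\<^esub> transport e P P' g"
      if "f \<in> carrier (aut_group P L)" "g \<in> carrier (aut_group P L)" for f g
    proof -
      have "transport e P P' f \<otimes>\<^bsub>aut_group P' ?L'\<^esub> transport e P P' g =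
          compose P' (transport e P P' f) (transport e P P' g)"
        using that by (intro mult transport_in_aut_group[OF e L])
      also have "\<dots> = transport e P P' (compose P f g)"
        using that by (intro ext) (simp add: transport_def compose_def ec ic ie closed)
      finally show ?thesis using mult[OF that] by simp
    qed
    show "bij_betw (transport e P P') (carrier (aut_group P L)) (carrier (aut_group P' ?L'))"
    proof (rule bij_betw_byWitness[where f' = "transport ?i P' P"])
      show "transport e P P' ` carrier (aut_group P L) \<subseteq> carrier (aut_group P' ?L')"
        by (rule image_subsetI) (rule transport_in_aut_group[OF e L])
      show "transport ?i P' P ` carrier (aut_group P' ?L') \<subseteq> carrier (aut_group P L)"
      proof (rule image_subsetI)
        fix f assume "f \<in> carrier (aut_group P' ?L')"
        from transport_in_aut_group[OF i L' this] show "transport ?i P' P f \<in> carrier (aut_group P L)"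
          by (simp only: iL)
      qed
      show "\<forall>f\<in>carrier (aut_group P L). transport ?i P' P (transport e P P' f) = f"
      proof
        fix f assume f: "f \<in> carrier (aut_group P L)"
        show "transport ?i P' P (transport e P P' f) = f"
          by (rule extensionalityI[of _ P])
            (use f in \<open>auto simp: in_aut_group_iff transport_def iie ec ie closed[OF f]\<close>)
      qed
      show "\<forall>f\<in>carrier (aut_group P' ?L'). transport e P P' (transport ?i P' P f) = f"
      proof
        fix f assume f: "f \<in> carrier (aut_group P' ?L')"
        show "transport e P P' (transport ?i P' P f) = f"
          by (rule extensionalityI[of _ P'])
            (use f in \<open>auto simp: in_aut_group_iff transport_def iie ic ei closed'[OF f]\<close>)
      qed
    qed
  qed
qed

lemma flag_transitive_image:
  assumes "\<And>g. g \<in> G \<Longrightarrow> h g \<in> G'"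
    and "\<And>g x. g \<in> G \<Longrightarrow> x \<in> P \<Longrightarrow> h g (e x) = e (g x)"
    and L: "\<And>l. l \<in> L \<Longrightarrow> l \<subseteq> P" and ft: "flag_transitive L G"
  shows "flag_transitive ((\<lambda>l. e ` l) ` L) G'"
  unfolding flag_transitive_def
proof (intro ballI)
  fix l' x' m' y' assume *: "l' \<in> (\<lambda>l. e ` l) ` L" "x' \<in> l'" "m' \<in> (\<lambda>l. e ` l) ` L" "y' \<in> m'"
  obtain l x where l: "l \<in> L" "l' = e ` l" "x \<in> l" "x' = e x" using *(1,2) by blast
  obtain m y where m: "m \<in> L" "m' = e ` m" "y \<in> m" "y' = e y" using *(3,4) by blast
  obtain g where g: "g \<in> G" "g x = y" "g ` l = m"
    using ft[unfolded flag_transitive_def, rule_format, OF l(1,3) m(1,3)] by blast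
  have "h g ` l' = (\<lambda>x. e (g x)) ` l"
    unfolding l(2) image_image using assms(2)[OF g(1)] L[OF l(1)] by (intro image_cong) auto
  also have "\<dots> = m'" by (simp add: m(2) image_image flip: g(3))
  finally have "h g ` l' = m'" .
  moreover have "h g x' = y'" using assms(2)[OF g(1)] L[OF l(1)] l m g by auto
  ultimately show "\<exists>g\<in>G'. g x' = y' \<and> g ` l' = m'" using assms(1)[OF g(1)] by blast
qed

section \<open>Uniqueness\<close>

lemma A0_transitive:
  assumes "Q \<in> pts" "Q' \<in> pts" obtains f where "f \<in> carrier A\<^sub>0" "f Q = Q'"
proof -
  have ex: "\<exists>l. l \<in> dlines \<and> q \<in> l" if "q \<in> pts" for q
    using card_lines_through[OF design2_dlines that] by (metis (mono_tags, lifting) Collect_empty_eq card.empty zero_neq_numeral)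
  obtain l m where l: "l \<in> dlines" "Q \<in> l" and m: "m \<in> dlines" "Q' \<in> m" using ex assms by metis
  show thesis
    using flag_transitive_A0[unfolded flag_transitive_def, rule_format, OF l m] that by blast
qed

text \<open>A subgroup of order 330 contains a subgroup of order 11, which fixes exactly one point; that point is
  fixed by the whole subgroup, because the length of its orbit divides 330 and is congruent to 1 modulo 11.\<close>

lemma order_330_fixes_point:
  assumes S: "subgroup S A\<^sub>0" "card S = 330"
  obtains c where "c \<in> pts" "\<And>g. g \<in> S \<Longrightarrow> g c = c"
proof -
  have finX: "finite S" using S(2) by (metis card.infinite zero_neq_numeral)
  have "group (A\<^sub>0\<lparr>carrier := S\<rparr>)" using S(1) by (rule subgroup.subgroup_is_group) (rule group_A0)
  moreover have "Factorial_Ring.prime (11 :: nat)" by (simp add: prime_nat_numeral_eq)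
  ultimately obtain K where K: "subgroup K (A\<^sub>0\<lparr>carrier := S\<rparr>)" "card K = 11"
    using sylow_thm[of 11 "A\<^sub>0\<lparr>carrier := S\<rparr>" 1 30] S(2) finX by (auto simp: order_def)
  have KX: "K \<subseteq> S" using subgroup.subset[OF K(1)] by simp
  have KA: "subgroup K A\<^sub>0" using A0.incl_subgroup[OF S(1) K(1)] .
  interpret K: subgroup K "A\<^sub>0" by (rule KA)
  have primeK: "Factorial_Ring.prime (card K)" using K(2) \<open>Factorial_Ring.prime 11\<close> by simp
  have "\<not> K \<subseteq> {\<one>\<^bsub>A\<^sub>0\<^esub>}" using card_mono[of "{\<one>\<^bsub>A\<^sub>0\<^esub>}" K] K(2) by auto
  then obtain x where x: "x \<in> K" "x \<noteq> \<one>\<^bsub>A\<^sub>0\<^esub>" by blast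
  have xA: "x \<in> carrier A\<^sub>0" using x by simp
  have x11: "x [^]\<^bsub>A\<^sub>0\<^esub> (11 :: nat) = \<one>\<^bsub>A\<^sub>0\<^esub>"
  proof -
    interpret KG: group "A\<^sub>0\<lparr>carrier := K\<rparr>" using KA by (rule subgroup.subgroup_is_group) (rule group_A0)
    have "x [^]\<^bsub>A\<^sub>0\<lparr>carrier := K\<rparr>\<^esub> (11 :: nat) = \<one>\<^bsub>A\<^sub>0\<^esub>"
      using KG.pow_order_eq_1[of x] x K(2) by (simp add: order_def)
    then show ?thesis by (simp add: A0.nat_pow_consistent[symmetric])
  qed
  have unique: "Q = Q'" if "Q \<in> pts" "Q' \<in> pts" "\<And>g. g \<in> K \<Longrightarrow> g Q = Q" "\<And>g. g \<in> K \<Longrightarrow> g Q' = Q'" for Q Q'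
    using A0_order_11[OF xA x11 x(2)] that x(1) by blast
  have "\<exists>c\<in>pts. \<forall>g\<in>K. g c = c"
  proof (rule ccontr)
    assume *: "\<not> ?thesis"
    \<comment> \<open>Impossible without fixed points, because 496 is congruent to 1 modulo
      11.\<close>
    have "11 dvd card {Q \<in> pts. \<exists>g\<in>K. g Q \<noteq> Q}"
      using pts_act.prime_order_nonfixed[OF KA primeK, of pts] A0_pts K.mem_carrier K(2) by simp
    moreover have "{Q \<in> pts. \<exists>g\<in>K. g Q \<noteq> Q} = pts" using * by blast
    ultimately show False by (simp add: card_pts)
  qed
  then obtain c where c: "c \<in> pts" "\<And>g. g \<in> K \<Longrightarrow> g c = c" by blast
  define Y where "Y = (\<lambda>g. g c) ` S"
  have S_carrier: "g \<in> carrier A\<^sub>0" if "g \<in> S" for g using S(1) that by (meson subgroup.mem_carrier)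
  have Y_pts: "Y \<subseteq> pts" using A0_pts[OF S_carrier c(1)] by (auto simp: Y_def)
  have cY: "c \<in> Y" using c(2)[OF x(1)] x(1) KX unfolding Y_def by (intro image_eqI[of _ _ x]) auto
  have finY: "finite Y" using finX by (simp add: Y_def)
  have closed: "g y \<in> Y" if g: "g \<in> K" and y: "y \<in> Y" for g y
  proof -
    obtain h where h: "h \<in> S" "y = h c" using y by (auto simp: Y_def)
    have "g \<otimes>\<^bsub>A\<^sub>0\<^esub> h \<in> S" using S(1) g h KX by (meson subgroup.m_closed subsetD)
    moreover have "(g \<otimes>\<^bsub>A\<^sub>0\<^esub> h) c = g y" using A0_apply[OF _ S_carrier[OF h(1)] c(1)] g h(2) by simp
    ultimately show ?thesis unfolding Y_def by (intro image_eqI[of _ _ "g \<otimes>\<^bsub>A\<^sub>0\<^esub> h"]) auto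
  qed
  have "card K dvd card {y \<in> Y. \<exists>g\<in>K. g y \<noteq> y}"
    by (rule pts_act.prime_order_nonfixed[OF KA primeK finY Y_pts]) (rule closed)
  moreover have "{y \<in> Y. \<exists>g\<in>K. g y \<noteq> y} = Y - {c}" using c unique Y_pts by blast
  ultimately have "11 dvd card Y - 1" using cY finY K(2) by simp
  then obtain k where k: "card Y - 1 = 11 * k" by (rule dvdE)
  have "card Y \<noteq> 0" using cY finY by auto
  then have cardY: "card Y = 11 * k + 1" using k by arith
  have "11 * 30 = card Y * card (pts_act.stab S c)" using pts_act.orbit_stab[OF S(1) finX c(1)] S(2) by (simp add: Y_def)
  then have "card Y dvd 11 * 30" by (rule dvdI)
  moreover have "coprime (card Y) 11"
  proof -
    have "\<not> 11 dvd card Y" unfolding cardY by presburger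
    then show ?thesis using prime_imp_coprime[OF \<open>Factorial_Ring.prime 11\<close>] by (simp add: coprime_commute)
  qed
  ultimately have dvd: "card Y dvd 30" by (metis coprime_dvd_mult_right_iff)
  \<comment> \<open>The candidates for the orbit length are 1, 12 and 23, of which only 1 divides
    30.\<close>
  then have "11 * k + 1 \<le> 30" using dvd_imp_le[OF dvd] cardY by simp
  then have "k = 0 \<or> k = 1 \<or> k = 2" by arith
  then have "k = 0" using dvd cardY by auto
  then obtain z where "Y = {z}" using cardY by (auto simp: card_1_singleton_iff)
  then have "Y = {c}" using cY by auto
  then show thesis using c(1) by (intro that[of c]) (auto simp: Y_def)
qed

theorem flag_transitive_design_unique:
  fixes P :: "'p set" and H :: "'h monoid"
  assumes D: "design2 496 4 P L" and adm: "admits_flag_transitive P L H" and H: "H \<cong> A\<^sub>0"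
  shows "design_iso P L pts dlines"
proof -
  have L_sub: "l \<subseteq> P" if "l \<in> L" for l using D that by (auto simp: design2_def)
  have gAut: "group (aut_group P L)" by (rule group_aut_group) (rule L_sub)
  obtain G where G: "subgroup G (aut_group P L)" "flag_transitive L G" "aut_group P L \<lparr>carrier := G\<rparr> \<cong> H"
    using adm unfolding admits_flag_transitive_def by blast
  let ?G = "aut_group P L \<lparr>carrier := G\<rparr>"
  have gG: "group ?G" using G(1) gAut by (rule subgroup.subgroup_is_group)
  have "A\<^sub>0 \<cong> ?G" using group.iso_sym[OF gG iso_trans[OF G(3) H]] .
  then obtain \<theta> where \<theta>: "\<theta> \<in> iso A\<^sub>0 ?G" unfolding is_iso_def by blast
  have \<theta>_hom: "\<theta> \<in> hom A\<^sub>0 ?G" and \<theta>_im: "\<theta> ` carrier A\<^sub>0 = G" using \<theta> by (auto simp: iso_def bij_betw_def)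
  have \<theta>_G: "\<theta> g \<in> G" if "g \<in> carrier A\<^sub>0" for g using \<theta>_im that by blast
  have G_Aut: "k \<in> carrier (aut_group P L)" if "k \<in> G" for k using G(1) that by (meson subgroup.mem_carrier)
  have G_P: "k x \<in> P" if "k \<in> G" "x \<in> P" for k x
    using G_Aut[OF that(1)] that(2) by (auto simp: in_aut_group_iff bij_betw_def)
  have G_L: "k ` l \<in> L" if "k \<in> G" "l \<in> L" for k l
    using G_Aut[OF that(1)] that(2) by (auto simp: in_aut_group_iff)
  have \<theta>_mult: "\<theta> (g \<otimes>\<^bsub>A\<^sub>0\<^esub> h) = compose P (\<theta> g) (\<theta> h)" if "g \<in> carrier A\<^sub>0" "h \<in> carrier A\<^sub>0" for g h
    using hom_mult[OF \<theta>_hom that] G_Aut[OF \<theta>_G[OF that(1)]] G_Aut[OF \<theta>_G[OF that(2)]]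
    by (simp add: aut_group_def BijGroup_def)
  have \<theta>_one: "\<theta> \<one>\<^bsub>A\<^sub>0\<^esub> = (\<lambda>x\<in>P. x)"
    using hom_one[OF \<theta>_hom group_A0 gG] by (simp add: aut_group_def BijGroup_def)
  interpret T: set_action "A\<^sub>0" \<theta> P
    by unfold_locales (simp_all add: G_P \<theta>_G \<theta>_one \<theta>_mult compose_eq)
  have ex_line: "\<exists>l. l \<in> L \<and> x \<in> l" if "x \<in> P" for x
    using card_lines_through[OF D that] by (metis (mono_tags, lifting) Collect_empty_eq card.empty zero_neq_numeral)
  have trans: "\<exists>g\<in>carrier A\<^sub>0. \<theta> g x = y" if xy: "x \<in> P" "y \<in> P" for x y
  proof -
    obtain l where l: "l \<in> L" "x \<in> l" using ex_line[OF xy(1)] by blast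
    obtain m where m: "m \<in> L" "y \<in> m" using ex_line[OF xy(2)] by blast
    obtain k where "k \<in> G" "k x = y" using G(2)[unfolded flag_transitive_def, rule_format, OF l m] by blast
    then show ?thesis using \<theta>_im by blast
  qed
  have cP: "card P = 496" and finP: "finite P" using D by (simp_all add: design2_def)
  then obtain p where p: "p \<in> P" by fastforce
  define S where "S = T.stab (carrier A\<^sub>0) p"
  have S: "subgroup S A\<^sub>0" unfolding S_def by (rule T.subgroup_stab[OF A0.subgroup_self p])
  have "(\<lambda>g. \<theta> g p) ` carrier A\<^sub>0 = P"
  proof
    show "(\<lambda>g. \<theta> g p) ` carrier A\<^sub>0 \<subseteq> P" using T.act_closed[OF _ p] by blast
    show "P \<subseteq> (\<lambda>g. \<theta> g p) ` carrier A\<^sub>0"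
    proof
      fix q assume "q \<in> P"
      then obtain g where "g \<in> carrier A\<^sub>0" "\<theta> g p = q" using trans[OF p] by blast
      then show "q \<in> (\<lambda>g. \<theta> g p) ` carrier A\<^sub>0" by (intro image_eqI[of _ _ g]) simp_all
    qed
  qed
  then have card_S: "card S = 330"
    using T.orbit_stab[OF A0.subgroup_self finite_A0 p] by (simp add: order_A0 cP S_def)
  obtain c where c: "c \<in> pts" "\<And>g. g \<in> S \<Longrightarrow> g c = c"
    by (rule order_330_fixes_point[OF S card_S]) blast
  \<comment> \<open>Any group element carrying \<open>p\<close> to \<open>q\<close> gives the same
    value, because the stabilizer \<open>S\<close> of \<open>p\<close> fixes
    \<open>c\<close>.\<close>
  define f where "f q = (SOME g. g \<in> carrier A\<^sub>0 \<and> \<theta> g p = q) c" for q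
  have f_eq: "f (\<theta> g p) = g c" if g: "g \<in> carrier A\<^sub>0" for g
  proof -
    define h where "h = (SOME h. h \<in> carrier A\<^sub>0 \<and> \<theta> h p = \<theta> g p)"
    have h: "h \<in> carrier A\<^sub>0" "\<theta> h p = \<theta> g p"
      unfolding h_def using someI[of "\<lambda>h. h \<in> carrier A\<^sub>0 \<and> \<theta> h p = \<theta> g p" g] g by simp_all
    let ?k = "inv\<^bsub>A\<^sub>0\<^esub> h \<otimes>\<^bsub>A\<^sub>0\<^esub> g"
    have "\<theta> ?k p = p" using g h p T.act_inv(1)[OF h(1) p] T.act_mult[of "inv\<^bsub>A\<^sub>0\<^esub> h" g p] by simp
    then have "?k \<in> S" using g h by (simp add: S_def T.stab_def)
    then have "?k c = c" by (rule c(2))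
    then have "h c = h (?k c)" by simp
    also have "\<dots> = (h \<otimes>\<^bsub>A\<^sub>0\<^esub> ?k) c" using g h c(1) by (simp add: A0_apply)
    also have "h \<otimes>\<^bsub>A\<^sub>0\<^esub> ?k = g" using g h by (simp flip: A0.m_assoc)
    finally show ?thesis by (simp add: f_def flip: h_def)
  qed
  have f_equivariant: "g (f q) = f (\<theta> g q)" if g: "g \<in> carrier A\<^sub>0" and q: "q \<in> P" for g q
  proof -
    obtain h where h: "h \<in> carrier A\<^sub>0" "\<theta> h p = q" using trans[OF p q] by blast
    have "\<theta> g q = \<theta> (g \<otimes>\<^bsub>A\<^sub>0\<^esub> h) p" using T.act_mult[OF g h(1) p] h(2) by simp
    then have "f (\<theta> g q) = (g \<otimes>\<^bsub>A\<^sub>0\<^esub> h) c" using f_eq[of "g \<otimes>\<^bsub>A\<^sub>0\<^esub> h"] g h by simp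
    also have "\<dots> = g (f q)" using f_eq[OF h(1)] h(2) by (simp add: A0_apply g h(1) c(1))
    finally show ?thesis by simp
  qed
  have "f ` P = pts"
  proof
    show "f ` P \<subseteq> pts"
    proof (rule image_subsetI)
      fix q assume "q \<in> P"
      then obtain h where h: "h \<in> carrier A\<^sub>0" "\<theta> h p = q" using trans[OF p] by blast
      then show "f q \<in> pts" using f_eq[OF h(1)] A0_pts[OF h(1) c(1)] by simp
    qed
    show "pts \<subseteq> f ` P"
    proof
      fix Q assume "Q \<in> pts"
      then obtain g where g: "g \<in> carrier A\<^sub>0" "g c = Q" using A0_transitive[OF c(1)] by metis
      then show "Q \<in> f ` P" using f_eq[OF g(1)] T.act_closed[OF g(1) p] by (intro image_eqI[of _ _ "\<theta> g p"]) simp_all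
    qed
  qed
  then have bij_f: "bij_betw f P pts"
    using eq_card_imp_inj_on[OF finP, of f] by (simp add: bij_betw_def cP card_pts)
  interpret I: invariant_design "(\<lambda>l. f ` l) ` L"
  proof
    show "design2 496 4 pts ((\<lambda>l. f ` l) ` L)" by (rule design2_image[OF D bij_f])
    show "g ` m \<in> (\<lambda>l. f ` l) ` L" if g: "g \<in> carrier A\<^sub>0" and m: "m \<in> (\<lambda>l. f ` l) ` L" for g m
    proof -
      obtain l where l: "l \<in> L" "m = f ` l" using m by blast
      have "g ` m = (\<lambda>q. f (\<theta> g q)) ` l"
        unfolding l(2) image_image using f_equivariant[OF g] L_sub[OF l(1)] by (intro image_cong) auto
      also have "\<dots> = f ` \<theta> g ` l" by (simp add: image_image)
      finally show ?thesis using G_L[OF \<theta>_G[OF g] l(1)] by simp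
    qed
    let ?\<eta> = "inv_into (carrier A\<^sub>0) \<theta>"
    have \<eta>: "?\<eta> k \<in> carrier A\<^sub>0" "\<theta> (?\<eta> k) = k" if "k \<in> G" for k
      using that by (simp_all add: inv_into_into f_inv_into_f flip: \<theta>_im)
    show "flag_transitive ((\<lambda>l. f ` l) ` L) (carrier A\<^sub>0)"
    proof (rule flag_transitive_image[where h = ?\<eta> and P = P])
      show "?\<eta> k \<in> carrier A\<^sub>0" if "k \<in> G" for k using \<eta> that by simp
      show "?\<eta> k (f x) = f (k x)" if "k \<in> G" "x \<in> P" for k x
        using f_equivariant[OF \<eta>(1)[OF that(1)] that(2)] \<eta>(2)[OF that(1)] by simp
    qed (use L_sub G(2) in auto)
  qed
  show ?thesis unfolding design_iso_def using bij_f I.L_eq_dlines by blast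
qed

theorem mainTheorem2:
  fixes F :: "'f ring"
  assumes "field F" and "order F = 2 ^ 5"
  shows "\<exists>(P\<^sub>0 :: nat set) L\<^sub>0.
           design2 496 4 P\<^sub>0 L\<^sub>0 \<and>
           admits_flag_transitive P\<^sub>0 L\<^sub>0 (PGammaL2 F) \<and>
           (\<forall>(P :: 'p set) L.
              design2 496 4 P L \<and> admits_flag_transitive P L (PGammaL2 F) \<longrightarrow>
              design_iso P L P\<^sub>0 L\<^sub>0) \<and>
           aut_group P\<^sub>0 L\<^sub>0 \<cong> PGammaL2 F"
proof -
  interpret F: field F by (fact assms(1))
  have order: "order F = 32" using assms(2) by simp
  obtain \<phi> where "gf32_model F \<phi>"
    using F.gf32_model_exists[OF F.char_2_of_order_32[OF order] order] by blast
  then interpret M: gf32_model F \<phi> .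
  have FA: "PGammaL2 F \<cong> A\<^sub>0" by (rule M.PGammaL2_iso_A0)
  \<comment> \<open>The forms are numbered, because the model design is to have natural numbers as
    points.\<close>
  obtain e :: "form \<Rightarrow> nat" where e: "inj_on e pts"
    using finite_imp_inj_to_nat_seg[of pts] by auto
  define P\<^sub>0 where "P\<^sub>0 = e ` pts"
  define L\<^sub>0 where "L\<^sub>0 = (\<lambda>l. e ` l) ` dlines"
  have bij_e: "bij_betw e pts P\<^sub>0" using e by (simp add: bij_betw_def P\<^sub>0_def)
  have D: "design2 496 4 P\<^sub>0 L\<^sub>0" unfolding L\<^sub>0_def by (rule design2_image[OF design2_dlines bij_e])
  have iso: "transport e pts P\<^sub>0 \<in> iso A\<^sub>0 (aut_group P\<^sub>0 L\<^sub>0)"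
    unfolding L\<^sub>0_def by (rule aut_group_iso[OF bij_e dlines_sub])
  have A0_iso: "aut_group P\<^sub>0 L\<^sub>0 \<cong> A\<^sub>0"
    using A0.iso_sym[of "aut_group P\<^sub>0 L\<^sub>0"] iso by (auto simp: is_iso_def)
  have aut: "aut_group P\<^sub>0 L\<^sub>0 \<cong> PGammaL2 F"
    using iso_trans[OF A0_iso group.iso_sym[OF F.group_PGammaL2 FA]] .
  have "group (aut_group P\<^sub>0 L\<^sub>0)" using D by (intro group_aut_group) (simp add: design2_def)
  then have sub: "subgroup (carrier (aut_group P\<^sub>0 L\<^sub>0)) (aut_group P\<^sub>0 L\<^sub>0)" by (rule group.subgroup_self)
  have "flag_transitive L\<^sub>0 (carrier (aut_group P\<^sub>0 L\<^sub>0))"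
    unfolding L\<^sub>0_def
  proof (rule flag_transitive_image[where h = "transport e pts P\<^sub>0" and P = pts and G = "carrier A\<^sub>0"])
    show "transport e pts P\<^sub>0 g \<in> carrier (aut_group P\<^sub>0 ((\<lambda>l. e ` l) ` dlines))" if "g \<in> carrier A\<^sub>0" for g
      using transport_in_aut_group[OF bij_e dlines_sub that] .
    show "transport e pts P\<^sub>0 g (e x) = e (g x)" if "x \<in> pts" for g x
      using that bij_e by (simp add: transport_def bij_betw_inv_into_left bij_betw_apply)
  qed (use dlines_sub flag_transitive_A0 in auto)
  then have adm: "admits_flag_transitive P\<^sub>0 L\<^sub>0 (PGammaL2 F)"
    unfolding admits_flag_transitive_def using sub aut by (intro exI[of _ "carrier (aut_group P\<^sub>0 L\<^sub>0)"]) simp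
  have "design_iso P L P\<^sub>0 L\<^sub>0"
    if PL: "design2 496 4 P L" "admits_flag_transitive P L (PGammaL2 F)" for P :: "'p set" and L
  proof -
    obtain f where f: "bij_betw f P pts" "(\<lambda>l. f ` l) ` L = dlines"
      using flag_transitive_design_unique[OF PL FA] by (auto simp: design_iso_def)
    have "bij_betw (e \<circ> f) P P\<^sub>0" using f(1) bij_e by (rule bij_betw_trans)
    moreover have "(\<lambda>l. (e \<circ> f) ` l) ` L = L\<^sub>0"
      unfolding L\<^sub>0_def f(2)[symmetric] by (simp add: image_image)
    ultimately show ?thesis unfolding design_iso_def by blast
  qed
  with D adm aut show ?thesis by blast
qed

end
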